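(* Let $T\colon R^{p,0}_\omega\to R^{p,0}_\omega$ be a bounded linear operator and $0<\epsilon<1$. Then either $T$ or $I-T$ is a $\frac{4}{1-\epsilon}(p^*-1)^2\big(\frac{p^*}{2}\big)^{3/2}$-factor of the identity $I$ on $R^{p,0}_\omega$; that is, for $S=T$ or $S=I-T$ there exist bounded operators $A,B$ on $R^{p,0}_\omega$ with $ASB=I$ and $\|A\|\|B\|\le\frac{4}{1-\epsilon}(p^*-1)^2\big(\frac{p^*}{2}\big)^{3/2}$.
   Context: Fix $1<p<\infty$, $q=p/(p-1)$, $p^*=\max\{p,q\}$. All $L_r$ spaces are over $[0,1]$ with Lebesgue measure. A dyadic interval is $[(i-1)2^{-n},i2^{-n})$, $n\ge0$, $1\le i\le2^n$; $\mathcal D^n$ is the set of those of length $2^{-n}$ and $\mathcal D_n=\bigcup_{k=0}^n\mathcal D^k$. For a dyadic interval $I$, $I^+,I^-$ are its left and right halves and $h_I=\chi_{I^+}-\chi_{I^-}$. For each $n\in\mathbb N$ a family $(h^n_I)_{I\in\mathcal D_{n-1}}$ in $L_p$ is fixed with the same joint distribution as $(h_I)_{I\in\mathcal D_{n-1}}$, such that the $\sigma$-algebras $\sigma(h^n_I:I\in\mathcal D_{n-1})$, $n\in\mathbb N$, are independent. Let $\mathcal D_\omega=\{(n,I):n\in\mathbb N,I\in\mathcal D_{n-1}\}$. $R^{p,0}_\omega$ is the closed linear span of $\{h^n_I:(n,I)\in\mathcal D_\omega\}$ in $L_p$ (a distributional copy of the mean-zero hyperplane of the Bourgain–Rosenthal–Schechtman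 space $R^p_\omega$). *)

theory Defs
  imports "HOL-Probability.Probability"
begin

definition unitM :: "real measure" where
  "unitM = restrict_space lborel {0..1}"

text \<open>Dyadic intervals are coded as pairs (k,i), meaning [(i-1) 2^-k, i 2^-k), 1 <= i <= 2^k.\<close>
definition dyadic_upto :: "nat \<Rightarrow> (nat \<times> nat) set" where
  "dyadic_upto n = {(k, i). k \<le> n \<and> 1 \<le> i \<and> i \<le> 2 ^ k}"

definition dyad_interval :: "nat \<times> nat \<Rightarrow> real set" where
  "dyad_interval I = (case I of (k, i) \<Rightarrow> {(real i - 1) / 2 ^ k ..< real i / 2 ^ k})"

definition dyad_left :: "nat \<times> nat \<Rightarrow> real set" where
  "dyad_left I = (case I of (k, i) \<Rightarrow> {(real i - 1) / 2 ^ k ..< (2 * real i - 1) / 2 ^ (k + 1)})"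

definition dyad_right :: "nat \<times> nat \<Rightarrow> real set" where
  "dyad_right I = (case I of (k, i) \<Rightarrow> {(2 * real i - 1) / 2 ^ (k + 1) ..< real i / 2 ^ k})"

definition haar :: "nat \<times> nat \<Rightarrow> real \<Rightarrow> real" where
  "haar I x = indicator (dyad_left I) x - indicator (dyad_right I) x"

definition D_omega :: "(nat \<times> (nat \<times> nat)) set" where
  "D_omega = {(n, I). 1 \<le> n \<and> I \<in> dyadic_upto (n - 1)}"

definition BRS_family :: "(nat \<Rightarrow> nat \<times> nat \<Rightarrow> real \<Rightarrow> real) \<Rightarrow> bool" where
  "BRS_family h \<longleftrightarrow>
     (\<forall>n\<ge>1. \<forall>I\<in>dyadic_upto (n - 1). h n I \<in> borel_measurable unitM) \<and>
     (\<forall>n\<ge>1. distr unitM (PiM (dyadic_upto (n - 1)) (\<lambda>_. borel)) (\<lambda>x. \<lambda>I\<in>dyadic_upto (n - 1). h n I x)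
          = distr unitM (PiM (dyadic_upto (n - 1)) (\<lambda>_. borel)) (\<lambda>x. \<lambda>I\<in>dyadic_upto (n - 1). haar I x)) \<and>
     prob_space.indep_vars unitM (\<lambda>n. PiM (dyadic_upto (n - 1)) (\<lambda>_. borel))
        (\<lambda>n x. \<lambda>I\<in>dyadic_upto (n - 1). h n I x) {n. 1 \<le> n}"

definition in_Lp :: "real \<Rightarrow> (real \<Rightarrow> real) \<Rightarrow> bool" where
  "in_Lp p f \<longleftrightarrow> f \<in> borel_measurable unitM \<and> integrable unitM (\<lambda>x. \<bar>f x\<bar> powr p)"

definition Lp_norm :: "real \<Rightarrow> (real \<Rightarrow> real) \<Rightarrow> real" where
  "Lp_norm p f = (\<integral>x. \<bar>f x\<bar> powr p \<partial>unitM) powr (1 / p)"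

definition R_p0_omega :: "real \<Rightarrow> (nat \<Rightarrow> nat \<times> nat \<Rightarrow> real \<Rightarrow> real) \<Rightarrow> (real \<Rightarrow> real) set" where
  "R_p0_omega p h = {f. in_Lp p f \<and>
     (\<forall>e>0. \<exists>F c. finite F \<and> F \<subseteq> D_omega \<and>
        Lp_norm p (\<lambda>x. f x - (\<Sum>(n, I)\<in>F. c (n, I) * h n I x)) < e)}"

definition bounded_op_on :: "real \<Rightarrow> (real \<Rightarrow> real) set \<Rightarrow> ((real \<Rightarrow> real) \<Rightarrow> (real \<Rightarrow> real)) \<Rightarrow> bool" where
  "bounded_op_on p V T \<longleftrightarrow>
     (\<forall>f\<in>V. T f \<in> V) \<and>
     (\<forall>f\<in>V. \<forall>g\<in>V. \<forall>a b. AE x in unitM. T (\<lambda>y. a * f y + b * g y) x = a * T f x + b * T g x) \<and>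
     (\<exists>C. \<forall>f\<in>V. Lp_norm p (T f) \<le> C * Lp_norm p f)"

definition op_norm_on :: "real \<Rightarrow> (real \<Rightarrow> real) set \<Rightarrow> ((real \<Rightarrow> real) \<Rightarrow> (real \<Rightarrow> real)) \<Rightarrow> real" where
  "op_norm_on p V T = Sup {Lp_norm p (T f) | f. f \<in> V \<and> Lp_norm p f \<le> 1}"

definition conj_exp :: "real \<Rightarrow> real" where
  "conj_exp p = p / (p - 1)"

definition p_star :: "real \<Rightarrow> real" where
  "p_star p = max p (conj_exp p)"

end

theory Submission
  imports Defs "HOL-Library.Ramsey"
begin

text \<open>
  Up to null sets, the \<open>n\<close>-th copy of the Haar system generates the same \<open>\<sigma>\<close>-algebra as a uniformly
  distributed random subset of \<open>{..<n}\<close> (the signs of its \<open>n\<close> Rademacher functions), and the space is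
  the closed span of the nonconstant Walsh functions of these independent random subsets.

  Given \<open>T\<close>, one looks inside the \<open>m\<close>-th copy, \<open>m\<close> large, for a distributional copy of the \<open>n\<close>-th one
  on which \<open>T\<close> acts almost like a scalar. Averaging over signs shows that each row and column of the
  Walsh matrix of \<open>T\<close> has boundedly many entries above a given size; Ramsey's theorem makes its diagonal
  depend only on the cardinality of the frequency, and a union bound removes the off-diagonal. The
  embedded copy reads its coordinates through a multiplexer with a long address. The address spreads the
  cardinalities of the frequencies binomially, so that the diagonal becomes almost constant. The limit
  scalar \<open>c\<close> can be taken to be the same for all \<open>n\<close>, and either \<open>c\<close> or \<open>1 - c\<close> is at least \<open>1/2\<close>.

  Since every embedded copy lives in a single block, the embedding \<open>B\<close> is isometric and the map \<open>A\<close> in the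
  other direction is a conditional expectation, hence a contraction, so that \<open>A T B\<close> is within \<open>1/4\<close> of
  \<open>c\<close> times the identity. This yields a factorization with constant \<open>4\<close>, which is at most the constant
  claimed because \<open>p* \<ge> 2\<close>.
\<close>

section \<open>The spaces \<open>L\<^sub>p\<close>\<close>

text \<open>Choosing coordinates alone can never finish the argument. The noise operator, which
  multiplies the Walsh function of \<open>F\<close> by \<open>\<rho> ^ card F\<close>, looks the
  same on every set of coordinates, so restricting to a subcube brings it no closer to a scalar.
  Each embedded function must therefore mix Walsh functions of many cardinalities, in proportions
  that hardly change when \<open>card F\<close> grows by one. This is what the address provides: the
  binomial law with \<open>l\<close> trials moves by only O(1 / sqrt l) in total variation under a
  shift by one. Walsh functions suit the argument because they are bounded by 1 and orthogonal: a
  coefficient is at most the norm, and a bounded functional is large on boundedly many of them,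
  whether they enter as arguments of \<open>T\<close> or as test functions. The errors of the matrix
  entries are made summable with total at most 1/4 = 1/2 * 1/2, so that the passage from entries to
  operator norms takes only the triangle inequality and the contractivity of conditional
  expectations.\<close>

lemma prob_space_unitM: "prob_space unitM"
  unfolding unitM_def by (rule prob_space_restrict_space) auto

interpretation unitM: prob_space unitM
  by (rule prob_space_unitM)

lemma convex_abs_powr:
  fixes p :: real
  assumes "1 \<le> p"
  shows "convex_on UNIV (\<lambda>x::real. \<bar>x\<bar> powr p)"
proof (rule convex_onI)
  fix t x y :: real
  assume t: "0 < t" "t < 1"
  have one: "(s * \<bar>z\<bar>) powr p \<le> s * \<bar>z\<bar> powr p" if "0 < s" "s < 1" for s z :: real
  proof -
    have "s powr p \<le> s powr 1"
      using that assms by (intro powr_mono') auto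
    then show ?thesis
      using that by (simp add: powr_mult mult_right_mono)
  qed
  have "\<bar>(1 - t) *\<^sub>R x + t *\<^sub>R y\<bar> powr p \<le> ((1 - t) * \<bar>x\<bar> + t * \<bar>y\<bar>) powr p"
  proof (rule powr_mono2)
    have "\<bar>(1 - t) * x + t * y\<bar> \<le> \<bar>(1 - t) * x\<bar> + \<bar>t * y\<bar>"
      by (rule abs_triangle_ineq)
    then show "\<bar>(1 - t) *\<^sub>R x + t *\<^sub>R y\<bar> \<le> (1 - t) * \<bar>x\<bar> + t * \<bar>y\<bar>"
      using t by (simp add: abs_mult)
  qed (use assms in auto)
  also have "\<dots> \<le> (1 - t) * \<bar>x\<bar> powr p + t * \<bar>y\<bar> powr p"
  proof -
    \<comment> \<open>At a zero argument the claim reduces to \<open>s powr p \<le> s\<close> for 0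
      < s < 1; convexity on the positive half line covers the rest.\<close>
    consider "x = 0" | "y = 0" | "x \<noteq> 0" "y \<noteq> 0" by auto
    then show ?thesis
    proof cases
      case 1 then show ?thesis using one[of t y] t assms by simp
    next
      case 2 then show ?thesis using one[of "1 - t" x] t assms by simp
    next
      case 3
      then show ?thesis
        using convex_onD[OF powr_convex[OF assms], of t "\<bar>x\<bar>" "\<bar>y\<bar>"] t by auto
    qed
  qed
  finally show "\<bar>(1 - t) *\<^sub>R x + t *\<^sub>R y\<bar> powr p \<le> (1 - t) * \<bar>x\<bar> powr p + t * \<bar>y\<bar> powr p" .
qed auto

lemma in_Lp_measurable [measurable_dest]: "in_Lp p f \<Longrightarrow> f \<in> borel_measurable unitM"
  by (simp add: in_Lp_def)

lemma in_Lp_integrable_powr: "in_Lp p f \<Longrightarrow> integrable unitM (\<lambda>x. \<bar>f x\<bar> powr p)"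
  by (simp add: in_Lp_def)

lemma Lp_norm_nonneg: "0 \<le> Lp_norm p f"
  by (simp add: Lp_norm_def)

lemma Lp_norm_powr: "p \<noteq> 0 \<Longrightarrow> Lp_norm p f powr p = (\<integral>x. \<bar>f x\<bar> powr p \<partial>unitM)"
  by (simp add: Lp_norm_def powr_powr)

lemma Lp_norm_le_iff:
  assumes "0 < p" "0 \<le> a"
  shows "Lp_norm p f \<le> a \<longleftrightarrow> (\<integral>x. \<bar>f x\<bar> powr p \<partial>unitM) \<le> a powr p"
  using assms powr_mono2[of p "Lp_norm p f" a] powr_less_mono2[of p a "Lp_norm p f"]
    Lp_norm_powr[of p f] Lp_norm_nonneg[of p f] by force

lemma Lp_norm_cong_AE:
  assumes "AE x in unitM. f x = g x" "f \<in> borel_measurable unitM" "g \<in> borel_measurable unitM"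
  shows "Lp_norm p f = Lp_norm p g"
  unfolding Lp_norm_def using assms by (subst integral_cong_AE[of _ _ "\<lambda>x. \<bar>g x\<bar> powr p"]) auto

lemma in_Lp_cong_AE:
  assumes "AE x in unitM. f x = g x" "f \<in> borel_measurable unitM" "in_Lp p g"
  shows "in_Lp p f"
proof -
  have [measurable]: "f \<in> borel_measurable unitM" "g \<in> borel_measurable unitM"
    using assms by (auto simp: in_Lp_def)
  have "integrable unitM (\<lambda>x. \<bar>f x\<bar> powr p) \<longleftrightarrow> integrable unitM (\<lambda>x. \<bar>g x\<bar> powr p)"
    by (rule integrable_cong_AE) (use assms(1) in auto)
  then show ?thesis using assms by (simp add: in_Lp_def)
qed

lemma in_Lp_cmult: "in_Lp p f \<Longrightarrow> in_Lp p (\<lambda>x. c * f x)"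
  by (auto simp: in_Lp_def abs_mult powr_mult)

lemma in_Lp_add:
  assumes p: "1 \<le> p" and "in_Lp p f" "in_Lp p g"
  shows "in_Lp p (\<lambda>x. f x + g x)"
proof -
  have [measurable]: "f \<in> borel_measurable unitM" "g \<in> borel_measurable unitM"
    using assms by (auto simp: in_Lp_def)
  have bound: "\<bar>a + b\<bar> powr p \<le> \<bar>2 * a\<bar> powr p + \<bar>2 * b\<bar> powr p" for a b :: real
  proof -
    have "\<bar>a + b\<bar> powr p \<le> \<bar>2 * a\<bar> powr p / 2 + \<bar>2 * b\<bar> powr p / 2"
      using convex_onD[OF convex_abs_powr[OF p], of "1/2" "2 * a" "2 * b"] by simp
    moreover have "0 \<le> \<bar>2 * a\<bar> powr p" "0 \<le> \<bar>2 * b\<bar> powr p" by (rule powr_ge_zero)+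
    ultimately show ?thesis by linarith
  qed
  have "integrable unitM (\<lambda>x. \<bar>2 * f x\<bar> powr p + \<bar>2 * g x\<bar> powr p)"
    using in_Lp_cmult[OF assms(2), of 2] in_Lp_cmult[OF assms(3), of 2]
    by (auto simp: in_Lp_def)
  then have "integrable unitM (\<lambda>x. \<bar>f x + g x\<bar> powr p)"
    by (rule Bochner_Integration.integrable_bound) (use bound in \<open>auto intro!: AE_I2 order_trans[OF bound]\<close>)
  then show ?thesis by (simp add: in_Lp_def)
qed

lemma in_Lp_lincomb:
  assumes "1 \<le> p" "in_Lp p f" "in_Lp p g"
  shows "in_Lp p (\<lambda>x. a * f x + b * g x)"
  using in_Lp_add[OF assms(1) in_Lp_cmult[OF assms(2)] in_Lp_cmult[OF assms(3)]] .

lemma in_Lp_diff: "1 \<le> p \<Longrightarrow> in_Lp p f \<Longrightarrow> in_Lp p g \<Longrightarrow> in_Lp p (\<lambda>x. f x - g x)"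
  using in_Lp_lincomb[of p f g 1 "-1"] by simp

lemma in_Lp_bounded:
  assumes "f \<in> borel_measurable unitM" "\<And>x. \<bar>f x\<bar> \<le> C" "0 \<le> p"
  shows "in_Lp p f"
proof -
  have "integrable unitM (\<lambda>x. \<bar>f x\<bar> powr p)"
    by (rule unitM.integrable_const_bound[where B="C powr p"]) (use assms in \<open>auto intro!: powr_mono2\<close>)
  then show ?thesis using assms by (simp add: in_Lp_def)
qed

lemma in_Lp_zero: "in_Lp p (\<lambda>x. 0)"
  by (simp add: in_Lp_def)

lemma in_Lp_sum:
  assumes "1 \<le> p" "\<And>i. i \<in> X \<Longrightarrow> in_Lp p (f i)"
  shows "in_Lp p (\<lambda>x. \<Sum>i\<in>X. c i * f i x)"
proof (cases "finite X")
  case True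
  then show ?thesis using assms(2)
    by induction (auto simp: in_Lp_zero intro!: in_Lp_add[OF assms(1)] in_Lp_cmult)
qed (simp add: in_Lp_zero)

lemma Lp_norm_bounded:
  assumes p: "0 < p" and "f \<in> borel_measurable unitM" "\<And>x. \<bar>f x\<bar> \<le> C"
  shows "Lp_norm p f \<le> C"
proof -
  have C: "0 \<le> C" using assms(3)[of 0] by linarith
  have "(\<integral>x. \<bar>f x\<bar> powr p \<partial>unitM) \<le> (\<integral>x. C powr p \<partial>unitM)"
    by (rule integral_mono) (use in_Lp_bounded[OF assms(2,3)] p assms(3) in \<open>auto simp: in_Lp_def intro!: powr_mono2\<close>)
  then show ?thesis using C p by (simp add: Lp_norm_le_iff unitM.prob_space)
qed

lemma Lp_norm_cmult:
  assumes "p \<noteq> 0"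
  shows "Lp_norm p (\<lambda>x. c * f x) = \<bar>c\<bar> * Lp_norm p f"
  using assms by (simp add: Lp_norm_def abs_mult powr_mult powr_powr)

lemma Lp_norm_minus_commute: "Lp_norm p (\<lambda>x. f x - g x) = Lp_norm p (\<lambda>x. g x - f x)"
  by (simp add: Lp_norm_def abs_minus_commute)

lemma Lp_norm_zero [simp]: "Lp_norm p (\<lambda>x. 0) = 0"
  by (simp add: Lp_norm_def)

lemma Lp_norm_eq_0_AE:
  assumes "in_Lp p f" "Lp_norm p f = 0"
  shows "AE x in unitM. f x = 0"
proof -
  have "(\<integral>x. \<bar>f x\<bar> powr p \<partial>unitM) = 0"
    using assms(2) by (simp add: Lp_norm_def)
  then have "AE x in unitM. \<bar>f x\<bar> powr p = 0"
    using assms(1) by (subst (asm) integral_nonneg_eq_0_iff_AE) (auto simp: in_Lp_def)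
  then show ?thesis by auto
qed

lemma AE_0_Lp_norm:
  assumes "f \<in> borel_measurable unitM" "AE x in unitM. f x = 0"
  shows "Lp_norm p f = 0"
  using Lp_norm_cong_AE[of f "\<lambda>x. 0" p] assms by simp

text \<open>Normalization: with \<open>a\<close> and \<open>b\<close> slightly above the two norms,
  \<open>f + g\<close> is \<open>a + b\<close> times a convex combination of \<open>f / a\<close>
  and \<open>g / b\<close>, whose p-th moments are at most 1. The extra \<open>e / 2\<close> keeps
  \<open>a\<close> and \<open>b\<close> positive when a norm vanishes.\<close>

lemma Lp_norm_triangle:
  assumes p: "1 \<le> p" and f: "in_Lp p f" and g: "in_Lp p g"
  shows "Lp_norm p (\<lambda>x. f x + g x) \<le> Lp_norm p f + Lp_norm p g"
proof (rule field_le_epsilon)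
  fix e :: real assume e: "0 < e"
  define a b where "a = Lp_norm p f + e / 2" and "b = Lp_norm p g + e / 2"
  have ab: "0 < a" "0 < b" using e Lp_norm_nonneg[of p f] Lp_norm_nonneg[of p g] by (auto simp: a_def b_def)
  define t where "t = b / (a + b)"
  have t: "0 \<le> t" "t \<le> 1" "1 - t = a / (a + b)" using ab by (auto simp: t_def field_simps)
  have fa: "(\<integral>x. \<bar>f x\<bar> powr p \<partial>unitM) \<le> a powr p" and gb: "(\<integral>x. \<bar>g x\<bar> powr p \<partial>unitM) \<le> b powr p"
    using ab e p by (auto simp: Lp_norm_le_iff[symmetric] a_def b_def)
  have pt: "\<bar>u + v\<bar> powr p \<le> (a + b) powr p * ((1 - t) * (\<bar>u\<bar> powr p / a powr p) + t * (\<bar>v\<bar> powr p / b powr p))" for u v :: real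
  proof -
    have "u + v = (a + b) * ((1 - t) * (u / a) + t * (v / b))"
      unfolding t(3) using ab
      by (simp add: t_def distrib_left add_pos_pos[THEN less_imp_neq, symmetric])
    then have "\<bar>u + v\<bar> powr p = (a + b) powr p * \<bar>(1 - t) * (u / a) + t * (v / b)\<bar> powr p"
      using ab by (simp add: abs_mult powr_mult)
    also have "\<dots> \<le> (a + b) powr p * ((1 - t) * \<bar>u / a\<bar> powr p + t * \<bar>v / b\<bar> powr p)"
      using convex_onD[OF convex_abs_powr[OF p], of t "u / a" "v / b"] t
      by (intro mult_left_mono) auto
    also have "\<bar>u / a\<bar> powr p = \<bar>u\<bar> powr p / a powr p" using ab by (simp add: powr_divide)
    also have "\<bar>v / b\<bar> powr p = \<bar>v\<bar> powr p / b powr p" using ab by (simp add: powr_divide)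
    finally show ?thesis .
  qed
  have "(\<integral>x. \<bar>f x + g x\<bar> powr p \<partial>unitM)
      \<le> (\<integral>x. (a + b) powr p * ((1 - t) * (\<bar>f x\<bar> powr p / a powr p) + t * (\<bar>g x\<bar> powr p / b powr p)) \<partial>unitM)"
    by (rule integral_mono) (use in_Lp_add[OF p f g] f g pt in \<open>auto simp: in_Lp_def\<close>)
  also have "\<dots> = (a + b) powr p * ((1 - t) * ((\<integral>x. \<bar>f x\<bar> powr p \<partial>unitM) / a powr p)
      + t * ((\<integral>x. \<bar>g x\<bar> powr p \<partial>unitM) / b powr p))"
    using f g by (simp add: in_Lp_def)
  also have "\<dots> \<le> (a + b) powr p * ((1 - t) * 1 + t * 1)"
    using t fa gb ab by (intro mult_left_mono add_mono) auto
  finally have "(\<integral>x. \<bar>f x + g x\<bar> powr p \<partial>unitM) \<le> (a + b) powr p" by simp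
  then show "Lp_norm p (\<lambda>x. f x + g x) \<le> Lp_norm p f + Lp_norm p g + e"
    using p ab by (subst Lp_norm_le_iff) (auto simp: a_def b_def add_ac)
qed

lemma Lp_norm_triangle_diff:
  assumes p: "1 \<le> p" and f: "in_Lp p f" and g: "in_Lp p g"
  shows "Lp_norm p (\<lambda>x. f x - g x) \<le> Lp_norm p f + Lp_norm p g"
  using Lp_norm_triangle[OF p f in_Lp_cmult[OF g, of "-1"]] Lp_norm_cmult[of p "-1" g] p by simp

lemma Lp_norm_triangle_via:
  assumes p: "1 \<le> p" and "in_Lp p f" "in_Lp p g" "in_Lp p k"
  shows "Lp_norm p (\<lambda>x. f x - k x) \<le> Lp_norm p (\<lambda>x. f x - g x) + Lp_norm p (\<lambda>x. g x - k x)"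
  using Lp_norm_triangle[OF p in_Lp_diff[OF p assms(2,3)] in_Lp_diff[OF p assms(3,4)]] by simp

lemma Lp_norm_sum_le:
  assumes "1 \<le> p" "\<And>i. i \<in> X \<Longrightarrow> in_Lp p (f i)"
  shows "Lp_norm p (\<lambda>x. \<Sum>i\<in>X. c i * f i x) \<le> (\<Sum>i\<in>X. \<bar>c i\<bar> * Lp_norm p (f i))"
proof (cases "finite X")
  case True
  then show ?thesis using assms(2)
  proof induction
    case (insert i X)
    have "Lp_norm p (\<lambda>x. c i * f i x + (\<Sum>i\<in>X. c i * f i x))
      \<le> Lp_norm p (\<lambda>x. c i * f i x) + Lp_norm p (\<lambda>x. \<Sum>i\<in>X. c i * f i x)"
      using insert(4) by (intro Lp_norm_triangle in_Lp_cmult in_Lp_sum assms(1)) auto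
    also have "\<dots> \<le> \<bar>c i\<bar> * Lp_norm p (f i) + (\<Sum>i\<in>X. \<bar>c i\<bar> * Lp_norm p (f i))"
      using insert assms(1) by (intro add_mono) (auto simp: Lp_norm_cmult)
    finally show ?case using insert(1,2) by simp
  qed simp
qed simp

lemma in_Lp_integrable:
  assumes p: "1 \<le> p" and f: "in_Lp p f"
  shows "integrable unitM f"
proof -
  have [measurable]: "f \<in> borel_measurable unitM" using f by (simp add: in_Lp_def)
  have b: "\<bar>y\<bar> \<le> 1 + \<bar>y\<bar> powr p" for y :: real
  proof (cases "\<bar>y\<bar> \<le> 1")
    case True then show ?thesis using powr_ge_zero[of "\<bar>y\<bar>" p] by linarith
  next
    case False then have "\<bar>y\<bar> powr 1 \<le> \<bar>y\<bar> powr p" using p by (intro powr_mono) auto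
    then show ?thesis using False by simp
  qed
  have "integrable unitM (\<lambda>x. 1 + \<bar>f x\<bar> powr p)" using f by (auto simp: in_Lp_def)
  then show ?thesis
    by (rule Bochner_Integration.integrable_bound) (use b in \<open>auto intro!: AE_I2 order_trans[OF b]\<close>)
qed

section \<open>Integral inequalities and completeness\<close>

lemma integral_abs_le_Lp_norm:
  assumes p: "1 \<le> p" and f: "in_Lp p f"
  shows "(\<integral>x. \<bar>f x\<bar> \<partial>unitM) \<le> Lp_norm p f"
proof -
  have "\<bar>\<integral>x. \<bar>f x\<bar> \<partial>unitM\<bar> powr p \<le> (\<integral>x. \<bar>\<bar>f x\<bar>\<bar> powr p \<partial>unitM)"
    by (rule unitM.jensens_inequality[where I=UNIV])
      (use in_Lp_integrable[OF p f] f p convex_abs_powr in \<open>auto simp: in_Lp_def\<close>)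
  then have "(\<integral>x. \<bar>f x\<bar> \<partial>unitM) powr p \<le> Lp_norm p f powr p"
    using p by (simp add: Lp_norm_powr)
  then show ?thesis
    using p Lp_norm_nonneg[of p f] powr_less_mono2[of p "Lp_norm p f" "\<integral>x. \<bar>f x\<bar> \<partial>unitM"] by force
qed

lemma integrable_mult_bounded_Lp:
  assumes p: "1 \<le> p" and f: "in_Lp p f" and [measurable]: "g \<in> borel_measurable unitM" and g: "\<And>x. \<bar>g x\<bar> \<le> C"
  shows "integrable unitM (\<lambda>x. f x * g x)"
proof -
  have [measurable]: "f \<in> borel_measurable unitM" using f by (simp add: in_Lp_def)
  have "integrable unitM (\<lambda>x. C * f x)" using in_Lp_integrable[OF p f] by simp
  then show ?thesis
  proof (rule Bochner_Integration.integrable_bound)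
    have "0 \<le> C" using g[of 0] by linarith
    then show "AE x in unitM. norm (f x * g x) \<le> norm (C * f x)"
      using g by (auto intro!: AE_I2 mult_left_mono simp: abs_mult mult.commute[of C])
  qed auto
qed

lemma abs_integral_mult_bounded_le:
  assumes p: "1 \<le> p" and f: "in_Lp p f" and [measurable]: "g \<in> borel_measurable unitM" and g: "\<And>x. \<bar>g x\<bar> \<le> 1"
  shows "\<bar>\<integral>x. f x * g x \<partial>unitM\<bar> \<le> Lp_norm p f"
proof -
  have "\<bar>\<integral>x. f x * g x \<partial>unitM\<bar> \<le> (\<integral>x. \<bar>f x * g x\<bar> \<partial>unitM)" by (rule integral_abs_bound)
  also have "\<dots> \<le> (\<integral>x. \<bar>f x\<bar> \<partial>unitM)"
    by (rule integral_mono[OF integrable_abs[OF integrable_mult_bounded_Lp[OF assms]] integrable_abs[OF in_Lp_integrable[OF p f]]])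
      (use g in \<open>auto simp: abs_mult mult_left_le\<close>)
  also have "\<dots> \<le> Lp_norm p f" by (rule integral_abs_le_Lp_norm[OF p f])
  finally show ?thesis .
qed

text \<open>Young's inequality is integrated after normalizing both factors; the slack
  \<open>e\<close> that keeps the normalizing constants positive tends to 0 at the end. The second
  factor is bounded because every test function below is a finite Walsh sum or an indicator, which
  settles the integrability of the product at once.\<close>

lemma Holder_bounded:
  assumes pq: "1 < p" "1 < q" "1 / p + 1 / q = 1" and f: "in_Lp p f"
    and [measurable]: "g \<in> borel_measurable unitM" and g: "\<And>x. \<bar>g x\<bar> \<le> C"
  shows "\<bar>\<integral>x. f x * g x \<partial>unitM\<bar> \<le> Lp_norm p f * Lp_norm q g"
proof (rule tendsto_lowerbound)
  show "((\<lambda>e. (Lp_norm p f + e) * (Lp_norm q g + e)) \<longlongrightarrow> Lp_norm p f * Lp_norm q g) (at_right 0)"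
    by (auto intro!: tendsto_eq_intros)
  have gL: "in_Lp q g" using g pq by (intro in_Lp_bounded) auto
  show "\<forall>\<^sub>F e in at_right 0. \<bar>\<integral>x. f x * g x \<partial>unitM\<bar> \<le> (Lp_norm p f + e) * (Lp_norm q g + e)"
  proof (rule eventually_mono[OF eventually_at_right_less])
    fix e :: real assume e: "0 < e"
    define a b where "a = Lp_norm p f + e" and "b = Lp_norm q g + e"
    have ab: "0 < a" "0 < b" using e Lp_norm_nonneg[of p f] Lp_norm_nonneg[of q g] by (auto simp: a_def b_def)
    have fa: "(\<integral>x. \<bar>f x\<bar> powr p \<partial>unitM) \<le> a powr p" and gb: "(\<integral>x. \<bar>g x\<bar> powr q \<partial>unitM) \<le> b powr q"
      using ab e pq by (auto simp: Lp_norm_le_iff[symmetric] a_def b_def)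
    have pt: "\<bar>u * v\<bar> \<le> a * b * (\<bar>u\<bar> powr p / a powr p / p + \<bar>v\<bar> powr q / b powr q / q)" for u v :: real
    proof -
      have "\<bar>u * v\<bar> = a * b * ((\<bar>u\<bar> / a) * (\<bar>v\<bar> / b))" using ab by (simp add: abs_mult)
      also have "\<dots> \<le> a * b * ((\<bar>u\<bar> / a) powr p / p + (\<bar>v\<bar> / b) powr q / q)"
        using ab pq by (intro mult_left_mono Youngs_inequality) auto
      finally show ?thesis using ab by (simp add: powr_divide)
    qed
    have "\<bar>\<integral>x. f x * g x \<partial>unitM\<bar> \<le> (\<integral>x. \<bar>f x * g x\<bar> \<partial>unitM)" by (rule integral_abs_bound)
    also have "\<dots> \<le> (\<integral>x. a * b * (\<bar>f x\<bar> powr p / a powr p / p + \<bar>g x\<bar> powr q / b powr q / q) \<partial>unitM)"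
      using integrable_mult_bounded_Lp[OF _ f _ g] pq f gL pt
      by (intro integral_mono) (auto simp: in_Lp_def)
    also have "\<dots> = a * b * ((\<integral>x. \<bar>f x\<bar> powr p \<partial>unitM) / a powr p / p + (\<integral>x. \<bar>g x\<bar> powr q \<partial>unitM) / b powr q / q)"
      using f gL by (simp add: in_Lp_def)
    also have "\<dots> \<le> a * b * (1 / p + 1 / q)"
      using fa gb ab pq by (intro mult_left_mono add_mono divide_right_mono) auto
    finally show "\<bar>\<integral>x. f x * g x \<partial>unitM\<bar> \<le> (Lp_norm p f + e) * (Lp_norm q g + e)"
      using pq by (simp add: a_def b_def)
  qed
qed simp

text \<open>Riesz-Fischer: a fast subsequence has increments with summable L1 norms and so converges
  almost everywhere. Fatou's lemma then turns the Cauchy condition into membership of the limit and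
  norm convergence of the whole sequence.\<close>

lemma Lp_complete:
  assumes p: "1 \<le> p" and f: "\<And>n. in_Lp p (f n)"
    and Cauchy: "\<And>e. 0 < e \<Longrightarrow> \<exists>N. \<forall>m\<ge>N. \<forall>n\<ge>N. Lp_norm p (\<lambda>x. f m x - f n x) < e"
  shows "\<exists>g. in_Lp p g \<and> (\<lambda>n. Lp_norm p (\<lambda>x. g x - f n x)) \<longlonglongrightarrow> 0"
proof -
  have [measurable]: "f n \<in> borel_measurable unitM" for n using f by (simp add: in_Lp_def)
  have "\<exists>N. \<forall>m\<ge>N. \<forall>n\<ge>N. Lp_norm p (\<lambda>x. f m x - f n x) < (1/2) ^ k" for k :: nat
    by (rule Cauchy) simp
  then obtain N where N: "\<And>k m n. m \<ge> N k \<Longrightarrow> n \<ge> N k \<Longrightarrow> Lp_norm p (\<lambda>x. f m x - f n x) < (1/2) ^ k"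
    by metis
  \<comment> \<open>The partial sums of \<open>N\<close> make \<open>r\<close> increasing while
    keeping \<open>N k \<le> r k\<close>; the summand \<open>k\<close> makes it unbounded.\<close>
  define r where "r k = k + (\<Sum>i\<le>k. N i)" for k
  have rN: "N k \<le> r k" and rk: "k \<le> r k" and rS: "r k \<le> r (Suc k)" for k
    using member_le_sum[of k "{..k}" N] by (auto simp: r_def)
  define d where "d k x = \<bar>f (r (Suc k)) x - f (r k) x\<bar>" for k x
  have [measurable]: "d k \<in> borel_measurable unitM" for k unfolding d_def by measurable
  have dint: "(\<integral>\<^sup>+x. ennreal (d k x) \<partial>unitM) \<le> ennreal ((1/2) ^ k)" for k
  proof -
    have L: "in_Lp p (\<lambda>x. f (r (Suc k)) x - f (r k) x)" by (intro in_Lp_diff p f)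
    have "(\<integral>\<^sup>+x. ennreal (d k x) \<partial>unitM) = ennreal (\<integral>x. d k x \<partial>unitM)"
      using in_Lp_integrable[OF p L] by (intro nn_integral_eq_integral) (auto simp: d_def)
    also have "(\<integral>x. d k x \<partial>unitM) \<le> (1/2) ^ k"
      unfolding d_def using integral_abs_le_Lp_norm[OF p L] N[of k "r (Suc k)" "r k"] rN[of k] rS[of k] by auto
    finally show ?thesis by (simp add: ennreal_leI)
  qed
  have "(\<integral>\<^sup>+x. (\<Sum>k. ennreal (d k x)) \<partial>unitM) = (\<Sum>k. \<integral>\<^sup>+x. ennreal (d k x) \<partial>unitM)"
    by (rule nn_integral_suminf) auto
  also have "\<dots> \<le> (\<Sum>k. ennreal ((1/2) ^ k))"
    by (rule suminf_le) (use dint in auto)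
  also have "\<dots> = ennreal (\<Sum>k. (1/2) ^ k)"
    by (rule suminf_ennreal2) (auto intro: summable_geometric)
  finally have "(\<integral>\<^sup>+x. (\<Sum>k. ennreal (d k x)) \<partial>unitM) \<noteq> \<infinity>"
    by (auto simp: top_unique)
  then have "AE x in unitM. (\<Sum>k. ennreal (d k x)) \<noteq> \<infinity>"
    by (intro nn_integral_PInf_AE) auto
  then have conv: "AE x in unitM. (\<lambda>k. f (r k) x) \<longlonglongrightarrow> lim (\<lambda>k. f (r k) x)"
  proof eventually_elim
    case (elim x)
    have "summable (\<lambda>k. d k x)"
      by (rule summable_suminf_not_top) (use elim in \<open>auto simp: d_def\<close>)
    then have "summable (\<lambda>k. f (r (Suc k)) x - f (r k) x)"
      by (auto simp: d_def intro: summable_rabs_cancel)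
    then have "convergent (\<lambda>n. \<Sum>k<n. f (r (Suc k)) x - f (r k) x)"
      by (simp add: summable_iff_convergent)
    then have "convergent (\<lambda>n. f (r n) x - f (r 0) x)"
      using sum_lessThan_telescope[of "\<lambda>k. f (r k) x"] by simp
    then have "convergent (\<lambda>n. f (r n) x)"
      using convergent_add_const_right_iff[of "\<lambda>n. f (r n) x" "- f (r 0) x"] by simp
    then show ?case by (simp add: convergent_LIMSEQ_iff)
  qed
  define g where "g x = lim (\<lambda>k. f (r k) x)" for x
  have [measurable]: "g \<in> borel_measurable unitM" unfolding g_def by measurable
  \<comment> \<open>Fatou along the subsequence: a bound on all later differences from
    \<open>f n\<close> passes to \<open>g - f n\<close>, together with integrability.\<close>
  have key: "in_Lp p (\<lambda>x. g x - f n x) \<and> Lp_norm p (\<lambda>x. g x - f n x) \<le> e"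
    if e: "0 < e" and n: "\<And>m. m \<ge> n \<Longrightarrow> Lp_norm p (\<lambda>x. f m x - f n x) \<le> e" for n e
  proof -
    have "(\<integral>\<^sup>+x. ennreal (\<bar>g x - f n x\<bar> powr p) \<partial>unitM)
        = (\<integral>\<^sup>+x. liminf (\<lambda>k. ennreal (\<bar>f (r k) x - f n x\<bar> powr p)) \<partial>unitM)"
    proof (rule nn_integral_cong_AE, use conv in eventually_elim)
      case (elim x)
      have "(\<lambda>k. ennreal (\<bar>f (r k) x - f n x\<bar> powr p)) \<longlonglongrightarrow> ennreal (\<bar>g x - f n x\<bar> powr p)"
        using elim p unfolding g_def
        by (intro tendsto_ennrealI tendsto_powr' tendsto_intros) auto
      from lim_imp_Liminf[OF _ this] show ?case by simp
    qed
    also have "\<dots> \<le> liminf (\<lambda>k. \<integral>\<^sup>+x. ennreal (\<bar>f (r k) x - f n x\<bar> powr p) \<partial>unitM)"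
      by (rule nn_integral_liminf) auto
    also have "\<dots> \<le> ennreal (e powr p)"
    proof (rule Liminf_le)
      have "\<forall>\<^sub>F k in sequentially. r k \<ge> n"
        using rk by (auto simp: eventually_sequentially intro: order_trans)
      then show "\<forall>\<^sub>F k in sequentially. (\<integral>\<^sup>+x. ennreal (\<bar>f (r k) x - f n x\<bar> powr p) \<partial>unitM) \<le> ennreal (e powr p)"
      proof eventually_elim
        case (elim k)
        have "in_Lp p (\<lambda>x. f (r k) x - f n x)" by (intro in_Lp_diff p f)
        then have "(\<integral>\<^sup>+x. ennreal (\<bar>f (r k) x - f n x\<bar> powr p) \<partial>unitM) = ennreal (\<integral>x. \<bar>f (r k) x - f n x\<bar> powr p \<partial>unitM)"
          by (intro nn_integral_eq_integral) (auto simp: in_Lp_def)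
        also have "\<dots> \<le> ennreal (e powr p)"
          using n[OF elim] p e by (intro ennreal_leI) (simp add: Lp_norm_le_iff)
        finally show ?case .
      qed
    qed simp
    finally have le: "(\<integral>\<^sup>+x. ennreal (\<bar>g x - f n x\<bar> powr p) \<partial>unitM) \<le> ennreal (e powr p)" .
    have int: "integrable unitM (\<lambda>x. \<bar>g x - f n x\<bar> powr p)"
      by (rule integrableI_bounded) (use le in \<open>auto intro: le_less_trans\<close>)
    then have "(\<integral>x. \<bar>g x - f n x\<bar> powr p \<partial>unitM) \<le> e powr p"
      using le by (subst (asm) nn_integral_eq_integral) auto
    then show ?thesis using int p e by (simp add: in_Lp_def Lp_norm_le_iff)
  qed
  have lim: "\<exists>n0. \<forall>n\<ge>n0. in_Lp p (\<lambda>x. g x - f n x) \<and> Lp_norm p (\<lambda>x. g x - f n x) \<le> e" if e: "0 < e" for e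
  proof -
    obtain N0 where "\<forall>m\<ge>N0. \<forall>n\<ge>N0. Lp_norm p (\<lambda>x. f m x - f n x) < e" using Cauchy[OF e] by blast
    then have "\<forall>n\<ge>N0. in_Lp p (\<lambda>x. g x - f n x) \<and> Lp_norm p (\<lambda>x. g x - f n x) \<le> e"
      using e by (intro allI impI key) (auto intro!: less_imp_le)
    then show ?thesis by blast
  qed
  obtain n0 where "in_Lp p (\<lambda>x. g x - f n0 x)" using lim[of 1] by auto
  from in_Lp_add[OF p this f[of n0]] have "in_Lp p g" by simp
  moreover have "(\<lambda>n. Lp_norm p (\<lambda>x. g x - f n x)) \<longlonglongrightarrow> 0"
  proof (rule LIMSEQ_I)
    fix e :: real assume "0 < e"
    then obtain n0 where "\<forall>n\<ge>n0. in_Lp p (\<lambda>x. g x - f n x) \<and> Lp_norm p (\<lambda>x. g x - f n x) \<le> e / 2"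
      using lim[of "e / 2"] by auto
    then have "\<forall>n\<ge>n0. norm (Lp_norm p (\<lambda>x. g x - f n x) - 0) < e"
      using \<open>0 < e\<close> Lp_norm_nonneg by force
    then show "\<exists>no. \<forall>n\<ge>no. norm (Lp_norm p (\<lambda>x. g x - f n x) - 0) < e" by blast
  qed
  ultimately show ?thesis by blast
qed

text \<open>For a functional bounded by \<open>C\<close> in L_r, signs that align its values give
  \<open>\<delta> * card X\<close> as a lower bound for \<open>C\<close> times the norm of the
  signed sum. Orthogonality makes the average \<open>u\<close> of the signed functions small: as
  \<open>u\<close> is bounded by 1, its r-th moment is at most its first, hence at most
  \<open>L powr (-1/2)\<close>. Comparing powers of \<open>L\<close> produces the exponent
  \<open>2 * r\<close>. Every \<open>r\<close> from 1 on is allowed, so that one lemma serves both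
  directions of an operator matrix, with r = p and with r conjugate to p.\<close>

lemma orthogonal_card_bound:
  fixes g :: "'i \<Rightarrow> real \<Rightarrow> real" and \<phi> :: "'i \<Rightarrow> real"
  assumes r: "1 \<le> r" and X: "finite X"
    and [measurable]: "\<And>i. i \<in> X \<Longrightarrow> g i \<in> borel_measurable unitM"
    and g: "\<And>i x. i \<in> X \<Longrightarrow> \<bar>g i x\<bar> \<le> 1"
    and orth: "\<And>i j. i \<in> X \<Longrightarrow> j \<in> X \<Longrightarrow> i \<noteq> j \<Longrightarrow> (\<integral>x. g i x * g j x \<partial>unitM) = 0"
    and C: "0 \<le> C"
    and \<phi>: "\<And>s. (\<And>i. \<bar>s i\<bar> = 1) \<Longrightarrow> \<bar>\<Sum>i\<in>X. s i * \<phi> i\<bar> \<le> C * Lp_norm r (\<lambda>x. \<Sum>i\<in>X. s i * g i x)"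
    and \<delta>: "0 < \<delta>" "\<And>i. i \<in> X \<Longrightarrow> \<delta> < \<bar>\<phi> i\<bar>"
  shows "real (card X) \<le> (C / \<delta>) powr (2 * r)"
proof (cases "X = {}")
  case False
  define L where "L = real (card X)"
  have L: "1 \<le> L" using False X by (simp add: L_def Suc_le_eq card_gt_0_iff)
  define s where "s i = (if 0 \<le> \<phi> i then 1 else -1 :: real)" for i
  define u where "u x = (\<Sum>i\<in>X. s i * g i x) / L" for x
  have s: "\<bar>s i\<bar> = 1" "s i * s i = 1" "s i * \<phi> i = \<bar>\<phi> i\<bar>" for i by (auto simp: s_def)
  have [measurable]: "u \<in> borel_measurable unitM" unfolding u_def by measurable
  have u1: "\<bar>u x\<bar> \<le> 1" for x
  proof -
    have "\<bar>\<Sum>i\<in>X. s i * g i x\<bar> \<le> (\<Sum>i\<in>X. \<bar>s i * g i x\<bar>)" by (rule sum_abs)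
    also have "\<dots> \<le> (\<Sum>i\<in>X. 1)" using g by (intro sum_mono) (auto simp: abs_mult s)
    finally show ?thesis using L by (simp add: u_def L_def)
  qed
  have gg: "integrable unitM (\<lambda>x. g i x * g j x)" if "i \<in> X" "j \<in> X" for i j
    using that g by (intro unitM.integrable_const_bound[where B=1]) (auto simp: abs_mult mult_le_one)
  have "(\<integral>x. (u x)\<^sup>2 \<partial>unitM) = (\<integral>x. (\<Sum>i\<in>X. \<Sum>j\<in>X. s i * s j * (g i x * g j x)) / L\<^sup>2 \<partial>unitM)"
    by (simp add: u_def power_divide power2_eq_square sum_product mult_ac)
  also have "\<dots> = (\<Sum>i\<in>X. \<Sum>j\<in>X. s i * s j * (\<integral>x. g i x * g j x \<partial>unitM)) / L\<^sup>2"
    using gg by simp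
  also have "(\<Sum>i\<in>X. \<Sum>j\<in>X. s i * s j * (\<integral>x. g i x * g j x \<partial>unitM)) \<le> (\<Sum>i\<in>X. \<Sum>j\<in>X. if i = j then 1 else 0)"
  proof (intro sum_mono)
    fix i j assume ij: "i \<in> X" "j \<in> X"
    have "(\<integral>x. g i x * g i x \<partial>unitM) \<le> (\<integral>x. 1 \<partial>unitM)"
      by (rule integral_mono[OF gg[OF ij(1) ij(1)]])
        (use g ij in \<open>auto simp: abs_square_le_1 power2_eq_square[symmetric]\<close>)
    then show "s i * s j * (\<integral>x. g i x * g j x \<partial>unitM) \<le> (if i = j then 1 else 0)"
      using ij orth by (auto simp: s unitM.prob_space)
  qed
  also have "\<dots> = L" using X by (simp add: L_def)
  finally have u2: "(\<integral>x. (u x)\<^sup>2 \<partial>unitM) \<le> 1 / L"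
    using L by (simp add: divide_right_mono power2_eq_square)
  have iu2: "integrable unitM (\<lambda>x. (u x)\<^sup>2)"
    using u1 by (intro unitM.integrable_const_bound[where B=1]) (auto simp: abs_square_le_1)
  \<comment> \<open>The arithmetic-geometric inequality in place of Cauchy-Schwarz; with the scaling
    \<open>sqrt L\<close> each of the two terms integrates to at most
    \<open>1 / sqrt L\<close>.\<close>
  have pt: "\<bar>u x\<bar> powr r \<le> (1 / sqrt L + sqrt L * (u x)\<^sup>2) / 2" for x
  proof -
    have "\<bar>u x\<bar> powr r \<le> \<bar>u x\<bar> powr 1" using u1[of x] r by (intro powr_mono') auto
    moreover have "0 \<le> (1 - sqrt L * \<bar>u x\<bar>)\<^sup>2 / sqrt L" using L by simp
    moreover have "(1 - sqrt L * \<bar>u x\<bar>)\<^sup>2 / sqrt L = 1 / sqrt L + sqrt L * (u x)\<^sup>2 - 2 * \<bar>u x\<bar>"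
      using L by (simp add: power2_eq_square field_simps)
    ultimately show ?thesis by simp
  qed
  have "(\<integral>x. \<bar>u x\<bar> powr r \<partial>unitM) \<le> (\<integral>x. (1 / sqrt L + sqrt L * (u x)\<^sup>2) / 2 \<partial>unitM)"
    using in_Lp_bounded[of u 1 r] u1 r iu2 pt by (intro integral_mono) (auto simp: in_Lp_def)
  also have "\<dots> = (1 / sqrt L + sqrt L * (\<integral>x. (u x)\<^sup>2 \<partial>unitM)) / 2"
    using iu2 by (simp add: unitM.prob_space)
  also have "\<dots> \<le> (1 / sqrt L + sqrt L * (1 / L)) / 2"
    using u2 L by (intro divide_right_mono add_left_mono mult_left_mono) auto
  also have "\<dots> = L powr (-1/2)"
    using L by (simp add: powr_minus_divide powr_half_sqrt field_simps)
  finally have "(\<integral>x. \<bar>u x\<bar> powr r \<partial>unitM) \<le> (L powr (-1/(2*r))) powr r"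
    using r by (simp add: powr_powr)
  then have uL: "Lp_norm r u \<le> L powr (-1/(2*r))"
    using r by (subst Lp_norm_le_iff) auto
  have "\<delta> * L \<le> (\<Sum>i\<in>X. \<bar>\<phi> i\<bar>)"
    using sum_mono[of X "\<lambda>i. \<delta>" "\<lambda>i. \<bar>\<phi> i\<bar>"] \<delta> by (auto simp: L_def mult.commute less_imp_le)
  also have "\<dots> \<le> C * Lp_norm r (\<lambda>x. L * u x)"
    using \<phi>[of s] s L by (simp add: u_def)
  also have "\<dots> = L * (C * Lp_norm r u)" using L r by (simp add: Lp_norm_cmult)
  finally have "\<delta> \<le> C * Lp_norm r u" using L by simp
  also have "\<dots> \<le> C * L powr (-1/(2*r))" using uL C by (intro mult_left_mono)
  finally have "L powr (1/(2*r)) \<le> C / \<delta>"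
    using \<delta> L by (simp add: powr_minus_divide field_simps)
  then have "(L powr (1/(2*r))) powr (2*r) \<le> (C / \<delta>) powr (2*r)"
    using r by (intro powr_mono2) auto
  then show ?thesis using r L by (simp add: powr_powr L_def)
qed simp

section \<open>Walsh functions and combinatorics\<close>

text \<open>A point of the discrete cube is encoded by the set \<open>x\<close> of its coordinates
  equal to -1. This is then the character (-1)^|S \<inter> x|, with points and frequencies of the
  same type.\<close>

definition walsh :: "'a set \<Rightarrow> 'a set \<Rightarrow> real" where
  "walsh S x = (\<Prod>j\<in>S. if j \<in> x then -1 else 1)"

lemma walsh_empty [simp]: "walsh {} x = 1" "walsh S {} = 1"
  by (simp_all add: walsh_def)

lemma abs_walsh [simp]: "\<bar>walsh S x\<bar> = 1"
  unfolding walsh_def abs_prod by (rule prod.neutral) auto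

lemma walsh_Un_disjoint:
  "finite S \<Longrightarrow> finite T \<Longrightarrow> S \<inter> T = {} \<Longrightarrow> walsh (S \<union> T) x = walsh S x * walsh T x"
  by (simp add: walsh_def prod.union_disjoint)

lemma walsh_mult_right: "walsh S x * walsh S y = walsh S (sym_diff x y)"
  unfolding walsh_def prod.distrib[symmetric] by (rule prod.cong) auto

lemma walsh_commute:
  assumes "finite S" "finite x"
  shows "walsh S x = walsh x S"
proof -
  have "walsh S x = (\<Prod>j\<in>S \<inter> x. -1)" if "finite S" for S x :: "'a set"
    unfolding walsh_def using that by (subst prod.inter_restrict) auto
  from this[OF assms(1)] this[OF assms(2)] show ?thesis by (metis Int_commute)
qed

text \<open>The sum factors into a product over \<open>J\<close>, and every factor with index in
  \<open>S\<close> is -1 + 1.\<close>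

lemma sum_walsh_left:
  assumes "finite J" "S \<subseteq> J" "S \<noteq> {}"
  shows "(\<Sum>x\<in>Pow J. walsh x S) = 0"
proof -
  have "(\<Sum>x\<in>Pow J. walsh x S) = (\<Prod>j\<in>J. (if j \<in> S then -1 else 1) + 1)"
    unfolding walsh_def by (subst prod_add[OF assms(1)]) simp
  also have "\<dots> = 0" using assms by (subst prod_zero_iff) auto
  finally show ?thesis .
qed

lemma sum_walsh:
  assumes "finite J" "S \<subseteq> J" "S \<noteq> {}"
  shows "(\<Sum>x\<in>Pow J. walsh S x) = 0"
proof -
  have "(\<Sum>x\<in>Pow J. walsh S x) = (\<Sum>x\<in>Pow J. walsh x S)"
    using assms by (intro sum.cong walsh_commute) (auto intro: finite_subset)
  with sum_walsh_left[OF assms] show ?thesis by simp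
qed

lemma walsh_inversion:
  assumes "finite J" "A \<subseteq> J" "B \<subseteq> J"
  shows "(\<Sum>P\<in>Pow J. walsh P A * walsh P B) = (if A = B then 2 ^ card J else 0)"
proof (cases "A = B")
  case True
  then show ?thesis using assms by (simp add: walsh_mult_right card_Pow)
next
  case False
  then show ?thesis
    unfolding walsh_mult_right using assms by (subst sum_walsh_left) auto
qed

section \<open>Union bound and Ramsey selection\<close>

text \<open>With all coordinates but \<open>k e\<close> fixed, at most \<open>L\<close> of the
  \<open>M\<close> values make \<open>e\<close> bad. Hence \<open>e\<close> excludes at most
  \<open>L * M ^ (card I - 1)\<close> assignments, and all events together exclude fewer than
  \<open>M ^ card I\<close>.\<close>

lemma avoid_bad_events:
  fixes bad :: "'e \<Rightarrow> ('i \<Rightarrow> nat) \<Rightarrow> bool" and k :: "'e \<Rightarrow> 'i"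
  assumes I: "finite I" and E: "finite E" "\<And>e. e \<in> E \<Longrightarrow> k e \<in> I"
    and L: "\<And>e \<psi>. e \<in> E \<Longrightarrow> \<psi> \<in> PiE I (\<lambda>_. {..<M}) \<Longrightarrow> card {v. v < M \<and> bad e (\<psi>(k e := v))} \<le> L"
    and M: "card E * L < M"
  shows "\<exists>\<psi> \<in> PiE I (\<lambda>_. {..<M}). \<forall>e\<in>E. \<not> bad e \<psi>"
proof (rule ccontr)
  assume "\<not> ?thesis"
  then have sub: "PiE I (\<lambda>_. {..<M}) \<subseteq> (\<Union>e\<in>E. {\<psi> \<in> PiE I (\<lambda>_. {..<M}). bad e \<psi>})" by auto
  have M0: "0 < M" using M by linarith
  have fin: "finite (PiE I (\<lambda>_. {..<M}))" using I by (intro finite_PiE) auto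
  have one: "card {\<psi> \<in> PiE I (\<lambda>_. {..<M}). bad e \<psi>} \<le> L * M ^ (card I - 1)" if e: "e \<in> E" for e
  proof -
    let ?K = "PiE (I - {k e}) (\<lambda>_. {..<M})"
    let ?B = "\<lambda>g. {v. v < M \<and> bad e (g(k e := v))}"
    have finK: "finite ?K" using I by (intro finite_PiE) auto
    have "{\<psi> \<in> PiE I (\<lambda>_. {..<M}). bad e \<psi>} \<subseteq> (\<lambda>(g, v). g(k e := v)) ` (SIGMA g:?K. ?B g)"
    proof
      fix \<psi> assume \<psi>: "\<psi> \<in> {\<psi> \<in> PiE I (\<lambda>_. {..<M}). bad e \<psi>}"
      then have "\<psi>(k e := undefined) \<in> ?K" "\<psi> (k e) < M" using E(2)[OF e] by (auto simp: PiE_def extensional_def)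
      moreover have "\<psi> = (\<psi>(k e := undefined))(k e := \<psi> (k e))" by simp
      ultimately show "\<psi> \<in> (\<lambda>(g, v). g(k e := v)) ` (SIGMA g:?K. ?B g)"
        using \<psi> by (intro image_eqI[where x="(\<psi>(k e := undefined), \<psi> (k e))"]) auto
    qed
    then have "card {\<psi> \<in> PiE I (\<lambda>_. {..<M}). bad e \<psi>} \<le> card (SIGMA g:?K. ?B g)"
      using finK by (intro surj_card_le) auto
    also have "\<dots> = (\<Sum>g\<in>?K. card (?B g))" using finK by simp
    also have "\<dots> \<le> (\<Sum>g\<in>?K. L)"
    proof (rule sum_mono)
      fix g assume "g \<in> ?K"
      then have "g(k e := 0) \<in> PiE I (\<lambda>_. {..<M})" using E(2)[OF e] M0 by (auto simp: PiE_def extensional_def)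
      from L[OF e this] show "card (?B g) \<le> L" by simp
    qed
    also have "\<dots> = L * M ^ (card I - 1)" using I E(2)[OF e] by (simp add: card_PiE)
    finally show ?thesis .
  qed
  have "M ^ card I = card (PiE I (\<lambda>_. {..<M}))" using I by (simp add: card_PiE)
  also have "\<dots> \<le> card (\<Union>e\<in>E. {\<psi> \<in> PiE I (\<lambda>_. {..<M}). bad e \<psi>})"
    using sub fin E(1) by (intro card_mono) auto
  also have "\<dots> \<le> (\<Sum>e\<in>E. card {\<psi> \<in> PiE I (\<lambda>_. {..<M}). bad e \<psi>})" by (rule card_UN_le[OF E(1)])
  also have "\<dots> \<le> (\<Sum>e\<in>E. L * M ^ (card I - 1))" by (intro sum_mono one)
  also have "\<dots> = card E * L * M ^ (card I - 1)" by simp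
  finally have le: "M ^ card I \<le> card E * L * M ^ (card I - 1)" .
  show False
  proof (cases "E = {}")
    case True
    then show False using le M0 by simp
  next
    case False
    then have "0 < card I" using E I by (auto simp: card_gt_0_iff)
    then have "M ^ card I = M * M ^ (card I - 1)" by (simp add: power_eq_if)
    then show False using le M M0 by simp
  qed
qed

text \<open>Induction on the largest size \<open>s\<close>: Ramsey's theorem for sets of size
  \<open>Suc s\<close> is applied with the target size \<open>N\<close> that the smaller sizes
  require, and the induction hypothesis is used inside the homogeneous set. The bound precedes the
  colouring, which makes later thresholds uniform over all matrices.\<close>

lemma ramsey_all_sizes:
  "\<exists>N. \<forall>f :: nat set \<Rightarrow> nat. (\<forall>S. f S < k) \<longrightarrow>
     (\<exists>H\<subseteq>{..<N}. card H = q \<and> (\<forall>S S'. S \<subseteq> H \<longrightarrow> S' \<subseteq> H \<longrightarrow> card S = card S' \<longrightarrow> card S \<in> {1..s} \<longrightarrow> f S = f S'))"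
proof (induction s)
  case 0
  show ?case by (rule exI[of _ q]) (auto intro!: exI[of _ "{..<q}"])
next
  case (Suc s)
  then obtain N where N: "\<And>f :: nat set \<Rightarrow> nat. (\<forall>S. f S < k) \<Longrightarrow>
     \<exists>H\<subseteq>{..<N}. card H = q \<and> (\<forall>S S'. S \<subseteq> H \<longrightarrow> S' \<subseteq> H \<longrightarrow> card S = card S' \<longrightarrow> card S \<in> {1..s} \<longrightarrow> f S = f S')"
    by blast
  obtain N' where N': "partn_lst {..<N'::nat} (replicate k N) (Suc s)" using ramsey_full by blast
  show ?case
  proof (rule exI[of _ N'], intro allI impI)
    fix f :: "nat set \<Rightarrow> nat" assume f: "\<forall>S. f S < k"
    then obtain i H where i: "i < k" and H: "H \<in> nsets {..<N'} N" "f ` nsets H (Suc s) \<subseteq> {i}"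
      using partn_lstE[OF N', of f k] by auto
    then have H': "H \<subseteq> {..<N'}" "finite H" "card H = N" by (auto simp: nsets_def)
    \<comment> \<open>Relabelling \<open>H\<close> by \<open>{..<N}\<close> lets the induction
      hypothesis act on the colours of images under \<open>e\<close>.\<close>
    then obtain e where e: "bij_betw e {..<N} H"
      using ex_bij_betw_nat_finite[of H] by (auto simp: atLeast0LessThan)
    obtain G where G: "G \<subseteq> {..<N}" "card G = q"
      "\<And>S S'. S \<subseteq> G \<Longrightarrow> S' \<subseteq> G \<Longrightarrow> card S = card S' \<Longrightarrow> card S \<in> {1..s} \<Longrightarrow> f (e ` S) = f (e ` S')"
      using N[of "\<lambda>S. f (e ` S)"] f by blast
    have inj: "inj_on e G" using e G(1) by (auto simp: bij_betw_def intro: inj_on_subset)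
    have eG: "e ` G \<subseteq> H" using e G(1) by (auto simp: bij_betw_def)
    have hom: "f S = f S'" if S: "S \<subseteq> e ` G" "S' \<subseteq> e ` G" "card S = card S'" "card S \<in> {1..Suc s}" for S S'
    proof (cases "card S = Suc s")
      case True
      then have "S \<in> nsets H (Suc s)" "S' \<in> nsets H (Suc s)"
        using S eG finite_subset[OF S(1)] finite_subset[OF S(2)] finite_subset[OF eG H'(2)]
        by (auto simp: nsets_def)
      then show ?thesis using H(2) by blast
    next
      case False
      obtain R R' where R: "R \<subseteq> G" "S = e ` R" "R' \<subseteq> G" "S' = e ` R'" using S(1,2) by (meson subset_imageE)
      moreover have "card R = card S" "card R' = card S'"
        using R inj by (auto simp: card_image inj_on_subset)
      ultimately show ?thesis using G(3)[of R R'] S False by auto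
    qed
    show "\<exists>H\<subseteq>{..<N'}. card H = q \<and> (\<forall>S S'. S \<subseteq> H \<longrightarrow> S' \<subseteq> H \<longrightarrow> card S = card S' \<longrightarrow> card S \<in> {1..Suc s} \<longrightarrow> f S = f S')"
    proof (intro exI[of _ "e ` G"] conjI allI impI)
      show "e ` G \<subseteq> {..<N'}" using eG H'(1) by (rule order_trans)
      show "card (e ` G) = q" using G(2) inj by (simp add: card_image)
    qed (rule hom)
  qed
qed

section \<open>Averages with binomial weights\<close>

lemma sum_Pow_card:
  fixes g :: "nat \<Rightarrow> real"
  assumes "finite A"
  shows "(\<Sum>P\<in>Pow A. g (card P)) = (\<Sum>k\<le>card A. real (card A choose k) * g k)"
proof -
  have "(\<Sum>P\<in>Pow A. g (card P)) = (\<Sum>k\<le>card A. \<Sum>P\<in>{P \<in> Pow A. card P = k}. g (card P))"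
    using assms by (intro sum.group[symmetric]) (auto intro: card_mono)
  also have "\<dots> = (\<Sum>k\<le>card A. \<Sum>P\<in>{P. P \<subseteq> A \<and> card P = k}. g k)"
    by (intro sum.cong refl) auto
  finally show ?thesis using assms by (simp add: n_subsets)
qed

text \<open>A sum of \<open>n\<close> fair signs has variance \<open>n\<close>; the moments are
  those of the Bernstein polynomials at 1/2.\<close>

lemma sum_choose_central_second_moment:
  "(\<Sum>k\<le>n. real (n choose k) * (real n - 2 * real k)\<^sup>2) = real n * 2 ^ n"
proof -
  have B: "Bernstein n k (1/2) = real (n choose k) / 2 ^ n" if "k \<le> n" for k
    using that by (simp add: Bernstein_def power_one_over power_add[symmetric] field_simps)
  have "(\<Sum>k\<le>n. real (n choose k) * (real n - 2 * real k)\<^sup>2) / 2 ^ n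
      = (\<Sum>k\<le>n. (real n)\<^sup>2 * Bernstein n k (1/2) - (4 * real n - 4) * (real k * Bernstein n k (1/2))
          + 4 * (real k * (real k - 1) * Bernstein n k (1/2)))"
    unfolding sum_divide_distrib
    by (intro sum.cong refl) (simp add: B power2_eq_square field_simps)
  also have "\<dots> = (real n)\<^sup>2 * (\<Sum>k\<le>n. Bernstein n k (1/2)) - (4 * real n - 4) * (\<Sum>k\<le>n. real k * Bernstein n k (1/2))
      + 4 * (\<Sum>k\<le>n. real k * (real k - 1) * Bernstein n k (1/2))"
    by (simp only: sum.distrib sum_subtractf sum_distrib_left)
  also have "\<dots> = real n"
    by (simp add: sum_k_Bernstein sum_kk_Bernstein) (simp add: power2_eq_square field_simps)
  finally show ?thesis by (simp add: field_simps)
qed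

text \<open>A binomial law and its shift by one are close in total variation. With
  \<open>n = Suc l\<close>, \<open>n\<close> times the difference is a single sum with weights
  \<open>(n choose k) * (n - 2 * k)\<close>, and the variance above bounds the mean of the modulus
  of \<open>n - 2 * k\<close> by \<open>sqrt n\<close>.\<close>

lemma binomial_average_shift:
  fixes \<mu> :: "nat \<Rightarrow> real"
  assumes \<mu>: "\<And>j. \<bar>\<mu> j\<bar> \<le> C"
  shows "\<bar>(\<Sum>k\<le>l. real (l choose k) * \<mu> (Suc s + k)) - (\<Sum>k\<le>l. real (l choose k) * \<mu> (s + k))\<bar>
           \<le> 2 * C / sqrt (Suc l) * 2 ^ l"
proof -
  define n where "n = Suc l"
  have n0: "0 < real n" by (simp add: n_def)
  have C0: "0 \<le> C" using \<mu>[of 0] by linarith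
  define D where "D = (\<Sum>k\<le>l. real (l choose k) * \<mu> (s + k)) - (\<Sum>k\<le>l. real (l choose k) * \<mu> (Suc s + k))"
  \<comment> \<open>The two absorption identities express \<open>l choose k\<close> through row
    \<open>n\<close>: the first treats the unshifted sum, the second the shifted one after its index
    has been moved by one.\<close>
  have e1: "real n * real (l choose k) = real (n - k) * real (n choose k)" for k
    using binomial_absorb_comp[of n k] unfolding n_def
    by (metis diff_Suc_1 of_nat_mult)
  have e2: "real n * real (l choose k) = real (Suc k) * real (n choose Suc k)" for k
    using Suc_times_binomial_eq[of l k] unfolding n_def by (metis mult.commute of_nat_mult)
  have "real n * D = (\<Sum>k\<le>l. real (n - k) * real (n choose k) * \<mu> (s + k))
      - (\<Sum>k\<le>l. real (Suc k) * real (n choose Suc k) * \<mu> (s + Suc k))"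
    unfolding D_def right_diff_distrib sum_distrib_left mult.assoc[symmetric] e1
    by (simp add: e1[symmetric] e2)
  also have "(\<Sum>k\<le>l. real (n - k) * real (n choose k) * \<mu> (s + k)) = (\<Sum>k\<le>l. (real n - real k) * real (n choose k) * \<mu> (s + k))"
    by (intro sum.cong refl) (simp add: n_def of_nat_diff)
  also have "\<dots> = (\<Sum>k\<le>n. (real n - real k) * real (n choose k) * \<mu> (s + k))"
    by (simp add: n_def)
  also have "(\<Sum>k\<le>l. real (Suc k) * real (n choose Suc k) * \<mu> (s + Suc k)) = (\<Sum>k\<le>n. real k * real (n choose k) * \<mu> (s + k))"
    unfolding n_def by (subst sum.atMost_Suc_shift) simp
  finally have "real n * D = (\<Sum>k\<le>n. real (n choose k) * (real n - 2 * real k) * \<mu> (s + k))"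
    by (simp add: sum_subtractf[symmetric] algebra_simps)
  then have "\<bar>real n * D\<bar> \<le> (\<Sum>k\<le>n. \<bar>real (n choose k) * (real n - 2 * real k) * \<mu> (s + k)\<bar>)"
    by simp
  also have "\<dots> \<le> (\<Sum>k\<le>n. C * (real (n choose k) * (sqrt n + (real n - 2 * real k)\<^sup>2 / sqrt n) / 2))"
  proof (rule sum_mono)
    fix k
    have "0 \<le> (sqrt n - \<bar>real n - 2 * real k\<bar>)\<^sup>2 / sqrt n" by simp
    also have "\<dots> = sqrt n + (real n - 2 * real k)\<^sup>2 / sqrt n - 2 * \<bar>real n - 2 * real k\<bar>"
      using n0 by (simp add: power2_eq_square field_simps)
    finally have a: "\<bar>real n - 2 * real k\<bar> \<le> (sqrt n + (real n - 2 * real k)\<^sup>2 / sqrt n) / 2" by simp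
    have "\<bar>real (n choose k) * (real n - 2 * real k) * \<mu> (s + k)\<bar> = real (n choose k) * (\<bar>real n - 2 * real k\<bar> * \<bar>\<mu> (s + k)\<bar>)"
      by (simp add: abs_mult)
    also have "\<dots> \<le> real (n choose k) * ((sqrt n + (real n - 2 * real k)\<^sup>2 / sqrt n) / 2 * C)"
      using a \<mu> by (intro mult_left_mono mult_mono) auto
    finally show "\<bar>real (n choose k) * (real n - 2 * real k) * \<mu> (s + k)\<bar>
        \<le> C * (real (n choose k) * (sqrt n + (real n - 2 * real k)\<^sup>2 / sqrt n) / 2)"
      by (simp add: mult_ac)
  qed
  also have "\<dots> = C * (sqrt n * (\<Sum>k\<le>n. real (n choose k)) + (\<Sum>k\<le>n. real (n choose k) * (real n - 2 * real k)\<^sup>2) / sqrt n) / 2"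
    by (simp add: sum_distrib_left[symmetric] sum_divide_distrib[symmetric] distrib_left sum.distrib)
      (simp add: sum_distrib_left sum_divide_distrib mult_ac)
  also have "(\<Sum>k\<le>n. real (n choose k)) = 2 ^ n"
    using choose_row_sum[of n] by (metis of_nat_numeral of_nat_power of_nat_sum)
  also have "C * (sqrt n * 2 ^ n + (\<Sum>k\<le>n. real (n choose k) * (real n - 2 * real k)\<^sup>2) / sqrt n) / 2 = C * sqrt n * 2 ^ n"
    unfolding sum_choose_central_second_moment using n0 by (simp add: field_simps)
  finally have "real n * \<bar>D\<bar> \<le> C * sqrt n * 2 ^ n" by (simp add: abs_mult)
  then have "\<bar>D\<bar> \<le> C * sqrt n * 2 ^ n / real n" using n0 by (simp add: field_simps)
  also have "\<dots> = C * 2 ^ n * (sqrt n / real n)" by simp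
  also have "sqrt n / real n = 1 / sqrt n" using n0 by (simp add: field_simps)
  also have "C * 2 ^ n * (1 / sqrt n) = 2 * C / sqrt n * 2 ^ l" by (simp add: n_def)
  finally show ?thesis by (simp add: D_def n_def abs_minus_commute)
qed

section \<open>The multiplexer\<close>

lemma walsh_image:
  assumes "inj_on \<phi> P"
  shows "walsh (\<phi> ` P) x = walsh P {i. \<phi> i \<in> x}"
  using assms by (simp add: walsh_def prod.reindex)

text \<open>The multiplexer \<open>q\<close>: the coordinates \<open>\<phi> (Inl j)\<close> of \<open>x\<close> form an address \<open>A\<close>, and \<open>i \<in> q x\<close> is
  decided by the coordinate \<open>\<phi> (Inr (i, A))\<close> found there. In the Walsh expansion of \<open>walsh F \<circ> q\<close> the sizes
  of the frequencies are \<open>card F\<close> plus a binomial variable, which hides the dependence on \<open>F\<close>.\<close>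

definition address :: "nat \<Rightarrow> (nat + nat \<times> nat set \<Rightarrow> nat) \<Rightarrow> nat set \<Rightarrow> nat set" where
  "address l \<phi> x = {j. j < l \<and> \<phi> (Inl j) \<in> x}"

definition multiplexer :: "nat \<Rightarrow> nat \<Rightarrow> (nat + nat \<times> nat set \<Rightarrow> nat) \<Rightarrow> nat set \<Rightarrow> nat set" where
  "multiplexer l n \<phi> x = {i. i < n \<and> \<phi> (Inr (i, address l \<phi> x)) \<in> x}"

text \<open>Names of the bits before \<open>\<phi>\<close> places them in a block: \<open>l\<close>
  address bits and one data bit for every output \<open>i\<close> and every address
  \<open>A\<close>, so that different addresses read disjoint data.\<close>

definition mux_coords :: "nat \<Rightarrow> nat \<Rightarrow> (nat + nat \<times> nat set) set" where
  "mux_coords l n = Inl ` {..<l} \<union> Inr ` ({..<n} \<times> Pow {..<l})"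

text \<open>The frequencies in the Walsh expansion of \<open>walsh F\<close> after the multiplexer:
  a set \<open>P\<close> of address bits together with the data bits of \<open>F\<close> at the
  address \<open>A\<close>. For given \<open>F\<close> only \<open>P\<close> varies in size, which
  gives the binomial spread.\<close>

definition mux_freq :: "nat set \<Rightarrow> nat set \<times> nat set \<Rightarrow> (nat + nat \<times> nat set) set" where
  "mux_freq F = (\<lambda>(A, P). Inl ` P \<union> Inr ` (F \<times> {A}))"

lemma finite_mux_coords: "finite (mux_coords l n)"
  by (simp add: mux_coords_def)

lemma mux_freq_subset:
  "F \<subseteq> {..<n} \<Longrightarrow> \<theta> \<in> Pow {..<l} \<times> Pow {..<l} \<Longrightarrow> mux_freq F \<theta> \<subseteq> mux_coords l n"
  by (auto simp: mux_freq_def mux_coords_def)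

lemma mux_freq_nonempty: "F \<noteq> {} \<Longrightarrow> mux_freq F \<theta> \<noteq> {}"
  by (auto simp: mux_freq_def split: prod.splits)

text \<open>Any data bit reveals the address, so a nonempty \<open>F\<close> determines
  \<open>A\<close>. Different terms of the expansions of \<open>F\<close> and \<open>G\<close> thus
  have different frequencies, and their cross terms involve off-diagonal entries only.\<close>

lemma mux_freq_inject:
  assumes "F \<noteq> {}" "G \<noteq> {}" "mux_freq F \<theta> = mux_freq G \<theta>'"
  shows "F = G" "\<theta> = \<theta>'"
proof -
  obtain A P A' P' where \<theta>: "\<theta> = (A, P)" "\<theta>' = (A', P')" by (metis surj_pair)
  have mem: "Inl j \<in> mux_freq F (A, P) \<longleftrightarrow> j \<in> P" "Inr (i, B) \<in> mux_freq F (A, P) \<longleftrightarrow> i \<in> F \<and> B = A" for j i B F A P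
    by (auto simp: mux_freq_def)
  have "j \<in> P \<longleftrightarrow> j \<in> P'" for j using mem(1) assms(3) \<theta> by metis
  moreover have *: "i \<in> F \<and> B = A \<longleftrightarrow> i \<in> G \<and> B = A'" for i B using mem(2) assms(3) \<theta> by metis
  ultimately show "F = G" "\<theta> = \<theta>'" using assms(1,2) \<theta> by blast+
qed

lemma card_mux_freq:
  assumes "finite F" "finite P"
  shows "card (mux_freq F (A, P)) = card F + card P"
  using assms unfolding mux_freq_def
  by (subst prod.case, subst card_Un_disjoint) (auto simp: card_image card_cartesian_product)

text \<open>The indicator that \<open>A\<close> is the current address \<open>a\<close> equals the
  sum over \<open>P\<close> of \<open>walsh P A * walsh P a\<close>, divided by
  \<open>2 ^ l\<close>. Weighting the data at each \<open>A\<close> by this indicator and summing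
  over \<open>A\<close> leaves the data that is actually read.\<close>

lemma walsh_multiplexer:
  assumes inj: "inj_on \<phi> (mux_coords l n)" and F: "F \<subseteq> {..<n}"
  shows "walsh F (multiplexer l n \<phi> x)
      = (\<Sum>(A, P)\<in>Pow {..<l} \<times> Pow {..<l}. walsh P A / 2 ^ l * walsh (\<phi> ` mux_freq F (A, P)) x)"
proof -
  define a where "a = address l \<phi> x"
  have a: "a \<subseteq> {..<l}" by (auto simp: a_def address_def)
  have fin: "finite F" using F finite_subset by blast
  have split: "walsh (\<phi> ` mux_freq F (A, P)) x = walsh P a * walsh F {i. \<phi> (Inr (i, A)) \<in> x}"
    if "A \<in> Pow {..<l}" "P \<in> Pow {..<l}" for A P
  proof -
    have "finite P" using that finite_subset by blast
    have "walsh (\<phi> ` mux_freq F (A, P)) x = walsh (mux_freq F (A, P)) {i. \<phi> i \<in> x}"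
      using inj mux_freq_subset[OF F, of "(A, P)"] that by (intro walsh_image) (auto intro: inj_on_subset)
    also have "\<dots> = walsh (Inl ` P) {i. \<phi> i \<in> x} * walsh (Inr ` (F \<times> {A})) {i. \<phi> i \<in> x}"
      unfolding mux_freq_def using fin \<open>finite P\<close> by (subst prod.case, subst walsh_Un_disjoint) auto
    also have "walsh (Inl ` P) {i. \<phi> i \<in> x} = walsh P a"
      unfolding walsh_def a_def address_def using that by (subst prod.reindex) (auto intro!: prod.cong)
    also have "Inr ` (F \<times> {A}) = (\<lambda>i. Inr (i, A)) ` F" by auto
    also have "walsh ((\<lambda>i. Inr (i, A)) ` F) {i. \<phi> i \<in> x} = walsh F {i. \<phi> (Inr (i, A)) \<in> x}"
      by (subst walsh_image) (auto simp: inj_on_def)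
    finally show ?thesis .
  qed
  have "(\<Sum>(A, P)\<in>Pow {..<l} \<times> Pow {..<l}. walsh P A / 2 ^ l * walsh (\<phi> ` mux_freq F (A, P)) x)
      = (\<Sum>A\<in>Pow {..<l}. \<Sum>P\<in>Pow {..<l}. walsh P A / 2 ^ l * (walsh P a * walsh F {i. \<phi> (Inr (i, A)) \<in> x}))"
    unfolding sum.cartesian_product[symmetric] by (intro sum.cong refl) (use split in auto)
  also have "\<dots> = (\<Sum>A\<in>Pow {..<l}. (\<Sum>P\<in>Pow {..<l}. walsh P A * walsh P a) / 2 ^ l * walsh F {i. \<phi> (Inr (i, A)) \<in> x})"
    by (intro sum.cong refl) (simp add: sum_distrib_left sum_distrib_right sum_divide_distrib mult_ac)
  also have "\<dots> = (\<Sum>A\<in>Pow {..<l}. if A = a then walsh F {i. \<phi> (Inr (i, A)) \<in> x} else 0)"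
    using a by (intro sum.cong refl) (simp add: walsh_inversion)
  also have "\<dots> = walsh F {i. \<phi> (Inr (i, a)) \<in> x}" using a by (simp add: sum.delta)
  also have "\<dots> = walsh F (multiplexer l n \<phi> x)"
    unfolding walsh_def multiplexer_def a_def using F by (intro prod.cong) auto
  finally show ?thesis ..
qed

text \<open>Ramsey's theorem makes the diagonal of \<open>t\<close> depend on cardinalities only; a union bound then
  selects coordinates on which the off-diagonal entries are negligible.\<close>

lemma homogeneous_coordinates:
  fixes C \<delta> \<epsilon> :: real and I :: "'i set" and L :: nat
  assumes I: "finite I" and \<delta>: "0 < \<delta>" and \<epsilon>: "0 < \<epsilon>"
  shows "\<exists>m0. \<forall>t :: nat set \<Rightarrow> nat set \<Rightarrow> real. \<forall>m\<ge>m0.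
     (\<forall>S S'. \<bar>t S S'\<bar> \<le> C) \<longrightarrow>
     (\<forall>S'\<subseteq>{..<m}. S' \<noteq> {} \<longrightarrow> card {S. S \<subseteq> {..<m} \<and> S \<noteq> {} \<and> \<delta> < \<bar>t S S'\<bar>} \<le> L) \<longrightarrow>
     (\<forall>S\<subseteq>{..<m}. S \<noteq> {} \<longrightarrow> card {S'. S' \<subseteq> {..<m} \<and> S' \<noteq> {} \<and> \<delta> < \<bar>t S S'\<bar>} \<le> L) \<longrightarrow>
     (\<exists>\<phi> :: 'i \<Rightarrow> nat. \<exists>\<mu> :: nat \<Rightarrow> real. inj_on \<phi> I \<and> \<phi> ` I \<subseteq> {..<m} \<and> (\<forall>s. \<bar>\<mu> s\<bar> \<le> C) \<and>
       (\<forall>P\<subseteq>I. P \<noteq> {} \<longrightarrow> \<bar>t (\<phi> ` P) (\<phi> ` P) - \<mu> (card P)\<bar> \<le> \<epsilon>) \<and>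
       (\<forall>P\<subseteq>I. \<forall>P'\<subseteq>I. P \<noteq> {} \<longrightarrow> P' \<noteq> {} \<longrightarrow> P \<noteq> P' \<longrightarrow> \<bar>t (\<phi> ` P) (\<phi> ` P')\<bar> \<le> \<delta>))"
proof -
  define N where "N = card I"
  define E where "E = {(P, P'). P \<subseteq> I \<and> P' \<subseteq> I \<and> P \<noteq> {} \<and> P' \<noteq> {} \<and> P \<noteq> P'}"
  have finE: "finite E"
    by (rule finite_subset[of _ "Pow I \<times> Pow I"]) (use I in \<open>auto simp: E_def\<close>)
  \<comment> \<open>The union bound over the pairs in \<open>E\<close> needs more than
    \<open>card E * L\<close> candidates for each coordinate.\<close>
  define M where "M = Suc (card E * L)"
  \<comment> \<open>Diagonal values are coloured by the cell of length \<open>\<epsilon>\<close> of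
    the interval from \<open>- C\<close> to \<open>C\<close> in which they lie; this is the number
    of cells.\<close>
  define K where "K = Suc (nat \<lfloor>2 * C / \<epsilon>\<rfloor>)"
  obtain m0 where m0: "\<And>f :: nat set \<Rightarrow> nat. (\<forall>S. f S < K) \<Longrightarrow>
     \<exists>H\<subseteq>{..<m0}. card H = N * M \<and> (\<forall>S S'. S \<subseteq> H \<longrightarrow> S' \<subseteq> H \<longrightarrow> card S = card S' \<longrightarrow> card S \<in> {1..N} \<longrightarrow> f S = f S')"
    using ramsey_all_sizes[of K "N * M" N] by blast
  show ?thesis
  proof (rule exI[of _ m0], intro allI impI)
    fix t :: "nat set \<Rightarrow> nat set \<Rightarrow> real" and m
    assume m: "m0 \<le> m" and tC: "\<forall>S S'. \<bar>t S S'\<bar> \<le> C"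
      and row: "\<forall>S'\<subseteq>{..<m}. S' \<noteq> {} \<longrightarrow> card {S. S \<subseteq> {..<m} \<and> S \<noteq> {} \<and> \<delta> < \<bar>t S S'\<bar>} \<le> L"
      and col: "\<forall>S\<subseteq>{..<m}. S \<noteq> {} \<longrightarrow> card {S'. S' \<subseteq> {..<m} \<and> S' \<noteq> {} \<and> \<delta> < \<bar>t S S'\<bar>} \<le> L"
    have C0: "0 \<le> C" using tC by (meson abs_ge_zero order_trans)
    define f where "f S = nat \<lfloor>(t S S + C) / \<epsilon>\<rfloor>" for S
    have "f S < K" for S
    proof -
      have "t S S \<le> C" using tC by (meson abs_le_D1)
      then have "(t S S + C) / \<epsilon> \<le> 2 * C / \<epsilon>" using \<epsilon> by (intro divide_right_mono) auto
      then have "\<lfloor>(t S S + C) / \<epsilon>\<rfloor> \<le> \<lfloor>2 * C / \<epsilon>\<rfloor>" by (rule floor_mono)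
      then show ?thesis unfolding f_def K_def by (simp add: nat_mono less_Suc_eq_le)
    qed
    then obtain H where H: "H \<subseteq> {..<m0}" "card H = N * M"
      and Hf: "\<And>S S'. S \<subseteq> H \<Longrightarrow> S' \<subseteq> H \<Longrightarrow> card S = card S' \<Longrightarrow> card S \<in> {1..N} \<Longrightarrow> f S = f S'"
      using m0[of f] by blast
    have Hm: "H \<subseteq> {..<m}" using H(1) m by auto
    have Ht: "\<bar>t S S - t S' S'\<bar> \<le> \<epsilon>" if "S \<subseteq> H" "S' \<subseteq> H" "card S = card S'" "card S \<in> {1..N}" for S S'
    proof -
      have ge: "0 \<le> (t S S + C) / \<epsilon>" for S
        using tC \<epsilon> by (smt (verit) divide_nonneg_pos)
      have "\<lfloor>(t S S + C) / \<epsilon>\<rfloor> = \<lfloor>(t S' S' + C) / \<epsilon>\<rfloor>"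
        using Hf[OF that] ge[of S] ge[of S'] unfolding f_def by (simp add: eq_nat_nat_iff)
      then have "\<bar>(t S S + C) / \<epsilon> - (t S' S' + C) / \<epsilon>\<bar> < 1"
        by linarith
      then have "\<bar>t S S - t S' S'\<bar> / \<epsilon> < 1"
        using \<epsilon> by (simp add: diff_divide_distrib[symmetric] abs_divide)
      then show ?thesis using \<epsilon> by simp
    qed
    obtain e where e: "bij_betw e {..<N * M} H"
      using ex_bij_betw_nat_finite[of H] H finite_subset[OF H(1)] by (auto simp: atLeast0LessThan)
    obtain \<iota> where \<iota>: "bij_betw \<iota> I {..<N}"
      using ex_bij_betw_finite_nat[OF I] by (auto simp: N_def atLeast0LessThan)
    \<comment> \<open>The homogeneous set is cut into \<open>N\<close> disjoint slots of
      \<open>M\<close> elements, and \<open>\<psi> i\<close> selects an element from the slot of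
      \<open>i\<close>.\<close>
    define \<Phi> where "\<Phi> \<psi> i = e (\<iota> i * M + \<psi> i)" for \<psi> i
    have slot: "\<iota> i * M + v < N * M" if "i \<in> I" "v < M" for i v
    proof -
      have "Suc (\<iota> i) \<le> N" using bij_betwE[OF \<iota>] that by (auto simp: Suc_le_eq)
      then have "Suc (\<iota> i) * M \<le> N * M" by (rule mult_le_mono1)
      then show ?thesis using that by simp
    qed
    have einj: "i = j \<and> v = w" if "e (\<iota> i * M + v) = e (\<iota> j * M + w)" "i \<in> I" "j \<in> I" "v < M" "w < M" for i j v w
    proof -
      have eq: "\<iota> i * M + v = \<iota> j * M + w"
        using e slot[OF that(2,4)] slot[OF that(3,5)] that(1) by (auto simp: bij_betw_def dest: inj_onD)
      then have "(\<iota> i * M + v) div M = (\<iota> j * M + w) div M" "(\<iota> i * M + v) mod M = (\<iota> j * M + w) mod M" by auto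
      then have "\<iota> i = \<iota> j" "v = w" using that(4,5) by auto
      then show ?thesis using \<iota> that by (auto simp: bij_betw_def dest: inj_onD)
    qed
    have \<Phi>H: "\<Phi> \<psi> ` P \<subseteq> H" if "\<psi> \<in> PiE I (\<lambda>_. {..<M})" "P \<subseteq> I" for \<psi> P
      using e slot that by (auto simp: \<Phi>_def bij_betw_def PiE_def Pi_def subset_iff)
    have \<Phi>inj: "inj_on (\<Phi> \<psi>) I" if "\<psi> \<in> PiE I (\<lambda>_. {..<M})" for \<psi>
      using einj that unfolding \<Phi>_def inj_on_def by (auto simp: PiE_def Pi_def)
    define bad where "bad = (\<lambda>(P, P') \<psi>. \<delta> < \<bar>t (\<Phi> \<psi> ` P) (\<Phi> \<psi> ` P')\<bar>)"
    \<comment> \<open>A coordinate in exactly one of \<open>P\<close> and \<open>P'\<close>: moving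
      it changes one of the two frequencies and leaves the other in place, so that a bound for a
      single row or column limits the bad choices.\<close>
    define k where "k = (\<lambda>(P, P'). SOME i :: 'i. i \<in> sym_diff P P')"
    have k: "k (P, P') \<in> sym_diff P P'" if "(P, P') \<in> E" for P P'
    proof -
      have "\<exists>i. i \<in> sym_diff P P'" using that by (auto simp: E_def)
      from someI_ex[OF this] show ?thesis by (simp add: k_def)
    qed
    \<comment> \<open>As slots are disjoint, different choices in the slot of \<open>i\<close> give
      different images of \<open>P\<close>; bad choices are therefore no more numerous than bad
      frequencies.\<close>
    have injS: "inj_on (\<lambda>v. \<Phi> (\<psi>(i := v)) ` P) {v. v < M}"
      if "\<psi> \<in> PiE I (\<lambda>_. {..<M})" "i \<in> P" "P \<subseteq> I" for \<psi> i P
    proof (rule inj_onI, simp)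
      fix v w assume vw: "v < M" "w < M" and eq: "\<Phi> (\<psi>(i := v)) ` P = \<Phi> (\<psi>(i := w)) ` P"
      have "e (\<iota> i * M + v) \<in> \<Phi> (\<psi>(i := v)) ` P" using that(2) by (auto simp: \<Phi>_def)
      then obtain j where j: "j \<in> P" "e (\<iota> i * M + v) = e (\<iota> j * M + (\<psi>(i := w)) j)"
        using eq by (auto simp: \<Phi>_def)
      moreover have "(\<psi>(i := w)) j < M" using that j vw by (auto simp: PiE_def Pi_def)
      ultimately have "i = j \<and> v = (\<psi>(i := w)) j" using einj[of i v j] vw that by blast
      then show "v = w" by auto
    qed
    have "\<exists>\<psi> \<in> PiE I (\<lambda>_. {..<M}). \<forall>e\<in>E. \<not> bad e \<psi>"
    proof (rule avoid_bad_events[OF I finE])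
      show "k e \<in> I" if "e \<in> E" for e
        using k[of "fst e" "snd e"] that by (auto simp: E_def)
      show "card E * L < M" by (simp add: M_def)
      fix e \<psi> assume "e \<in> E" and \<psi>: "\<psi> \<in> PiE I (\<lambda>_. {..<M})"
      then obtain P P' where e: "e = (P, P')" and PE: "(P, P') \<in> E"
        and P: "P \<subseteq> I" "P' \<subseteq> I" "P \<noteq> {}" "P' \<noteq> {}" by (auto simp: E_def)
      define i where "i = k e"
      have i: "i \<in> sym_diff P P'" using k[OF PE] by (simp add: i_def e)
      have upd: "\<psi>(i := v) \<in> PiE I (\<lambda>_. {..<M})" if "v < M" for v
        using \<psi> that i P by (auto simp: PiE_def extensional_def)
      have sub: "\<Phi> (\<psi>(i := v)) ` R \<subseteq> {..<m}" if "v < M" "R \<subseteq> I" for v R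
        using \<Phi>H[OF upd[OF that(1)] that(2)] Hm by blast
      have const: "\<Phi> (\<psi>(i := v)) ` R = \<Phi> \<psi> ` R" if "i \<notin> R" for v R
        using that by (intro image_cong) (auto simp: \<Phi>_def)
      have fin: "finite {S. S \<subseteq> {..<m} \<and> Q S}" for Q by (rule finite_subset[of _ "Pow {..<m}"]) auto
      show "card {v. v < M \<and> bad e (\<psi>(k e := v))} \<le> L"
      proof (cases "i \<in> P")
        case True
        then have "i \<notin> P'" using i by auto
        let ?B = "{S. S \<subseteq> {..<m} \<and> S \<noteq> {} \<and> \<delta> < \<bar>t S (\<Phi> \<psi> ` P')\<bar>}"
        have img: "(\<lambda>v. \<Phi> (\<psi>(i := v)) ` P) ` {v. v < M \<and> bad e (\<psi>(i := v))} \<subseteq> ?B"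
        proof (intro image_subsetI)
          fix v assume "v \<in> {v. v < M \<and> bad e (\<psi>(i := v))}"
          then have "v < M" "\<delta> < \<bar>t (\<Phi> (\<psi>(i := v)) ` P) (\<Phi> \<psi> ` P')\<bar>"
            by (simp_all add: bad_def e const[OF \<open>i \<notin> P'\<close>])
          then show "\<Phi> (\<psi>(i := v)) ` P \<in> ?B" using sub[OF _ P(1)] P(3) by simp
        qed
        have "card {v. v < M \<and> bad e (\<psi>(i := v))} \<le> card ?B"
          by (rule card_inj_on_le[OF _ img fin]) (rule inj_on_subset[OF injS[OF \<psi> True P(1)]], auto)
        also have "\<dots> \<le> L" using row order_trans[OF \<Phi>H[OF \<psi> P(2)] Hm] P(4) by simp
        finally show ?thesis by (simp add: i_def)
      next
        case False
        then have "i \<in> P'" using i by auto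
        let ?B = "{S. S \<subseteq> {..<m} \<and> S \<noteq> {} \<and> \<delta> < \<bar>t (\<Phi> \<psi> ` P) S\<bar>}"
        have img: "(\<lambda>v. \<Phi> (\<psi>(i := v)) ` P') ` {v. v < M \<and> bad e (\<psi>(i := v))} \<subseteq> ?B"
        proof (intro image_subsetI)
          fix v assume "v \<in> {v. v < M \<and> bad e (\<psi>(i := v))}"
          then have "v < M" "\<delta> < \<bar>t (\<Phi> \<psi> ` P) (\<Phi> (\<psi>(i := v)) ` P')\<bar>"
            by (simp_all add: bad_def e const[OF False])
          then show "\<Phi> (\<psi>(i := v)) ` P' \<in> ?B" using sub[OF _ P(2)] P(4) by simp
        qed
        have "card {v. v < M \<and> bad e (\<psi>(i := v))} \<le> card ?B"
          by (rule card_inj_on_le[OF _ img fin]) (rule inj_on_subset[OF injS[OF \<psi> \<open>i \<in> P'\<close> P(2)]], auto)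
        also have "\<dots> \<le> L" using col order_trans[OF \<Phi>H[OF \<psi> P(1)] Hm] P(3) by simp
        finally show ?thesis by (simp add: i_def)
      qed
    qed
    then obtain \<psi> where \<psi>: "\<psi> \<in> PiE I (\<lambda>_. {..<M})" and good: "\<And>e. e \<in> E \<Longrightarrow> \<not> bad e \<psi>" by blast
    define \<phi> where "\<phi> = \<Phi> \<psi>"
    \<comment> \<open>By homogeneity one reference set represents each size. Subsets of
      \<open>I\<close> have no size above \<open>N\<close>; the value 0 there respects the bound by
      \<open>C\<close>.\<close>
    define \<mu> where "\<mu> s = (if s \<le> N then t (e ` {..<s}) (e ` {..<s}) else 0)" for s
    have diag: "\<bar>t (\<phi> ` P) (\<phi> ` P) - \<mu> (card P)\<bar> \<le> \<epsilon>" if P: "P \<subseteq> I" "P \<noteq> {}" for P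
    proof -
      have cP: "card P \<in> {1..N}" using P I by (auto simp: N_def card_mono Suc_le_eq card_gt_0_iff intro: finite_subset)
      have "card P \<le> N" using cP by simp
      also have "N \<le> N * M" by (simp add: M_def)
      finally have sub: "{..<card P} \<subseteq> {..<N * M}" by (simp only: lessThan_subset_iff)
      then have ie: "inj_on e {..<card P}" and "e ` {..<card P} \<subseteq> H"
        using e by (auto simp: bij_betw_def intro: inj_on_subset)
      moreover have "card (\<phi> ` P) = card P"
        using \<Phi>inj[OF \<psi>] P unfolding \<phi>_def by (intro card_image) (auto intro: inj_on_subset)
      ultimately have "\<bar>t (\<phi> ` P) (\<phi> ` P) - t (e ` {..<card P}) (e ` {..<card P})\<bar> \<le> \<epsilon>"
        using \<Phi>H[OF \<psi> P(1)] cP unfolding \<phi>_def by (intro Ht) (auto simp: card_image)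
      then show ?thesis using cP by (simp add: \<mu>_def)
    qed
    show "\<exists>\<phi> :: 'i \<Rightarrow> nat. \<exists>\<mu> :: nat \<Rightarrow> real. inj_on \<phi> I \<and> \<phi> ` I \<subseteq> {..<m} \<and> (\<forall>s. \<bar>\<mu> s\<bar> \<le> C) \<and>
       (\<forall>P\<subseteq>I. P \<noteq> {} \<longrightarrow> \<bar>t (\<phi> ` P) (\<phi> ` P) - \<mu> (card P)\<bar> \<le> \<epsilon>) \<and>
       (\<forall>P\<subseteq>I. \<forall>P'\<subseteq>I. P \<noteq> {} \<longrightarrow> P' \<noteq> {} \<longrightarrow> P \<noteq> P' \<longrightarrow> \<bar>t (\<phi> ` P) (\<phi> ` P')\<bar> \<le> \<delta>)"
    proof (intro exI[of _ \<phi>] exI[of _ \<mu>] conjI allI impI)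
      show "inj_on \<phi> I" using \<Phi>inj[OF \<psi>] by (simp add: \<phi>_def)
      show "\<phi> ` I \<subseteq> {..<m}" using \<Phi>H[OF \<psi>, of I] Hm by (auto simp: \<phi>_def)
      show "\<bar>\<mu> s\<bar> \<le> C" for s using tC C0 by (simp add: \<mu>_def)
      show "\<bar>t (\<phi> ` P) (\<phi> ` P) - \<mu> (card P)\<bar> \<le> \<epsilon>" if "P \<subseteq> I" "P \<noteq> {}" for P using diag[OF that] .
      show "\<bar>t (\<phi> ` P) (\<phi> ` P')\<bar> \<le> \<delta>" if "P \<subseteq> I" "P' \<subseteq> I" "P \<noteq> {}" "P' \<noteq> {}" "P \<noteq> P'" for P P'
        using good[of "(P, P')"] that by (auto simp: E_def bad_def \<phi>_def)
    qed
  qed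
qed

text \<open>The double sum is the matrix entry at \<open>F\<close> and \<open>G\<close> after
  composition with the multiplexer. Both \<open>l\<close> and \<open>m0\<close> are chosen before
  the matrix, and \<open>Lf\<close> is a function because the level \<open>\<delta>\<close> below
  which entries are negligible depends on \<open>l\<close>. Up to small errors the entry vanishes
  for \<open>F \<noteq> G\<close> and is a binomial average \<open>g (card F)\<close> for
  \<open>F = G\<close>, which is then compared with \<open>g 1\<close>.\<close>

lemma finite_diagonalization:
  fixes C \<eta> :: real and n :: nat and Lf :: "real \<Rightarrow> nat"
  assumes C: "0 \<le> C" and \<eta>: "0 < \<eta>"
  shows "\<exists>l m0. \<forall>t :: nat set \<Rightarrow> nat set \<Rightarrow> real. \<forall>m\<ge>m0.
     (\<forall>S S'. \<bar>t S S'\<bar> \<le> C) \<longrightarrow>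
     (\<forall>\<delta>>0. \<forall>S'\<subseteq>{..<m}. S' \<noteq> {} \<longrightarrow> card {S. S \<subseteq> {..<m} \<and> S \<noteq> {} \<and> \<delta> < \<bar>t S S'\<bar>} \<le> Lf \<delta>) \<longrightarrow>
     (\<forall>\<delta>>0. \<forall>S\<subseteq>{..<m}. S \<noteq> {} \<longrightarrow> card {S'. S' \<subseteq> {..<m} \<and> S' \<noteq> {} \<and> \<delta> < \<bar>t S S'\<bar>} \<le> Lf \<delta>) \<longrightarrow>
     (\<exists>\<phi> c. inj_on \<phi> (mux_coords l n) \<and> \<phi> ` mux_coords l n \<subseteq> {..<m} \<and> \<bar>c\<bar> \<le> C \<and>
       (\<forall>F\<subseteq>{..<n}. \<forall>G\<subseteq>{..<n}. F \<noteq> {} \<longrightarrow> G \<noteq> {} \<longrightarrow>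
         \<bar>(\<Sum>(A, P)\<in>Pow {..<l} \<times> Pow {..<l}. \<Sum>(A', P')\<in>Pow {..<l} \<times> Pow {..<l}.
            walsh P A / 2 ^ l * (walsh P' A' / 2 ^ l) * t (\<phi> ` mux_freq F (A, P)) (\<phi> ` mux_freq G (A', P')))
          - (if F = G then c else 0)\<bar> \<le> \<eta>))"
proof -
  \<comment> \<open>Raising \<open>card F\<close> from 1 to at most \<open>n\<close> takes fewer
    than \<open>n\<close> steps, each moving the binomial average by at most
    \<open>2 * C / sqrt (Suc l)\<close>; together they may use \<open>\<eta> / 3\<close>.\<close>
  obtain l :: nat where l: "(6 * C * real n / \<eta>)\<^sup>2 \<le> real l" using real_arch_simple by blast
  have ln: "real n * (2 * C / sqrt (Suc l)) \<le> \<eta> / 3"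
  proof -
    have "6 * C * real n / \<eta> \<le> sqrt (Suc l)"
      by (rule real_le_rsqrt) (use l in auto)
    then show ?thesis using \<eta> by (simp add: field_simps)
  qed
  \<comment> \<open>There are \<open>16 ^ l\<close> pairs of terms with coefficients of modulus
    \<open>1 / 4 ^ l\<close>, so off-diagonal entries up to \<open>\<delta>\<close> add up to at
    most \<open>4 ^ l * \<delta> = \<eta> / 3\<close>.\<close>
  define \<delta> where "\<delta> = \<eta> / (3 * 4 ^ l)"
  have \<delta>: "0 < \<delta>" using \<eta> by (simp add: \<delta>_def)
  obtain m0 where m0: "\<And>(t :: nat set \<Rightarrow> nat set \<Rightarrow> real) m. m \<ge> m0 \<Longrightarrow>
     (\<forall>S S'. \<bar>t S S'\<bar> \<le> C) \<Longrightarrow>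
     (\<forall>S'\<subseteq>{..<m}. S' \<noteq> {} \<longrightarrow> card {S. S \<subseteq> {..<m} \<and> S \<noteq> {} \<and> \<delta> < \<bar>t S S'\<bar>} \<le> Lf \<delta>) \<Longrightarrow>
     (\<forall>S\<subseteq>{..<m}. S \<noteq> {} \<longrightarrow> card {S'. S' \<subseteq> {..<m} \<and> S' \<noteq> {} \<and> \<delta> < \<bar>t S S'\<bar>} \<le> Lf \<delta>) \<Longrightarrow>
     (\<exists>\<phi>. \<exists>\<mu> :: nat \<Rightarrow> real. inj_on \<phi> (mux_coords l n) \<and> \<phi> ` (mux_coords l n) \<subseteq> {..<m} \<and> (\<forall>s. \<bar>\<mu> s\<bar> \<le> C) \<and>
       (\<forall>P\<subseteq>mux_coords l n. P \<noteq> {} \<longrightarrow> \<bar>t (\<phi> ` P) (\<phi> ` P) - \<mu> (card P)\<bar> \<le> \<eta> / 3) \<and>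
       (\<forall>P\<subseteq>mux_coords l n. \<forall>P'\<subseteq>mux_coords l n. P \<noteq> {} \<longrightarrow> P' \<noteq> {} \<longrightarrow> P \<noteq> P' \<longrightarrow> \<bar>t (\<phi> ` P) (\<phi> ` P')\<bar> \<le> \<delta>))"
    using homogeneous_coordinates[OF finite_mux_coords[of l n] \<delta>, of "\<eta> / 3" C "Lf \<delta>"] \<eta> by auto
  show ?thesis
  proof (rule exI[of _ l], rule exI[of _ m0], intro allI impI)
    fix t :: "nat set \<Rightarrow> nat set \<Rightarrow> real" and m
    assume asm: "m0 \<le> m" "\<forall>S S'. \<bar>t S S'\<bar> \<le> C"
      "\<forall>\<delta>>0. \<forall>S'\<subseteq>{..<m}. S' \<noteq> {} \<longrightarrow> card {S. S \<subseteq> {..<m} \<and> S \<noteq> {} \<and> \<delta> < \<bar>t S S'\<bar>} \<le> Lf \<delta>"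
      "\<forall>\<delta>>0. \<forall>S\<subseteq>{..<m}. S \<noteq> {} \<longrightarrow> card {S'. S' \<subseteq> {..<m} \<and> S' \<noteq> {} \<and> \<delta> < \<bar>t S S'\<bar>} \<le> Lf \<delta>"
    obtain \<phi> and \<mu> :: "nat \<Rightarrow> real" where *: "inj_on \<phi> (mux_coords l n) \<and> \<phi> ` (mux_coords l n) \<subseteq> {..<m} \<and> (\<forall>s. \<bar>\<mu> s\<bar> \<le> C) \<and>
       (\<forall>P\<subseteq>mux_coords l n. P \<noteq> {} \<longrightarrow> \<bar>t (\<phi> ` P) (\<phi> ` P) - \<mu> (card P)\<bar> \<le> \<eta> / 3) \<and>
       (\<forall>P\<subseteq>mux_coords l n. \<forall>P'\<subseteq>mux_coords l n. P \<noteq> {} \<longrightarrow> P' \<noteq> {} \<longrightarrow> P \<noteq> P' \<longrightarrow> \<bar>t (\<phi> ` P) (\<phi> ` P')\<bar> \<le> \<delta>)"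
      using m0[OF asm(1,2) asm(3)[THEN spec, THEN mp, OF \<delta>] asm(4)[THEN spec, THEN mp, OF \<delta>]] by (elim exE)
    have \<phi>: "inj_on \<phi> (mux_coords l n)" "\<phi> ` (mux_coords l n) \<subseteq> {..<m}" and \<mu>: "\<And>s. \<bar>\<mu> s\<bar> \<le> C"
      and diag: "\<And>P. P \<subseteq> mux_coords l n \<Longrightarrow> P \<noteq> {} \<Longrightarrow> \<bar>t (\<phi> ` P) (\<phi> ` P) - \<mu> (card P)\<bar> \<le> \<eta> / 3"
      and off: "\<And>P P'. P \<subseteq> mux_coords l n \<Longrightarrow> P' \<subseteq> mux_coords l n \<Longrightarrow> P \<noteq> {} \<Longrightarrow> P' \<noteq> {} \<Longrightarrow> P \<noteq> P' \<Longrightarrow>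
          \<bar>t (\<phi> ` P) (\<phi> ` P')\<bar> \<le> \<delta>"
      using * by simp_all
    define g where "g s = (\<Sum>k\<le>l. real (l choose k) * \<mu> (s + k)) / 2 ^ l" for s
    define \<Theta> where "\<Theta> = Pow {..<l} \<times> Pow {..<l}"
    define \<kappa> where "\<kappa> = (\<lambda>(A :: nat set, P). walsh P A / 2 ^ l)"
    have fin\<Theta>: "finite \<Theta>" by (simp add: \<Theta>_def)
    have card\<Theta>: "real (card \<Theta>) = 4 ^ l"
      by (simp add: \<Theta>_def card_cartesian_product card_Pow power_mult_distrib[symmetric])
    have \<kappa>: "\<bar>\<kappa> \<theta> * \<kappa> \<theta>'\<bar> = 1 / 4 ^ l" for \<theta> \<theta>'
      by (simp add: \<kappa>_def abs_mult abs_divide power_mult_distrib[symmetric] split: prod.split)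
    have \<kappa>2: "\<kappa> \<theta> * \<kappa> \<theta> = 1 / 4 ^ l" for \<theta>
      using \<kappa>[of \<theta> \<theta>] by (simp add: abs_mult_self_eq)
    have gshift: "\<bar>g (Suc s) - g s\<bar> \<le> 2 * C / sqrt (Suc l)" for s
    proof -
      have "\<bar>g (Suc s) - g s\<bar> = \<bar>(\<Sum>k\<le>l. real (l choose k) * \<mu> (Suc s + k)) - (\<Sum>k\<le>l. real (l choose k) * \<mu> (s + k))\<bar> / 2 ^ l"
        by (simp add: g_def diff_divide_distrib[symmetric] abs_divide)
      also have "\<dots> \<le> 2 * C / sqrt (Suc l) * 2 ^ l / 2 ^ l"
        using binomial_average_shift[OF \<mu>] by (intro divide_right_mono) auto
      finally show ?thesis by simp
    qed
    have gj: "\<bar>g (Suc j) - g 1\<bar> \<le> real j * (2 * C / sqrt (Suc l))" for j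
    proof (induction j)
      case (Suc j)
      have "\<bar>g (Suc (Suc j)) - g 1\<bar> \<le> \<bar>g (Suc (Suc j)) - g (Suc j)\<bar> + \<bar>g (Suc j) - g 1\<bar>" by linarith
      also have "\<dots> \<le> 2 * C / sqrt (Suc l) + real j * (2 * C / sqrt (Suc l))"
        using gshift[of "Suc j"] Suc by (intro add_mono)
      finally show ?case by (simp add: algebra_simps add_divide_distrib)
    qed simp
    have "\<bar>g 1\<bar> \<le> C"
    proof -
      have "\<bar>\<Sum>k\<le>l. real (l choose k) * \<mu> (1 + k)\<bar> \<le> (\<Sum>k\<le>l. \<bar>real (l choose k) * \<mu> (1 + k)\<bar>)" by (rule sum_abs)
      also have "\<dots> \<le> (\<Sum>k\<le>l. real (l choose k) * C)" using \<mu> by (intro sum_mono) (auto simp: abs_mult mult_left_mono)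
      also have "\<dots> = 2 ^ l * C"
        unfolding sum_distrib_right[symmetric] using choose_row_sum[of l] by (metis of_nat_numeral of_nat_power of_nat_sum)
      finally show ?thesis by (simp add: g_def abs_divide divide_le_eq mult.commute)
    qed
    moreover have "\<bar>(\<Sum>\<theta>\<in>\<Theta>. \<Sum>\<theta>'\<in>\<Theta>. \<kappa> \<theta> * \<kappa> \<theta>' * t (\<phi> ` mux_freq F \<theta>) (\<phi> ` mux_freq G \<theta>')) - (if F = G then g 1 else 0)\<bar> \<le> \<eta>"
      if F: "F \<subseteq> {..<n}" "F \<noteq> {}" and G: "G \<subseteq> {..<n}" "G \<noteq> {}" for F G
    proof -
      have finF: "finite F" using F finite_subset by blast
      \<comment> \<open>The ideal terms: off-diagonal ones are dropped, and diagonal ones are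
        replaced by the value belonging to the size of the frequency.\<close>
      define d where "d \<theta> \<theta>' = (if F = G \<and> \<theta> = \<theta>' then \<mu> (card F + card (snd \<theta>)) / 4 ^ l else 0)" for \<theta> \<theta>' :: "nat set \<times> nat set"
      have entry: "\<bar>\<kappa> \<theta> * \<kappa> \<theta>' * t (\<phi> ` mux_freq F \<theta>) (\<phi> ` mux_freq G \<theta>') - d \<theta> \<theta>'\<bar>
          \<le> \<delta> / 4 ^ l + (if \<theta> = \<theta>' then \<eta> / 3 / 4 ^ l else 0)" if \<theta>: "\<theta> \<in> \<Theta>" "\<theta>' \<in> \<Theta>" for \<theta> \<theta>'
      proof (cases "F = G \<and> \<theta> = \<theta>'")
        case True
        obtain A P where AP: "\<theta> = (A, P)" "P \<subseteq> {..<l}" using \<theta> by (auto simp: \<Theta>_def)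
        then have "finite P" using finite_subset by blast
        then have "card (mux_freq F \<theta>) = card F + card (snd \<theta>)" using card_mux_freq[OF finF] AP by simp
        then have "\<bar>t (\<phi> ` mux_freq F \<theta>) (\<phi> ` mux_freq F \<theta>) - \<mu> (card F + card (snd \<theta>))\<bar> \<le> \<eta> / 3"
          using diag[OF mux_freq_subset[OF F(1)] mux_freq_nonempty[OF F(2)], of \<theta>] \<theta> by (simp add: \<Theta>_def)
        then have "\<bar>t (\<phi> ` mux_freq F \<theta>) (\<phi> ` mux_freq F \<theta>) - \<mu> (card F + card (snd \<theta>))\<bar> / 4 ^ l \<le> \<eta> / 3 / 4 ^ l"
          by (rule divide_right_mono) simp
        moreover have "\<bar>t (\<phi> ` mux_freq F \<theta>) (\<phi> ` mux_freq F \<theta>) - \<mu> (card F + card (snd \<theta>))\<bar> / 4 ^ l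
            = \<bar>\<kappa> \<theta> * \<kappa> \<theta>' * t (\<phi> ` mux_freq F \<theta>) (\<phi> ` mux_freq G \<theta>') - d \<theta> \<theta>'\<bar>"
          using True by (simp add: \<kappa>2 d_def diff_divide_distrib[symmetric] abs_divide)
        moreover have "0 \<le> \<delta> / 4 ^ l" using \<delta> by simp
        ultimately show ?thesis using True by simp
      next
        case False
        then have "mux_freq F \<theta> \<noteq> mux_freq G \<theta>'" using mux_freq_inject[OF F(2) G(2), of \<theta> \<theta>'] by blast
        then have "\<bar>t (\<phi> ` mux_freq F \<theta>) (\<phi> ` mux_freq G \<theta>')\<bar> \<le> \<delta>"
          using \<theta> unfolding \<Theta>_def
          by (intro off mux_freq_subset F G mux_freq_nonempty)
        then have "\<bar>\<kappa> \<theta> * \<kappa> \<theta>' * t (\<phi> ` mux_freq F \<theta>) (\<phi> ` mux_freq G \<theta>')\<bar> \<le> \<delta> / 4 ^ l"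
          unfolding abs_mult[of "\<kappa> \<theta> * \<kappa> \<theta>'"] \<kappa> by (simp add: divide_right_mono)
        moreover have "0 \<le> \<eta> / 3 / 4 ^ l" using \<eta> by simp
        ultimately show ?thesis using False by (auto simp: d_def)
      qed
      have "\<bar>(\<Sum>\<theta>\<in>\<Theta>. \<Sum>\<theta>'\<in>\<Theta>. \<kappa> \<theta> * \<kappa> \<theta>' * t (\<phi> ` mux_freq F \<theta>) (\<phi> ` mux_freq G \<theta>')) - (\<Sum>\<theta>\<in>\<Theta>. \<Sum>\<theta>'\<in>\<Theta>. d \<theta> \<theta>')\<bar>
          \<le> (\<Sum>\<theta>\<in>\<Theta>. \<Sum>\<theta>'\<in>\<Theta>. \<bar>\<kappa> \<theta> * \<kappa> \<theta>' * t (\<phi> ` mux_freq F \<theta>) (\<phi> ` mux_freq G \<theta>') - d \<theta> \<theta>'\<bar>)"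
        unfolding sum_subtractf[symmetric] by (intro order_trans[OF sum_abs] sum_mono order_trans[OF sum_abs] order_refl)
      also have "\<dots> \<le> (\<Sum>\<theta>\<in>\<Theta>. \<Sum>\<theta>'\<in>\<Theta>. \<delta> / 4 ^ l + (if \<theta> = \<theta>' then \<eta> / 3 / 4 ^ l else 0))"
        by (intro sum_mono entry)
      also have "\<dots> = 4 ^ l * (4 ^ l * (\<delta> / 4 ^ l)) + 4 ^ l * (\<eta> / 3 / 4 ^ l)"
        using fin\<Theta> by (simp add: sum.distrib card\<Theta> distrib_left)
      also have "\<dots> = \<eta> / 3 + \<eta> / 3" by (simp add: \<delta>_def)
      finally have close: "\<bar>(\<Sum>\<theta>\<in>\<Theta>. \<Sum>\<theta>'\<in>\<Theta>. \<kappa> \<theta> * \<kappa> \<theta>' * t (\<phi> ` mux_freq F \<theta>) (\<phi> ` mux_freq G \<theta>')) - (\<Sum>\<theta>\<in>\<Theta>. \<Sum>\<theta>'\<in>\<Theta>. d \<theta> \<theta>')\<bar>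
          \<le> \<eta> / 3 + \<eta> / 3" .
      have "\<bar>(\<Sum>\<theta>\<in>\<Theta>. \<Sum>\<theta>'\<in>\<Theta>. d \<theta> \<theta>') - (if F = G then g 1 else 0)\<bar> \<le> \<eta> / 3"
      proof (cases "F = G")
        case True
        have "(\<Sum>\<theta>\<in>\<Theta>. \<Sum>\<theta>'\<in>\<Theta>. d \<theta> \<theta>') = (\<Sum>\<theta>\<in>\<Theta>. \<mu> (card F + card (snd \<theta>)) / 4 ^ l)"
          unfolding d_def using True fin\<Theta> by simp
        also have "\<dots> = (\<Sum>A\<in>Pow {..<l}. \<Sum>P\<in>Pow {..<l}. \<mu> (card F + card P)) / 4 ^ l"
          unfolding \<Theta>_def sum_divide_distrib sum.cartesian_product by (simp add: case_prod_beta)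
        also have "\<dots> = 2 ^ l * (\<Sum>P\<in>Pow {..<l}. \<mu> (card F + card P)) / 4 ^ l" by (simp add: card_Pow)
        also have "\<dots> = g (card F)"
          using sum_Pow_card[of "{..<l}" "\<lambda>k. \<mu> (card F + k)"]
          by (simp add: g_def field_simps power_mult_distrib[symmetric])
        finally have "(\<Sum>\<theta>\<in>\<Theta>. \<Sum>\<theta>'\<in>\<Theta>. d \<theta> \<theta>') = g (card F)" .
        moreover obtain j where j: "card F = Suc j" using F finF by (metis card_0_eq not0_implies_Suc)
        moreover have "\<bar>g (Suc j) - g 1\<bar> \<le> \<eta> / 3"
        proof -
          have "card F \<le> n" using card_mono[OF _ F(1)] by simp
          then have "real j * (2 * C / sqrt (Suc l)) \<le> real n * (2 * C / sqrt (Suc l))"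
            using C j by (intro mult_right_mono) auto
          then show ?thesis using gj[of j] ln by linarith
        qed
        ultimately show ?thesis using True by simp
      next
        case False
        then show ?thesis using \<eta> by (simp add: d_def)
      qed
      with close show ?thesis by linarith
    qed
    ultimately show "\<exists>\<phi> c. inj_on \<phi> (mux_coords l n) \<and> \<phi> ` mux_coords l n \<subseteq> {..<m} \<and> \<bar>c\<bar> \<le> C \<and>
       (\<forall>F\<subseteq>{..<n}. \<forall>G\<subseteq>{..<n}. F \<noteq> {} \<longrightarrow> G \<noteq> {} \<longrightarrow>
         \<bar>(\<Sum>(A, P)\<in>Pow {..<l} \<times> Pow {..<l}. \<Sum>(A', P')\<in>Pow {..<l} \<times> Pow {..<l}.
            walsh P A / 2 ^ l * (walsh P' A' / 2 ^ l) * t (\<phi> ` mux_freq F (A, P)) (\<phi> ` mux_freq G (A', P')))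
          - (if F = G then c else 0)\<bar> \<le> \<eta>)"
      using \<phi> unfolding \<Theta>_def \<kappa>_def by (intro exI[of _ \<phi>] exI[of _ "g 1"]) (auto simp: case_prod_beta)
  qed
qed

section \<open>Sign patterns of the Haar copies\<close>

lemma walsh_expansion:
  assumes "finite J" "y \<subseteq> J"
  shows "u y = (\<Sum>F\<in>Pow J. (\<Sum>z\<in>Pow J. u z * walsh F z) / 2 ^ card J * walsh F y)"
proof -
  have "(\<Sum>F\<in>Pow J. (\<Sum>z\<in>Pow J. u z * walsh F z) / 2 ^ card J * walsh F y)
      = (\<Sum>F\<in>Pow J. \<Sum>z\<in>Pow J. u z * (walsh F z * walsh F y) / 2 ^ card J)"
    by (intro sum.cong refl) (simp add: sum_distrib_left sum_distrib_right sum_divide_distrib mult_ac)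
  also have "\<dots> = (\<Sum>z\<in>Pow J. u z * (\<Sum>F\<in>Pow J. walsh F z * walsh F y) / 2 ^ card J)"
    by (subst sum.swap) (simp add: sum_distrib_left sum_divide_distrib)
  also have "\<dots> = (\<Sum>z\<in>Pow J. if z = y then u z else 0)"
    using assms by (intro sum.cong refl) (simp add: walsh_inversion)
  also have "\<dots> = u y" using assms by (simp add: sum.delta)
  finally show ?thesis ..
qed

text \<open>Independent random sets, the n-th one uniformly distributed on the subsets of
  \<open>{..<n}\<close>. Law and independence are stated through integrals of real functions, a form
  that passes directly to compositions with maps between blocks.\<close>

definition block_system :: "(nat \<Rightarrow> real \<Rightarrow> nat set) \<Rightarrow> bool" where
  "block_system \<xi> \<longleftrightarrow>
     (\<forall>n\<ge>1. \<xi> n \<in> measurable unitM (count_space UNIV) \<and> (\<forall>x. \<xi> n x \<subseteq> {..<n}) \<and>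
        (\<forall>u :: nat set \<Rightarrow> real. (\<integral>x. u (\<xi> n x) \<partial>unitM) = (\<Sum>y\<in>Pow {..<n}. u y) / 2 ^ n)) \<and>
     (\<forall>X. finite X \<longrightarrow> X \<subseteq> {1..} \<longrightarrow> (\<forall>u :: nat \<Rightarrow> nat set \<Rightarrow> real.
        (\<integral>x. (\<Prod>n\<in>X. u n (\<xi> n x)) \<partial>unitM) = (\<Prod>n\<in>X. \<integral>x. u n (\<xi> n x) \<partial>unitM)))"

section \<open>Dyadic cells and binary digits\<close>

text \<open>For \<open>t\<close> in the half-open unit interval this numbers the dyadic interval of
  length 2^-j containing \<open>t\<close>, counting from 0, whereas coded intervals count from
  1.\<close>

definition cell :: "nat \<Rightarrow> real \<Rightarrow> nat" where
  "cell j t = nat \<lfloor>2 ^ j * t\<rfloor>"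

text \<open>The binary digits of \<open>v\<close> with the most significant one at position 0; a
  digit 1 means a right half and hence the sign -1.\<close>

definition digits :: "nat \<Rightarrow> nat \<Rightarrow> nat set" where
  "digits n v = {j. j < n \<and> odd (v div 2 ^ (n - Suc j))}"

text \<open>For Haar functions the inner sum is the j-th Rademacher function, and the set records
  where it is -1. Written as a condition on a vector of values, it applies equally to the
  copies.\<close>

definition sign_pattern :: "nat \<Rightarrow> (nat \<times> nat \<Rightarrow> real) \<Rightarrow> nat set" where
  "sign_pattern n v = {j. j < n \<and> (\<Sum>i\<in>{1..2 ^ j}. v (j, i)) < 0}"

lemma cell_Suc_div: "cell (Suc j) t div 2 = cell j t"
proof -
  have "\<lfloor>(2 ^ Suc j * t) / real_of_int 2\<rfloor> = \<lfloor>2 ^ Suc j * t\<rfloor> div 2"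
    by (rule floor_divide_real_eq_div) simp
  then have "\<lfloor>2 ^ j * t\<rfloor> = \<lfloor>2 ^ Suc j * t\<rfloor> div 2" by simp
  then show ?thesis by (simp add: cell_def nat_div_distrib')
qed

lemma cell_div_power: "k \<le> n \<Longrightarrow> cell n t div 2 ^ (n - k) = cell k t"
proof (induction n)
  case (Suc n)
  show ?case
  proof (cases "k = Suc n")
    case False
    then have "k \<le> n" using Suc by simp
    have "cell (Suc n) t div 2 ^ (Suc n - k) = cell (Suc n) t div 2 div 2 ^ (n - k)"
      using \<open>k \<le> n\<close> by (simp add: Suc_diff_le div_mult2_eq)
    then show ?thesis using Suc.IH[OF \<open>k \<le> n\<close>] by (simp add: cell_Suc_div)
  qed simp
qed simp

lemma cell_less: "0 \<le> t \<Longrightarrow> t < 1 \<Longrightarrow> cell j t < 2 ^ j"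
  by (simp add: cell_def nat_less_iff floor_less_iff)

lemma cell_eq_iff:
  assumes "0 \<le> t"
  shows "cell j t = v \<longleftrightarrow> real v / 2 ^ j \<le> t \<and> t < real (Suc v) / 2 ^ j"
proof -
  have "cell j t = v \<longleftrightarrow> \<lfloor>2 ^ j * t\<rfloor> = int v"
    using assms by (auto simp: cell_def)
  also have "\<dots> \<longleftrightarrow> real v \<le> 2 ^ j * t \<and> 2 ^ j * t < real v + 1"
    by (simp add: floor_eq_iff)
  finally show ?thesis by (simp add: field_simps)
qed

text \<open>One level below, the left half of the i-th interval is the cell
  \<open>2 * (i - 1)\<close> and the right half is the next cell, so the parity of the finer cell
  gives the sign.\<close>

lemma haar_cell:
  assumes t: "0 \<le> t" and i: "1 \<le> i"
  shows "haar (j, i) t = (if i = Suc (cell j t) then (if odd (cell (Suc j) t) then -1 else 1) else 0)"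
proof -
  have l: "t \<in> dyad_left (j, i) \<longleftrightarrow> cell (Suc j) t = 2 * (i - 1)"
    unfolding cell_eq_iff[OF t] dyad_left_def using i by (auto simp: field_simps of_nat_diff)
  have r: "t \<in> dyad_right (j, i) \<longleftrightarrow> cell (Suc j) t = 2 * (i - 1) + 1"
    unfolding cell_eq_iff[OF t] dyad_right_def using i by (auto simp: field_simps of_nat_diff)
  have c: "cell j t = cell (Suc j) t div 2" by (simp add: cell_Suc_div)
  show ?thesis unfolding haar_def indicator_def l r c using i by (auto elim!: oddE evenE)
qed

lemma sum_haar:
  assumes "0 \<le> t" "t < 1"
  shows "(\<Sum>i\<in>{1..2 ^ j}. haar (j, i) t) = (if odd (cell (Suc j) t) then -1 else 1)"
proof -
  have "(\<Sum>i\<in>{1..2 ^ j}. haar (j, i) t) = (\<Sum>i\<in>{1..2 ^ j}. if i = Suc (cell j t) then (if odd (cell (Suc j) t) then -1 else 1) else 0)"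
    by (intro sum.cong refl) (use haar_cell[OF assms(1)] in auto)
  also have "\<dots> = (if odd (cell (Suc j) t) then -1 else 1)"
    using cell_less[OF assms, of j] by (subst sum.delta) auto
  finally show ?thesis .
qed

lemma sign_pattern_haar:
  assumes "0 \<le> t" "t < 1"
  shows "sign_pattern n (\<lambda>I. haar I t) = digits n (cell n t)"
proof -
  have "odd (cell n t div 2 ^ (n - Suc j)) \<longleftrightarrow> odd (cell (Suc j) t)" if "j < n" for j
    using that by (simp add: cell_div_power)
  then show ?thesis unfolding sign_pattern_def sum_haar[OF assms] digits_def by auto
qed

lemma digits_Suc: "digits (Suc n) v = digits n (v div 2) \<union> (if odd v then {n} else {})"
proof -
  have "odd (v div 2 ^ (Suc n - Suc j)) \<longleftrightarrow> odd (v div 2 div 2 ^ (n - Suc j))" if "j < n" for j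
  proof -
    have "Suc n - Suc j = Suc (n - Suc j)" using that by simp
    then show ?thesis by (simp only: power_Suc div_mult2_eq)
  qed
  then show ?thesis unfolding digits_def by (auto simp: less_Suc_eq)
qed

lemma digits_subset: "digits n v \<subseteq> {..<n}"
  by (auto simp: digits_def)

lemma digits_inj: "v < 2 ^ n \<Longrightarrow> w < 2 ^ n \<Longrightarrow> digits n v = digits n w \<Longrightarrow> v = w"
proof (induction n arbitrary: v w)
  case (Suc n)
  have "n \<in> digits (Suc n) v \<longleftrightarrow> odd v" "digits (Suc n) v \<inter> {..<n} = digits n (v div 2)" for v
    unfolding digits_Suc using digits_subset[of n] by auto
  then have "odd v \<longleftrightarrow> odd w" "digits n (v div 2) = digits n (w div 2)" using Suc.prems(3) by metis+
  moreover have "v div 2 = w div 2"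
    using Suc.prems by (intro Suc.IH calculation) auto
  ultimately show ?case by (metis bit_eq_rec)
qed simp

lemma bij_betw_digits: "bij_betw (digits n) {..<2 ^ n} (Pow {..<n})"
proof -
  have inj: "inj_on (digits n) {..<2 ^ n}" by (rule inj_onI) (use digits_inj in auto)
  moreover have "digits n ` {..<2 ^ n} = Pow {..<n}"
    by (rule card_subset_eq) (use digits_subset in \<open>auto simp: card_image[OF inj] card_Pow\<close>)
  ultimately show ?thesis by (simp add: bij_betw_def)
qed

text \<open>The right end point lies in no dyadic interval and has to be discarded before cells are
  used.\<close>

lemma AE_unitM_unit_interval: "AE t in unitM. 0 \<le> t \<and> t < 1"
proof -
  have "AE t in lborel. t \<noteq> (1::real)" by (rule AE_lborel_singleton)
  then have "AE t in lborel. t \<in> {0..1} \<longrightarrow> 0 \<le> t \<and> t < (1::real)"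
    by eventually_elim auto
  then show ?thesis unfolding unitM_def by (subst AE_restrict_space_iff) auto
qed

lemma integral_cell:
  fixes u :: "nat \<Rightarrow> real"
  shows "(\<integral>t. u (cell n t) \<partial>unitM) = (\<Sum>v<2 ^ n. u v) / 2 ^ n"
proof -
  let ?I = "\<lambda>v::nat. {real v / 2 ^ n ..< real (Suc v) / 2 ^ n}"
  have sub: "?I v \<subseteq> {0..1}" if "v < 2 ^ n" for v
  proof -
    have "real (Suc v) \<le> 2 ^ n" using that by (metis Suc_leI of_nat_le_iff of_nat_numeral of_nat_power)
    then have "real (Suc v) / 2 ^ n \<le> 1" by simp
    moreover have "0 \<le> real v / 2 ^ n" by simp
    ultimately show ?thesis
      by (intro subsetI) (simp only: atLeastLessThan_iff atLeastAtMost_iff, linarith)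
  qed
  have Isets [measurable]: "?I v \<in> sets unitM" if "v < 2 ^ n" for v
    unfolding unitM_def using sub[OF that] by (subst sets_restrict_space_iff) auto
  have I: "measure unitM (?I v) = 1 / 2 ^ n" if "v < 2 ^ n" for v
    unfolding unitM_def using sub[OF that] by (subst measure_restrict_space) (auto simp: field_simps)
  have "cell n = (\<lambda>t. nat \<lfloor>2 ^ n * t\<rfloor>)" by (auto simp: cell_def)
  then have [measurable]: "cell n \<in> measurable unitM (count_space UNIV)"
    unfolding unitM_def by (simp add: measurable_restrict_space1)
  have "(\<integral>t. u (cell n t) \<partial>unitM) = (\<integral>t. (\<Sum>v<2 ^ n. u v * indicator (?I v) t) \<partial>unitM)"
  proof (rule integral_cong_AE)
    show "AE t in unitM. u (cell n t) = (\<Sum>v<2 ^ n. u v * indicator (?I v) t)"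
      using AE_unitM_unit_interval
    proof eventually_elim
      case (elim t)
      then have mem: "t \<in> ?I v \<longleftrightarrow> v = cell n t" for v using cell_eq_iff[of t n v] by auto
      have "(\<Sum>v<2 ^ n. u v * indicator (?I v) t) = (\<Sum>v<2 ^ n. if v = cell n t then u v else 0)"
        unfolding indicator_def mem by (intro sum.cong refl) simp
      then show ?case using cell_less[of t n] elim by simp
    qed
    show "(\<lambda>t. \<Sum>v<2 ^ n. u v * indicator (?I v) t) \<in> borel_measurable unitM"
      by (intro borel_measurable_sum borel_measurable_times borel_measurable_const borel_measurable_indicator Isets) simp
  qed simp
  also have "\<dots> = (\<Sum>v<2 ^ n. u v * measure unitM (?I v))"
  proof (subst Bochner_Integration.integral_sum)
    show "integrable unitM (\<lambda>t. u v * indicator (?I v) t)" if "v \<in> {..<2 ^ n}" for v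
      using that by (intro integrable_mult_right integrable_real_indicator Isets) (simp_all add: less_top[symmetric])
    show "(\<Sum>v<2 ^ n. \<integral>t. u v * indicator (?I v) t \<partial>unitM) = (\<Sum>v<2 ^ n. u v * measure unitM (?I v))"
    proof (rule sum.cong)
      fix v :: nat assume "v \<in> {..<2 ^ n}"
      then have "?I v \<inter> space unitM = ?I v" using Isets by (intro sets.Int_space_eq2) simp
      then show "(\<integral>t. u v * indicator (?I v) t \<partial>unitM) = u v * measure unitM (?I v)"
        by (simp only: integral_mult_right_zero Bochner_Integration.integral_indicator)
    qed simp
  qed
  also have "\<dots> = (\<Sum>v<2 ^ n. u v) / 2 ^ n"
    unfolding sum_divide_distrib by (rule sum.cong) (use I in auto)
  finally show ?thesis .
qed

lemma finite_dyadic_upto: "finite (dyadic_upto n)"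
proof -
  have "dyadic_upto n \<subseteq> Sigma {..n} (\<lambda>k. {..2 ^ k})" by (auto simp: dyadic_upto_def)
  then show ?thesis by (rule finite_subset) auto
qed

text \<open>Joint laws live on vectors restricted to \<open>dyadic_upto (n - 1)\<close>; the pattern
  reads only levels below \<open>n\<close>, which all belong to that index set.\<close>

lemma sign_pattern_restrict:
  assumes "1 \<le> n"
  shows "sign_pattern n (\<lambda>I\<in>dyadic_upto (n - 1). f I) = sign_pattern n f"
proof -
  have "(\<Sum>i\<in>{1..2 ^ j}. (\<lambda>I\<in>dyadic_upto (n - 1). f I) (j, i)) = (\<Sum>i\<in>{1..2 ^ j}. f (j, i))" if "j < n" for j
    by (rule sum.cong) (use that assms in \<open>auto simp: dyadic_upto_def\<close>)
  then show ?thesis unfolding sign_pattern_def by auto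
qed

lemma sign_pattern_subset: "sign_pattern n v \<subseteq> {..<n}"
  by (auto simp: sign_pattern_def)

lemma measurable_sign_pattern:
  assumes n: "1 \<le> n"
  shows "sign_pattern n \<in> measurable (PiM (dyadic_upto (n - 1)) (\<lambda>_. borel)) (count_space UNIV)"
proof -
  let ?M = "PiM (dyadic_upto (n - 1)) (\<lambda>_. borel :: real measure)"
  have [measurable]: "(\<lambda>v. v (j, i)) \<in> borel_measurable ?M" if "j < n" "i \<in> {1..2 ^ j}" for j i
    using that n by (intro measurable_component_singleton) (auto simp: dyadic_upto_def)
  have "sign_pattern n \<in> measurable ?M (count_space (Pow {..<n}))"
    unfolding measurable_count_space_eq2[OF finite_Pow_iff[THEN iffD2, OF finite_lessThan]]
  proof (intro conjI ballI funcsetI)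
    fix v show "sign_pattern n v \<in> Pow {..<n}" using sign_pattern_subset by auto
  next
    fix a assume "a \<in> Pow {..<n}"
    then have "sign_pattern n v = a \<longleftrightarrow> (\<forall>j\<in>{..<n}. ((\<Sum>i\<in>{1..2 ^ j}. v (j, i)) < 0) = (j \<in> a))" for v
      unfolding sign_pattern_def set_eq_iff mem_Collect_eq by blast
    then have "sign_pattern n -` {a} \<inter> space ?M
        = {v \<in> space ?M. \<forall>j\<in>{..<n}. ((\<Sum>i\<in>{1..2 ^ j}. v (j, i)) < 0) = (j \<in> a)}"
      by blast
    also have "\<dots> \<in> sets ?M" by measurable
    finally show "sign_pattern n -` {a} \<inter> space ?M \<in> sets ?M" .
  qed
  from measurable_compose[OF this, of "\<lambda>x. x" "count_space UNIV"] show ?thesis by simp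
qed

section \<open>Transfer from the Haar system to its copies\<close>

context
  fixes h :: "nat \<Rightarrow> nat \<times> nat \<Rightarrow> real \<Rightarrow> real"
  assumes h: "BRS_family h"
begin

definition pattern :: "nat \<Rightarrow> real \<Rightarrow> nat set" where
  "pattern n x = sign_pattern n (\<lambda>I. h n I x)"

lemma h_measurable: "1 \<le> n \<Longrightarrow> I \<in> dyadic_upto (n - 1) \<Longrightarrow> h n I \<in> borel_measurable unitM"
  using h unfolding BRS_family_def by blast

lemma haar_measurable: "haar I \<in> borel_measurable unitM"
  unfolding haar_def[abs_def] unitM_def dyad_left_def dyad_right_def
  by (rule measurable_restrict_space1) (auto split: prod.split)

lemma measurable_h_vector:
  "1 \<le> n \<Longrightarrow> (\<lambda>x. \<lambda>I\<in>dyadic_upto (n - 1). h n I x) \<in> measurable unitM (PiM (dyadic_upto (n - 1)) (\<lambda>_. borel))"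
  by (rule measurable_restrict) (auto intro: h_measurable)

lemma measurable_haar_vector:
  "(\<lambda>x. \<lambda>I\<in>dyadic_upto (n - 1). haar I x) \<in> measurable unitM (PiM (dyadic_upto (n - 1)) (\<lambda>_. borel))"
  by (rule measurable_restrict) (auto intro: haar_measurable)

lemma distr_h: "1 \<le> n \<Longrightarrow>
    distr unitM (PiM (dyadic_upto (n - 1)) (\<lambda>_. borel)) (\<lambda>x. \<lambda>I\<in>dyadic_upto (n - 1). h n I x)
    = distr unitM (PiM (dyadic_upto (n - 1)) (\<lambda>_. borel)) (\<lambda>x. \<lambda>I\<in>dyadic_upto (n - 1). haar I x)"
  using h unfolding BRS_family_def by blast

text \<open>An identity between Haar functions is a measurable condition on the vector of their
  values, and equality of the joint laws carries it to the copies.\<close>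

lemma AE_h_transfer:
  assumes n: "1 \<le> n"
    and P: "{v \<in> space (PiM (dyadic_upto (n - 1)) (\<lambda>_. borel)). P v} \<in> sets (PiM (dyadic_upto (n - 1)) (\<lambda>_. borel))"
    and haar: "\<And>t. 0 \<le> t \<Longrightarrow> t < 1 \<Longrightarrow> P (\<lambda>I\<in>dyadic_upto (n - 1). haar I t)"
  shows "AE x in unitM. P (\<lambda>I\<in>dyadic_upto (n - 1). h n I x)"
proof -
  have "AE x in unitM. P (\<lambda>I\<in>dyadic_upto (n - 1). haar I x)"
    using AE_unitM_unit_interval by eventually_elim (use haar in auto)
  then have "AE v in distr unitM (PiM (dyadic_upto (n - 1)) (\<lambda>_. borel)) (\<lambda>x. \<lambda>I\<in>dyadic_upto (n - 1). haar I x). P v"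
    by (subst AE_distr_iff[OF measurable_haar_vector P])
  then show ?thesis
    unfolding distr_h[OF n, symmetric] by (subst (asm) AE_distr_iff[OF measurable_h_vector[OF n] P])
qed

lemma pattern_eq: "1 \<le> n \<Longrightarrow> pattern n x = sign_pattern n (\<lambda>I\<in>dyadic_upto (n - 1). h n I x)"
  unfolding pattern_def by (simp only: sign_pattern_restrict)

lemma measurable_pattern: "1 \<le> n \<Longrightarrow> pattern n \<in> measurable unitM (count_space UNIV)"
  using measurable_compose[OF measurable_h_vector measurable_sign_pattern, of n]
  by (subst measurable_cong[OF pattern_eq]) auto

text \<open>By equality of laws the integral may be computed with the Haar functions themselves,
  where the pattern consists of the binary digits of a uniformly distributed cell.\<close>

lemma integral_pattern:
  fixes u :: "nat set \<Rightarrow> real"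
  assumes n: "1 \<le> n"
  shows "(\<integral>x. u (pattern n x) \<partial>unitM) = (\<Sum>y\<in>Pow {..<n}. u y) / 2 ^ n"
proof -
  have u: "(\<lambda>v. u (sign_pattern n v)) \<in> borel_measurable (PiM (dyadic_upto (n - 1)) (\<lambda>_. borel))"
    using measurable_compose[OF measurable_sign_pattern[OF n], of u borel] by simp
  have "(\<integral>x. u (pattern n x) \<partial>unitM)
      = (\<integral>v. u (sign_pattern n v) \<partial>distr unitM (PiM (dyadic_upto (n - 1)) (\<lambda>_. borel)) (\<lambda>x. \<lambda>I\<in>dyadic_upto (n - 1). h n I x))"
    by (subst integral_distr[OF measurable_h_vector[OF n] u]) (simp only: pattern_eq[OF n])
  also have "\<dots> = (\<integral>x. u (sign_pattern n (\<lambda>I. haar I x)) \<partial>unitM)"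
    unfolding distr_h[OF n] by (subst integral_distr[OF measurable_haar_vector u]) (simp only: sign_pattern_restrict[OF n])
  also have "\<dots> = (\<integral>x. u (digits n (cell n x)) \<partial>unitM)"
  proof (rule integral_cong_AE)
    show "(\<lambda>x. u (sign_pattern n (\<lambda>I. haar I x))) \<in> borel_measurable unitM"
      using measurable_compose[OF measurable_haar_vector u] by (simp only: sign_pattern_restrict[OF n])
    have "cell n = (\<lambda>t. nat \<lfloor>2 ^ n * t\<rfloor>)" by (auto simp: cell_def)
    then have "cell n \<in> measurable unitM (count_space UNIV)"
      unfolding unitM_def by (simp add: measurable_restrict_space1)
    from measurable_compose[OF this, of "\<lambda>v. u (digits n v)" borel]
    show "(\<lambda>x. u (digits n (cell n x))) \<in> borel_measurable unitM" by simp
    show "AE x in unitM. u (sign_pattern n (\<lambda>I. haar I x)) = u (digits n (cell n x))"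
      using AE_unitM_unit_interval by eventually_elim (simp add: sign_pattern_haar)
  qed
  also have "\<dots> = (\<Sum>v<2 ^ n. u (digits n v)) / 2 ^ n" by (rule integral_cell)
  also have "(\<Sum>v<2 ^ n. u (digits n v)) = (\<Sum>y\<in>Pow {..<n}. u y)"
    by (rule sum.reindex_bij_betw[OF bij_betw_digits])
  finally show ?thesis .
qed

lemma block_system_pattern: "block_system pattern"
  unfolding block_system_def
proof (intro conjI allI impI)
  fix X :: "nat set" and u :: "nat \<Rightarrow> nat set \<Rightarrow> real"
  assume X: "finite X" "X \<subseteq> {1..}"
  have ind: "unitM.indep_vars (\<lambda>n. PiM (dyadic_upto (n - 1)) (\<lambda>_. borel)) (\<lambda>n x. \<lambda>I\<in>dyadic_upto (n - 1). h n I x) X"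
    using h X unfolding BRS_family_def by (intro unitM.indep_vars_subset[of _ _ "{n. 1 \<le> n}" X]) auto
  have "unitM.indep_vars (\<lambda>_. borel) (\<lambda>n x. u n (sign_pattern n (\<lambda>I\<in>dyadic_upto (n - 1). h n I x))) X"
  proof (rule unitM.indep_vars_compose2[OF ind])
    fix n assume "n \<in> X"
    then have "1 \<le> n" using X by auto
    from measurable_compose[OF measurable_sign_pattern[OF this], of "u n" borel]
    show "(\<lambda>v. u n (sign_pattern n v)) \<in> borel_measurable (PiM (dyadic_upto (n - 1)) (\<lambda>_. borel))" by simp
  qed
  then have "unitM.indep_vars (\<lambda>_. borel) (\<lambda>n x. u n (pattern n x)) X"
    by (rule unitM.indep_vars_cong[THEN iffD1, rotated 3]) (use X in \<open>auto simp only: pattern_eq atLeast_iff subset_eq\<close>)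
  moreover have "integrable unitM (\<lambda>x. u n (pattern n x))" if "n \<in> X" for n
  proof (rule unitM.integrable_const_bound[where B="\<Sum>y\<in>Pow {..<n}. \<bar>u n y\<bar>"])
    show "AE x in unitM. norm (u n (pattern n x)) \<le> (\<Sum>y\<in>Pow {..<n}. \<bar>u n y\<bar>)"
      using member_le_sum[of _ "Pow {..<n}" "\<lambda>y. \<bar>u n y\<bar>"] sign_pattern_subset
      by (intro AE_I2) (auto simp: pattern_def)
    have "pattern n \<in> measurable unitM (count_space UNIV)" using measurable_pattern that X by auto
    from measurable_compose[OF this, of "u n" borel] show "(\<lambda>x. u n (pattern n x)) \<in> borel_measurable unitM" by simp
  qed
  ultimately show "(\<integral>x. (\<Prod>n\<in>X. u n (pattern n x)) \<partial>unitM) = (\<Prod>n\<in>X. \<integral>x. u n (pattern n x) \<partial>unitM)"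
    using X(1) by (intro unitM.indep_vars_lebesgue_integral) auto
qed (rule measurable_pattern, assumption, unfold pattern_def, rule sign_pattern_subset,
    fold pattern_def, rule integral_pattern, assumption)

text \<open>A Haar function of level below \<open>n\<close> is constant on cells of length 2^-n and
  so is a function \<open>u\<close> of the pattern. Its mean vanishes, and therefore its Walsh
  expansion has no constant term.\<close>

lemma h_eq_walsh:
  assumes n: "1 \<le> n" and I: "I \<in> dyadic_upto (n - 1)"
  shows "\<exists>a. AE x in unitM. h n I x = (\<Sum>F\<in>Pow {..<n} - {{}}. a F * walsh F (pattern n x))"
proof -
  obtain j i where ji: "I = (j, i)" "j < n" "1 \<le> i" "i \<le> 2 ^ j" using I n by (auto simp: dyadic_upto_def)
  \<comment> \<open>The value on a digit pattern is read off at the left end point of the cell with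
    these digits.\<close>
  define u where "u y = haar I (real (inv_into {..<2 ^ n} (digits n) y) / 2 ^ n)" for y
  have haar_u: "haar I t = u (digits n (cell n t))" if t: "0 \<le> t" "t < 1" for t
  proof -
    have v: "inv_into {..<2 ^ n} (digits n) (digits n (cell n t)) = cell n t"
      using bij_betw_digits[of n] cell_less[OF t, of n] by (intro inv_into_f_f) (auto simp: bij_betw_def)
    define s where "s = real (cell n t) / 2 ^ n"
    have s: "0 \<le> s" by (simp add: s_def)
    have "cell n s = cell n t" using s by (subst cell_eq_iff) (auto simp: s_def divide_strict_right_mono)
    then have "cell k s = cell k t" if "k \<le> n" for k using cell_div_power[OF that] by metis
    then show ?thesis unfolding u_def v s_def[symmetric] ji haar_cell[OF t(1) ji(3)] haar_cell[OF s ji(3)] using ji by simp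
  qed
  define a where "a F = (\<Sum>z\<in>Pow {..<n}. u z * walsh F z) / 2 ^ n" for F
  have u_exp: "u y = (\<Sum>F\<in>Pow {..<n}. a F * walsh F y)" if "y \<subseteq> {..<n}" for y
    using walsh_expansion[of "{..<n}" y u] that by (simp add: a_def)
  have "a {} = 0"
  proof -
    have "a {} = (\<Sum>v<2 ^ n. u (digits n v)) / 2 ^ n"
      using sum.reindex_bij_betw[OF bij_betw_digits[of n], of u] by (simp add: a_def)
    also have "\<dots> = (\<integral>t. u (digits n (cell n t)) \<partial>unitM)" by (rule integral_cell[symmetric])
    also have "\<dots> = (\<integral>t. (if cell (Suc j) t = 2 * (i - 1) then 1 else if cell (Suc j) t = 2 * (i - 1) + 1 then -1 else 0) \<partial>unitM)"
    proof (rule integral_cong_AE)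
      have m: "cell n \<in> measurable unitM (count_space UNIV)" for n
      proof -
        have "cell n = (\<lambda>t. nat \<lfloor>2 ^ n * t\<rfloor>)" by (auto simp: cell_def)
        then show ?thesis unfolding unitM_def by (simp add: measurable_restrict_space1)
      qed
      from measurable_compose[OF m[of n], of "\<lambda>v. u (digits n v)" borel]
      show "(\<lambda>t. u (digits n (cell n t))) \<in> borel_measurable unitM" by simp
      from measurable_compose[OF m[of "Suc j"], of "\<lambda>c. if c = 2 * (i - 1) then 1 else if c = 2 * (i - 1) + 1 then -1 else 0" borel]
      show "(\<lambda>t. if cell (Suc j) t = 2 * (i - 1) then 1 else if cell (Suc j) t = 2 * (i - 1) + 1 then -1 else 0 :: real) \<in> borel_measurable unitM" by simp
      show "AE t in unitM. u (digits n (cell n t)) = (if cell (Suc j) t = 2 * (i - 1) then 1 else if cell (Suc j) t = 2 * (i - 1) + 1 then -1 else 0)"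
        using AE_unitM_unit_interval
      proof eventually_elim
        case (elim t)
        have c: "cell j t = cell (Suc j) t div 2" by (simp add: cell_Suc_div)
        show ?case using elim ji(3) unfolding haar_u[symmetric, OF elim[THEN conjunct1] elim[THEN conjunct2]] ji(1) haar_cell[OF elim[THEN conjunct1] ji(3)] c
          by (auto elim!: oddE evenE)
      qed
    qed
    also have "\<dots> = (\<Sum>c<2 ^ Suc j. if c = 2 * (i - 1) then 1 else if c = 2 * (i - 1) + 1 then -1 else 0) / 2 ^ Suc j"
      by (rule integral_cell)
    also have "(\<Sum>c<2 ^ Suc j. if c = 2 * (i - 1) then 1 else if c = 2 * (i - 1) + 1 then -1 else 0 :: real)
        = (\<Sum>c<2 ^ Suc j. if c = 2 * (i - 1) then 1 else 0) - (\<Sum>c<2 ^ Suc j. if c = 2 * (i - 1) + 1 then 1 else 0)"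
      unfolding sum_subtractf[symmetric] by (intro sum.cong) auto
    also have "\<dots> = 0" using ji(3,4) by (simp add: sum.delta)
    finally show ?thesis by simp
  qed
  have "AE x in unitM. (\<lambda>I\<in>dyadic_upto (n - 1). h n I x) I = u (sign_pattern n (\<lambda>I\<in>dyadic_upto (n - 1). h n I x))"
  proof (rule AE_h_transfer[OF n])
    let ?M = "PiM (dyadic_upto (n - 1)) (\<lambda>_. borel :: real measure)"
    have [measurable]: "(\<lambda>v. v I) \<in> borel_measurable ?M" using I by (rule measurable_component_singleton)
    have [measurable]: "(\<lambda>v. u (sign_pattern n v)) \<in> borel_measurable ?M"
      using measurable_compose[OF measurable_sign_pattern[OF n], of u borel] by simp
    show "{v \<in> space ?M. v I = u (sign_pattern n v)} \<in> sets ?M" by measurable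
    show "(\<lambda>I\<in>dyadic_upto (n - 1). haar I t) I = u (sign_pattern n (\<lambda>I\<in>dyadic_upto (n - 1). haar I t))"
      if "0 \<le> t" "t < 1" for t
      using haar_u[OF that] I unfolding sign_pattern_restrict[OF n] sign_pattern_haar[OF that] by simp
  qed
  then have "AE x in unitM. h n I x = (\<Sum>F\<in>Pow {..<n} - {{}}. a F * walsh F (pattern n x))"
  proof eventually_elim
    case (elim x)
    then have "h n I x = u (pattern n x)" unfolding pattern_eq[OF n] using I by simp
    also have "\<dots> = (\<Sum>F\<in>Pow {..<n}. a F * walsh F (pattern n x))"
      using sign_pattern_subset by (intro u_exp) (auto simp: pattern_def)
    also have "\<dots> = (\<Sum>F\<in>Pow {..<n} - {{}}. a F * walsh F (pattern n x))"
      using \<open>a {} = 0\<close> by (subst sum.remove[of _ "{}"]) auto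
    finally show ?case .
  qed
  then show ?thesis by blast
qed

text \<open>With \<open>j = Max F\<close>, the factor \<open>walsh (F - {j})\<close> depends on
  earlier digits only and is constant on intervals of length 2^-j, while the remaining factor is the
  j-th Rademacher function. A nonconstant Walsh function is thus a signed sum of Haar functions of a
  single level.\<close>

lemma walsh_eq_h:
  assumes n: "1 \<le> n" and F: "F \<subseteq> {..<n}" "F \<noteq> {}"
  shows "\<exists>a. AE x in unitM. walsh F (pattern n x) = (\<Sum>I\<in>dyadic_upto (n - 1). a I * h n I x)"
proof -
  have fin: "finite F" using F finite_subset by blast
  define j where "j = Max F"
  have j: "j \<in> F" "j < n" using F fin by (auto simp: j_def)
  have Fj: "k < j" if "k \<in> F - {j}" for k using that fin Max_ge[OF fin, of k] by (auto simp: j_def less_le)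
  define a where "a = (\<lambda>(k, i). if k = j then walsh (F - {j}) (digits j (i - 1)) else 0)"
  let ?D = "dyadic_upto (n - 1)"
  have haar: "walsh F (digits n (cell n t)) = (\<Sum>I\<in>?D. a I * haar I t)" if t: "0 \<le> t" "t < 1" for t
  proof -
    have "(\<Sum>I\<in>?D. a I * haar I t) = (\<Sum>I\<in>Pair j ` {1..2 ^ j}. a I * haar I t)"
      by (rule sum.mono_neutral_right) (use finite_dyadic_upto j n in \<open>auto simp: dyadic_upto_def a_def\<close>)
    also have "\<dots> = (\<Sum>i\<in>{1..2 ^ j}. walsh (F - {j}) (digits j (i - 1)) * haar (j, i) t)"
      by (subst sum.reindex) (auto simp: a_def inj_on_def)
    also have "\<dots> = (\<Sum>i\<in>{1..2 ^ j}. if i = Suc (cell j t) then walsh (F - {j}) (digits j (cell j t)) * (if odd (cell (Suc j) t) then -1 else 1) else 0)"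
      by (intro sum.cong refl) (use haar_cell[OF t(1)] in auto)
    also have "\<dots> = walsh (F - {j}) (digits j (cell j t)) * (if odd (cell (Suc j) t) then -1 else 1)"
      using cell_less[OF t, of j] by (subst sum.delta) auto
    also have "\<dots> = walsh F (digits n (cell n t))"
    proof -
      have mem: "k \<in> digits m (cell m t) \<longleftrightarrow> k < m \<and> odd (cell (Suc k) t)" for k m
        unfolding digits_def using cell_div_power[of "Suc k" m t] by auto
      have "walsh F (digits n (cell n t)) = (if j \<in> digits n (cell n t) then -1 else 1) * walsh (F - {j}) (digits n (cell n t))"
        unfolding walsh_def using fin j by (subst prod.remove[of F j]) auto
      also have "walsh (F - {j}) (digits n (cell n t)) = walsh (F - {j}) (digits j (cell j t))"
        unfolding walsh_def using Fj j F(1) by (intro prod.cong) (auto simp: mem subset_iff)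
      finally show ?thesis using j by (simp add: mem)
    qed
    finally show ?thesis ..
  qed
  let ?v = "\<lambda>x. \<lambda>I\<in>?D. h n I x"
  have "AE x in unitM. walsh F (sign_pattern n (?v x)) = (\<Sum>I\<in>?D. a I * ?v x I)"
  proof (rule AE_h_transfer[OF n])
    let ?M = "PiM ?D (\<lambda>_. borel :: real measure)"
    have [measurable]: "(\<lambda>v. v I) \<in> borel_measurable ?M" if "I \<in> ?D" for I using that by (rule measurable_component_singleton)
    have [measurable]: "(\<lambda>v. walsh F (sign_pattern n v)) \<in> borel_measurable ?M"
      using measurable_compose[OF measurable_sign_pattern[OF n], of "walsh F" borel] by simp
    show "{v \<in> space ?M. walsh F (sign_pattern n v) = (\<Sum>I\<in>?D. a I * v I)} \<in> sets ?M" by measurable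
    show "walsh F (sign_pattern n (\<lambda>I\<in>?D. haar I t)) = (\<Sum>I\<in>?D. a I * (\<lambda>I\<in>?D. haar I t) I)" if "0 \<le> t" "t < 1" for t
      using haar[OF that] unfolding sign_pattern_restrict[OF n] sign_pattern_haar[OF that] by simp
  qed
  then have "AE x in unitM. walsh F (pattern n x) = (\<Sum>I\<in>?D. a I * h n I x)"
    unfolding pattern_eq[OF n] by eventually_elim simp
  then show ?thesis by blast
qed

end

section \<open>Operators on closed subspaces of \<open>L\<^sub>p\<close>\<close>

text \<open>Elements are functions, not classes: \<open>V\<close> is closed under pointwise
  combinations, whereas operators are linear almost everywhere only. Closedness also makes
  \<open>V\<close> stable under measurable changes on null sets.\<close>

locale closed_Lp_subspace =
  fixes p :: real and V :: "(real \<Rightarrow> real) set"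
  assumes p_ge1: "1 \<le> p"
    and V_ne: "V \<noteq> {}"
    and V_Lp: "f \<in> V \<Longrightarrow> in_Lp p f"
    and V_lincomb: "f \<in> V \<Longrightarrow> g \<in> V \<Longrightarrow> (\<lambda>x. a * f x + b * g x) \<in> V"
    and V_closed: "in_Lp p f \<Longrightarrow> (\<And>e. 0 < e \<Longrightarrow> \<exists>g\<in>V. Lp_norm p (\<lambda>x. f x - g x) < e) \<Longrightarrow> f \<in> V"
begin

lemma zero_in_V: "(\<lambda>x. 0) \<in> V"
  using V_ne V_lincomb[of _ _ 0 0] by auto

lemma cmult_in_V: "f \<in> V \<Longrightarrow> (\<lambda>x. c * f x) \<in> V"
  using V_lincomb[of f f c 0] by simp

lemma add_in_V: "f \<in> V \<Longrightarrow> g \<in> V \<Longrightarrow> (\<lambda>x. f x + g x) \<in> V"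
  using V_lincomb[of f g 1 1] by simp

lemma diff_in_V: "f \<in> V \<Longrightarrow> g \<in> V \<Longrightarrow> (\<lambda>x. f x - g x) \<in> V"
  using V_lincomb[of f g 1 "-1"] by simp

lemma sum_in_V: "(\<And>i. i \<in> X \<Longrightarrow> f i \<in> V) \<Longrightarrow> (\<lambda>x. \<Sum>i\<in>X. c i * f i x) \<in> V"
proof (induction X rule: infinite_finite_induct)
  case (insert i X)
  then have "(\<lambda>x. c i * f i x + 1 * (\<Sum>i\<in>X. c i * f i x)) \<in> V" by (intro V_lincomb) auto
  then show ?case using insert by simp
qed (simp_all add: zero_in_V)

lemma V_AE_cong:
  assumes "f \<in> V" "g \<in> borel_measurable unitM" "AE x in unitM. g x = f x"
  shows "g \<in> V"
proof (rule V_closed)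
  show g: "in_Lp p g" using in_Lp_cong_AE[OF assms(3,2)] V_Lp[OF assms(1)] .
  have "Lp_norm p (\<lambda>x. g x - f x) = 0"
    using assms V_Lp[OF assms(1)] by (intro AE_0_Lp_norm) (auto simp: in_Lp_def)
  then show "\<exists>h\<in>V. Lp_norm p (\<lambda>x. g x - h x) < e" if "0 < e" for e using assms(1) that by (intro bexI[of _ f]) simp_all
qed

lemma V_complete:
  assumes f: "\<And>n. f n \<in> V"
    and Cauchy: "\<And>e. 0 < e \<Longrightarrow> \<exists>N. \<forall>m\<ge>N. \<forall>n\<ge>N. Lp_norm p (\<lambda>x. f m x - f n x) < e"
  shows "\<exists>g\<in>V. (\<lambda>n. Lp_norm p (\<lambda>x. g x - f n x)) \<longlonglongrightarrow> 0"
proof -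
  obtain g where g: "in_Lp p g" "(\<lambda>n. Lp_norm p (\<lambda>x. g x - f n x)) \<longlonglongrightarrow> 0"
    using Lp_complete[OF p_ge1 V_Lp[OF f] Cauchy] by blast
  have "g \<in> V"
  proof (rule V_closed[OF g(1)])
    fix e :: real assume "0 < e"
    then have "\<forall>\<^sub>F n in sequentially. Lp_norm p (\<lambda>x. g x - f n x) < e" using order_tendstoD(2)[OF g(2)] by simp
    then obtain n where "Lp_norm p (\<lambda>x. g x - f n x) < e" by (auto simp: eventually_sequentially)
    then show "\<exists>h\<in>V. Lp_norm p (\<lambda>x. g x - h x) < e" using f by blast
  qed
  then show ?thesis using g by blast
qed

lemma op_in_V: "bounded_op_on p V T \<Longrightarrow> f \<in> V \<Longrightarrow> T f \<in> V"
  by (simp add: bounded_op_on_def)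

lemma op_lincomb: "bounded_op_on p V T \<Longrightarrow> f \<in> V \<Longrightarrow> g \<in> V \<Longrightarrow>
    AE x in unitM. T (\<lambda>y. a * f y + b * g y) x = a * T f x + b * T g x"
  by (simp add: bounded_op_on_def)

lemma op_bound: 
  assumes "bounded_op_on p V T"
  obtains C where "0 \<le> C" "\<And>f. f \<in> V \<Longrightarrow> Lp_norm p (T f) \<le> C * Lp_norm p f"
proof -
  obtain C where C: "\<forall>f\<in>V. Lp_norm p (T f) \<le> C * Lp_norm p f" using assms by (auto simp: bounded_op_on_def)
  have "Lp_norm p (T f) \<le> max C 0 * Lp_norm p f" if "f \<in> V" for f
  proof -
    have "C * Lp_norm p f \<le> max C 0 * Lp_norm p f" by (intro mult_right_mono Lp_norm_nonneg) simp
    then show ?thesis using C that by fastforce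
  qed
  then show thesis using that[of "max C 0"] by auto
qed

lemma op_diff: "bounded_op_on p V T \<Longrightarrow> f \<in> V \<Longrightarrow> g \<in> V \<Longrightarrow> AE x in unitM. T (\<lambda>y. f y - g y) x = T f x - T g x"
  using op_lincomb[of T f g 1 "-1"] by simp

text \<open>Operators act on representatives. The difference of two representatives has norm 0, so
  the norm bound makes its image vanish almost everywhere.\<close>

lemma op_cong:
  assumes T: "bounded_op_on p V T" and f: "f \<in> V" and g: "g \<in> V" and eq: "AE x in unitM. f x = g x"
  shows "AE x in unitM. T f x = T g x"
proof -
  obtain C where C: "0 \<le> C" "\<And>f. f \<in> V \<Longrightarrow> Lp_norm p (T f) \<le> C * Lp_norm p f" using op_bound[OF T] by blast
  have d: "(\<lambda>x. f x - g x) \<in> V" using f g by (rule diff_in_V)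
  have "Lp_norm p (\<lambda>x. f x - g x) = 0" using eq V_Lp[OF d] by (intro AE_0_Lp_norm) (auto simp: in_Lp_def)
  then have "Lp_norm p (T (\<lambda>x. f x - g x)) = 0" using C(2)[OF d] Lp_norm_nonneg[of p "T (\<lambda>x. f x - g x)"] by simp
  then have "AE x in unitM. T (\<lambda>x. f x - g x) x = 0" using Lp_norm_eq_0_AE V_Lp[OF op_in_V[OF T d]] by blast
  then show ?thesis using op_diff[OF T f g] by eventually_elim simp
qed

lemma op_sum:
  assumes T: "bounded_op_on p V T"
  shows "finite X \<Longrightarrow> (\<And>i. i \<in> X \<Longrightarrow> f i \<in> V) \<Longrightarrow>
    AE x in unitM. T (\<lambda>y. \<Sum>i\<in>X. c i * f i y) x = (\<Sum>i\<in>X. c i * T (f i) x)"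
proof (induction X rule: finite_induct)
  case empty
  show ?case using op_lincomb[OF T zero_in_V zero_in_V, of 0 0] by simp
next
  case (insert i X)
  then have "AE x in unitM. T (\<lambda>y. \<Sum>i\<in>X. c i * f i y) x = (\<Sum>i\<in>X. c i * T (f i) x)" by auto
  moreover have "AE x in unitM. T (\<lambda>y. c i * f i y + 1 * (\<Sum>i\<in>X. c i * f i y)) x = c i * T (f i) x + 1 * T (\<lambda>y. \<Sum>i\<in>X. c i * f i y) x"
    using insert by (intro op_lincomb[OF T] sum_in_V) auto
  ultimately show ?case by eventually_elim (use insert(1,2) in simp)
qed

lemma op_compose:
  assumes T: "bounded_op_on p V T" and U: "bounded_op_on p V U"
  shows "bounded_op_on p V (\<lambda>f. T (U f))"
proof -
  obtain C where C: "0 \<le> C" "\<And>f. f \<in> V \<Longrightarrow> Lp_norm p (T f) \<le> C * Lp_norm p f" using op_bound[OF T] by blast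
  obtain D where D: "0 \<le> D" "\<And>f. f \<in> V \<Longrightarrow> Lp_norm p (U f) \<le> D * Lp_norm p f" using op_bound[OF U] by blast
  have "Lp_norm p (T (U f)) \<le> C * D * Lp_norm p f" if "f \<in> V" for f
  proof -
    have "Lp_norm p (T (U f)) \<le> C * Lp_norm p (U f)" using C(2) op_in_V[OF U that] .
    also have "\<dots> \<le> C * (D * Lp_norm p f)" using C(1) D(2)[OF that] by (rule mult_left_mono[rotated])
    finally show ?thesis by simp
  qed
  moreover have "AE x in unitM. T (U (\<lambda>y. a * f y + b * g y)) x = a * T (U f) x + b * T (U g) x"
    if fg: "f \<in> V" "g \<in> V" for f g a b
  proof -
    have "AE x in unitM. T (U (\<lambda>y. a * f y + b * g y)) x = T (\<lambda>y. a * U f y + b * U g y) x"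
      using fg by (intro op_cong[OF T] op_in_V[OF U] V_lincomb op_lincomb[OF U])
    moreover have "AE x in unitM. T (\<lambda>y. a * U f y + b * U g y) x = a * T (U f) x + b * T (U g) x"
      using fg by (intro op_lincomb[OF T] op_in_V[OF U])
    ultimately show ?thesis by eventually_elim simp
  qed
  ultimately show ?thesis unfolding bounded_op_on_def using op_in_V[OF T] op_in_V[OF U] by blast
qed

lemma op_complement:
  assumes T: "bounded_op_on p V T"
  shows "bounded_op_on p V (\<lambda>f x. f x - T f x)"
proof -
  obtain C where C: "0 \<le> C" "\<And>f. f \<in> V \<Longrightarrow> Lp_norm p (T f) \<le> C * Lp_norm p f" using op_bound[OF T] by blast
  have "Lp_norm p (\<lambda>x. f x - T f x) \<le> (1 + C) * Lp_norm p f" if "f \<in> V" for f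
    using Lp_norm_triangle_diff[OF p_ge1 V_Lp[OF that] V_Lp[OF op_in_V[OF T that]]] C(2)[OF that]
    by (simp add: algebra_simps)
  moreover have "AE x in unitM. (a * f x + b * g x) - T (\<lambda>y. a * f y + b * g y) x
      = a * (f x - T f x) + b * (g x - T g x)" if "f \<in> V" "g \<in> V" for f g a b
    using op_lincomb[OF T that, of a b] by eventually_elim (simp add: algebra_simps)
  ultimately show ?thesis unfolding bounded_op_on_def using op_in_V[OF T] diff_in_V by blast
qed

lemma op_norm_le:
  assumes "0 \<le> C" and C: "\<And>f. f \<in> V \<Longrightarrow> Lp_norm p (T f) \<le> C * Lp_norm p f"
  shows "op_norm_on p V T \<le> C" "0 \<le> op_norm_on p V T"
proof -
  have le: "y \<le> C" if y: "y \<in> {Lp_norm p (T f) |f. f \<in> V \<and> Lp_norm p f \<le> 1}" for y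
  proof -
    obtain f where f: "y = Lp_norm p (T f)" "f \<in> V" "Lp_norm p f \<le> 1" using y by auto
    have "C * Lp_norm p f \<le> C * 1" using f assms(1) by (intro mult_left_mono)
    then show ?thesis using C[OF f(2)] f(1) by simp
  qed
  have z: "Lp_norm p (T (\<lambda>x. 0)) \<in> {Lp_norm p (T f) |f. f \<in> V \<and> Lp_norm p f \<le> 1}"
    using zero_in_V Lp_norm_zero[of p] by (auto intro!: exI[of _ "\<lambda>x. 0"])
  show "op_norm_on p V T \<le> C" unfolding op_norm_on_def using z by (intro cSup_least le) auto
  have "Lp_norm p (T (\<lambda>x. 0)) \<le> op_norm_on p V T"
    unfolding op_norm_on_def using z by (rule cSup_upper) (rule bdd_aboveI[OF le])
  then show "0 \<le> op_norm_on p V T" using Lp_norm_nonneg[of p "T (\<lambda>x. 0)"] by linarith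
qed

section \<open>Operators defined on dense subsets\<close>

text \<open>The assignment of \<open>u k\<close> to \<open>v k\<close> extends from finite
  combinations to \<open>V\<close>. As the \<open>v k\<close> may be linearly dependent (in one
  application they are all the images of an operator), coefficients do not define the extension. It
  comes from the closure of the graph of finite combinations: density and completeness make it
  total, \<open>bound\<close> makes it single-valued up to null sets, and a choice of
  representatives makes it a function.\<close>

lemma extend_operator:
  fixes v u :: "'k \<Rightarrow> real \<Rightarrow> real"
  assumes v: "\<And>k. k \<in> K \<Longrightarrow> v k \<in> V" and u: "\<And>k. k \<in> K \<Longrightarrow> u k \<in> V" and C: "0 \<le> C"
    and bound: "\<And>X a. finite X \<Longrightarrow> X \<subseteq> K \<Longrightarrow>
        Lp_norm p (\<lambda>x. \<Sum>k\<in>X. a k * u k x) \<le> C * Lp_norm p (\<lambda>x. \<Sum>k\<in>X. a k * v k x)"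
    and dense: "\<And>f e. f \<in> V \<Longrightarrow> 0 < e \<Longrightarrow> \<exists>X a. finite X \<and> X \<subseteq> K \<and> Lp_norm p (\<lambda>x. f x - (\<Sum>k\<in>X. a k * v k x)) < e"
  shows "\<exists>U. bounded_op_on p V U \<and> (\<forall>f\<in>V. Lp_norm p (U f) \<le> C * Lp_norm p f) \<and>
    (\<forall>k\<in>K. AE x in unitM. U (v k) x = u k x)"
proof -
  have vV: "(\<lambda>x. \<Sum>k\<in>X. a k * v k x) \<in> V" and uV: "(\<lambda>x. \<Sum>k\<in>X. a k * u k x) \<in> V" if "X \<subseteq> K" for X a
    using that v u by (auto intro!: sum_in_V)
  \<comment> \<open>The closure of the graph: one and the same combination must approximate both
    entries.\<close>
  define Rel where "Rel f g \<longleftrightarrow> g \<in> V \<and> (\<forall>e>0. \<exists>X a. finite X \<and> X \<subseteq> K \<and>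
      Lp_norm p (\<lambda>x. f x - (\<Sum>k\<in>X. a k * v k x)) < e \<and> Lp_norm p (\<lambda>x. g x - (\<Sum>k\<in>X. a k * u k x)) < e)" for f g
  have total: "\<exists>g. Rel f g" if f: "f \<in> V" for f
  proof -
    have "\<exists>X a. finite X \<and> X \<subseteq> K \<and> Lp_norm p (\<lambda>x. f x - (\<Sum>k\<in>X. a k * v k x)) < 1 / Suc n" for n
      by (rule dense[OF f]) simp
    then obtain X a where Xa: "\<And>n. finite (X n)" "\<And>n. X n \<subseteq> K" "\<And>n. Lp_norm p (\<lambda>x. f x - (\<Sum>k\<in>X n. a n k * v k x)) < 1 / Suc n"
      by metis
    define G where "G n x = (\<Sum>k\<in>X n. a n k * u k x)" for n x
    define H where "H n x = (\<Sum>k\<in>X n. a n k * v k x)" for n x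
    have HV: "H n \<in> V" and GV: "G n \<in> V" for n unfolding H_def[abs_def] G_def[abs_def] using vV uV Xa by auto
    have GH: "Lp_norm p (\<lambda>x. G m x - G n x) \<le> C * Lp_norm p (\<lambda>x. H m x - H n x)" for m n
    proof -
      \<comment> \<open>Two combinations over different index sets are subtracted on the union, each
        extended by 0, so that \<open>bound\<close> applies to the difference.\<close>
      define b where "b k = (if k \<in> X m then a m k else 0) - (if k \<in> X n then a n k else 0)" for k
      have "(\<Sum>k\<in>X m \<union> X n. b k * z k) = (\<Sum>k\<in>X m. a m k * z k) - (\<Sum>k\<in>X n. a n k * z k)" for z :: "'k \<Rightarrow> real"
      proof -
        have "(\<Sum>k\<in>X m \<union> X n. b k * z k) = (\<Sum>k\<in>X m \<union> X n. if k \<in> X m then a m k * z k else 0) - (\<Sum>k\<in>X m \<union> X n. if k \<in> X n then a n k * z k else 0)"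
          unfolding b_def sum_subtractf[symmetric] by (intro sum.cong refl) (auto simp: algebra_simps)
        then show ?thesis using Xa(1) by (simp add: sum.If_cases Int_absorb1)
      qed
      then show ?thesis using bound[of "X m \<union> X n" b] Xa(1,2) by (simp add: G_def H_def)
    qed
    have "\<exists>g\<in>V. (\<lambda>n. Lp_norm p (\<lambda>x. g x - G n x)) \<longlonglongrightarrow> 0"
    proof (rule V_complete[OF GV])
      fix e :: real assume e: "0 < e"
      obtain N :: nat where N: "2 * (C + 1) / e < real N" using reals_Archimedean2 by blast
      have N0: "0 < real N" using N e C by (meson add_nonneg_pos divide_nonneg_pos le_less_trans less_imp_le mult_nonneg_nonneg zero_le_numeral zero_less_one)
      have "Lp_norm p (\<lambda>x. G m x - G n x) < e" if mn: "N \<le> m" "N \<le> n" for m n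
      proof -
        have small: "Lp_norm p (\<lambda>x. f x - H i x) \<le> 1 / real N" if "N \<le> i" for i
        proof -
          have "1 / real (Suc i) \<le> 1 / real N" using that N0 by (intro divide_left_mono) auto
          then show ?thesis using Xa(3)[of i] by (simp add: H_def)
        qed
        have "Lp_norm p (\<lambda>x. H m x - H n x) \<le> Lp_norm p (\<lambda>x. H m x - f x) + Lp_norm p (\<lambda>x. f x - H n x)"
          by (intro Lp_norm_triangle_via p_ge1 V_Lp HV f)
        also have "\<dots> \<le> 1 / real N + 1 / real N"
          using small[OF mn(1)] small[OF mn(2)] by (simp add: Lp_norm_minus_commute[of p "H m"])
        finally have "Lp_norm p (\<lambda>x. H m x - H n x) \<le> 2 / real N" by simp
        then have "Lp_norm p (\<lambda>x. G m x - G n x) \<le> C * (2 / real N)"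
          using GH[of m n] C by (meson mult_left_mono order_trans)
        also have "\<dots> < e"
        proof -
          have "2 * C < 2 * (C + 1)" by simp
          also have "\<dots> < e * real N" using N e by (simp add: divide_less_eq mult.commute)
          finally show ?thesis using N0 by (simp add: divide_less_eq mult.commute)
        qed
        finally show ?thesis .
      qed
      then show "\<exists>N. \<forall>m\<ge>N. \<forall>n\<ge>N. Lp_norm p (\<lambda>x. G m x - G n x) < e" by blast
    qed
    then obtain g where g: "g \<in> V" "(\<lambda>n. Lp_norm p (\<lambda>x. g x - G n x)) \<longlonglongrightarrow> 0" by blast
    have "\<exists>X a. finite X \<and> X \<subseteq> K \<and> Lp_norm p (\<lambda>x. f x - (\<Sum>k\<in>X. a k * v k x)) < e \<and> Lp_norm p (\<lambda>x. g x - (\<Sum>k\<in>X. a k * u k x)) < e"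
      if e: "0 < e" for e
    proof -
      have "\<forall>\<^sub>F n in sequentially. Lp_norm p (\<lambda>x. g x - G n x) < e" using order_tendstoD(2)[OF g(2)] e by simp
      moreover have "\<forall>\<^sub>F n in sequentially. 1 / real (Suc n) < e"
        using order_tendstoD(2)[OF LIMSEQ_inverse_real_of_nat e] by (simp add: inverse_eq_divide)
      ultimately have "\<forall>\<^sub>F n in sequentially. Lp_norm p (\<lambda>x. g x - G n x) < e \<and> 1 / real (Suc n) < e" by eventually_elim simp
      then obtain n where n: "Lp_norm p (\<lambda>x. g x - G n x) < e" "1 / real (Suc n) < e" by (auto simp: eventually_sequentially)
      then show ?thesis using Xa[of n] less_trans by (intro exI[of _ "X n"] exI[of _ "a n"]) (auto simp: G_def)
    qed
    then show ?thesis using g(1) unfolding Rel_def by blast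
  qed
  have lin: "Rel (\<lambda>x. \<alpha> * f x + \<beta> * f' x) (\<lambda>x. \<alpha> * g x + \<beta> * g' x)"
    if f: "f \<in> V" "f' \<in> V" and R: "Rel f g" "Rel f' g'" for f f' g g' \<alpha> \<beta>
    unfolding Rel_def
  proof (intro conjI allI impI)
    have gV: "g \<in> V" "g' \<in> V" using R by (auto simp: Rel_def)
    then show "(\<lambda>x. \<alpha> * g x + \<beta> * g' x) \<in> V" by (rule V_lincomb)
    fix e :: real assume e: "0 < e"
    define d where "d = e / (\<bar>\<alpha>\<bar> + \<bar>\<beta>\<bar> + 1)"
    have d: "0 < d" "(\<bar>\<alpha>\<bar> + \<bar>\<beta>\<bar>) * d < e"
      using e by (auto simp: d_def field_simps add_pos_nonneg intro!: divide_pos_pos)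
    obtain X a where X: "finite X" "X \<subseteq> K" "Lp_norm p (\<lambda>x. f x - (\<Sum>k\<in>X. a k * v k x)) < d" "Lp_norm p (\<lambda>x. g x - (\<Sum>k\<in>X. a k * u k x)) < d"
      using R(1) d(1) unfolding Rel_def by blast
    obtain Y b where Y: "finite Y" "Y \<subseteq> K" "Lp_norm p (\<lambda>x. f' x - (\<Sum>k\<in>Y. b k * v k x)) < d" "Lp_norm p (\<lambda>x. g' x - (\<Sum>k\<in>Y. b k * u k x)) < d"
      using R(2) d(1) unfolding Rel_def by blast
    define c where "c k = \<alpha> * (if k \<in> X then a k else 0) + \<beta> * (if k \<in> Y then b k else 0)" for k
    have c: "(\<Sum>k\<in>X \<union> Y. c k * z k) = \<alpha> * (\<Sum>k\<in>X. a k * z k) + \<beta> * (\<Sum>k\<in>Y. b k * z k)" for z :: "'k \<Rightarrow> real"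
    proof -
      have "(\<Sum>k\<in>X \<union> Y. c k * z k) = \<alpha> * (\<Sum>k\<in>X \<union> Y. if k \<in> X then a k * z k else 0) + \<beta> * (\<Sum>k\<in>X \<union> Y. if k \<in> Y then b k * z k else 0)"
        unfolding c_def sum_distrib_left sum.distrib[symmetric] by (intro sum.cong refl) (auto simp: algebra_simps)
      then show ?thesis using X(1) Y(1) by (simp add: sum.If_cases Int_absorb1)
    qed
    have est: "Lp_norm p (\<lambda>x. (\<alpha> * F x + \<beta> * F' x) - (\<Sum>k\<in>X \<union> Y. c k * z k x)) < e"
      if F: "F \<in> V" "F' \<in> V" and z: "\<And>k. k \<in> K \<Longrightarrow> z k \<in> V"
        and s: "Lp_norm p (\<lambda>x. F x - (\<Sum>k\<in>X. a k * z k x)) < d" "Lp_norm p (\<lambda>x. F' x - (\<Sum>k\<in>Y. b k * z k x)) < d" for F F' z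
    proof -
      have L: "in_Lp p (\<lambda>x. F x - (\<Sum>k\<in>X. a k * z k x))" "in_Lp p (\<lambda>x. F' x - (\<Sum>k\<in>Y. b k * z k x))"
        using F z X(2) Y(2) by (auto intro!: V_Lp diff_in_V sum_in_V)
      have "Lp_norm p (\<lambda>x. (\<alpha> * F x + \<beta> * F' x) - (\<Sum>k\<in>X \<union> Y. c k * z k x))
          = Lp_norm p (\<lambda>x. \<alpha> * (F x - (\<Sum>k\<in>X. a k * z k x)) + \<beta> * (F' x - (\<Sum>k\<in>Y. b k * z k x)))"
        by (simp add: c algebra_simps)
      also have "\<dots> \<le> \<bar>\<alpha>\<bar> * Lp_norm p (\<lambda>x. F x - (\<Sum>k\<in>X. a k * z k x)) + \<bar>\<beta>\<bar> * Lp_norm p (\<lambda>x. F' x - (\<Sum>k\<in>Y. b k * z k x))"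
        using Lp_norm_triangle[OF p_ge1 in_Lp_cmult[OF L(1), of \<alpha>] in_Lp_cmult[OF L(2), of \<beta>]] p_ge1 by (simp add: Lp_norm_cmult)
      also have "\<dots> \<le> \<bar>\<alpha>\<bar> * d + \<bar>\<beta>\<bar> * d" using s by (intro add_mono mult_left_mono) auto
      finally show ?thesis using d(2) by (simp add: algebra_simps)
    qed
    show "\<exists>X a. finite X \<and> X \<subseteq> K \<and> Lp_norm p (\<lambda>x. \<alpha> * f x + \<beta> * f' x - (\<Sum>k\<in>X. a k * v k x)) < e
        \<and> Lp_norm p (\<lambda>x. \<alpha> * g x + \<beta> * g' x - (\<Sum>k\<in>X. a k * u k x)) < e"
      using est[OF f v X(3) Y(3)] est[OF gV u X(4) Y(4)] X(1,2) Y(1,2)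
      by (intro exI[of _ "X \<union> Y"] exI[of _ c]) simp
  qed
  have bnd: "Lp_norm p g \<le> C * Lp_norm p f" if f: "f \<in> V" and R: "Rel f g" for f g
  proof (rule field_le_epsilon)
    fix e :: real assume e: "0 < e"
    define d where "d = e / (C + 1)"
    have "d * (C + 1) = e" using C by (simp add: d_def)
    moreover have "0 < d" using e C by (simp add: d_def)
    ultimately have d: "0 < d" "d + C * d = e" by (auto simp: algebra_simps)
    have gV: "g \<in> V" using R by (auto simp: Rel_def)
    obtain X a where X: "finite X" "X \<subseteq> K" "Lp_norm p (\<lambda>x. f x - (\<Sum>k\<in>X. a k * v k x)) < d" "Lp_norm p (\<lambda>x. g x - (\<Sum>k\<in>X. a k * u k x)) < d"
      using R d(1) unfolding Rel_def by blast
    have "Lp_norm p (\<lambda>x. (g x - (\<Sum>k\<in>X. a k * u k x)) + (\<Sum>k\<in>X. a k * u k x))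
        \<le> Lp_norm p (\<lambda>x. g x - (\<Sum>k\<in>X. a k * u k x)) + Lp_norm p (\<lambda>x. \<Sum>k\<in>X. a k * u k x)"
      using gV uV[OF X(2)] by (intro Lp_norm_triangle p_ge1 V_Lp diff_in_V)
    moreover have "Lp_norm p (\<lambda>x. f x - (f x - (\<Sum>k\<in>X. a k * v k x))) \<le> Lp_norm p f + Lp_norm p (\<lambda>x. f x - (\<Sum>k\<in>X. a k * v k x))"
      using f vV[OF X(2)] by (intro Lp_norm_triangle_diff p_ge1 V_Lp diff_in_V)
    ultimately have 1: "Lp_norm p g \<le> d + Lp_norm p (\<lambda>x. \<Sum>k\<in>X. a k * u k x)" and 2: "Lp_norm p (\<lambda>x. \<Sum>k\<in>X. a k * v k x) \<le> Lp_norm p f + d"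
      using X(3,4) by simp_all
    have "Lp_norm p (\<lambda>x. \<Sum>k\<in>X. a k * u k x) \<le> C * (Lp_norm p f + d)"
      using bound[OF X(1,2), of a] mult_left_mono[OF 2 C] by linarith
    then show "Lp_norm p g \<le> C * Lp_norm p f + e" using 1 d(2) by (simp add: algebra_simps)
  qed
  have uniq: "AE x in unitM. g x = g' x" if "f \<in> V" "Rel f g" "Rel f g'" for f g g'
  proof -
    have "Rel (\<lambda>x. 1 * f x + - 1 * f x) (\<lambda>x. 1 * g x + - 1 * g' x)" using that by (intro lin)
    then have R: "Rel (\<lambda>x. 0) (\<lambda>x. g x - g' x)" by simp
    then have "(\<lambda>x. g x - g' x) \<in> V" by (simp add: Rel_def)
    moreover have "Lp_norm p (\<lambda>x. g x - g' x) = 0"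
      using bnd[OF zero_in_V R] Lp_norm_nonneg[of p "\<lambda>x. g x - g' x"] by simp
    ultimately have "AE x in unitM. g x - g' x = 0" by (rule Lp_norm_eq_0_AE[OF V_Lp])
    then show ?thesis by eventually_elim simp
  qed
  define U where "U f = (SOME g. Rel f g)" for f
  have U: "Rel f (U f)" if "f \<in> V" for f unfolding U_def using total[OF that] by (rule someI_ex)
  have UV: "U f \<in> V" if "f \<in> V" for f using U[OF that] by (simp add: Rel_def)
  have Ulin: "AE x in unitM. U (\<lambda>y. a * f y + b * g y) x = a * U f x + b * U g x" if "f \<in> V" "g \<in> V" for f g a b
    using that V_lincomb[OF that] by (intro uniq[OF _ U lin] U) auto
  have Ubd: "Lp_norm p (U f) \<le> C * Lp_norm p f" if "f \<in> V" for f using bnd[OF that U[OF that]] .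
  have Uv: "AE x in unitM. U (v k) x = u k x" if k: "k \<in> K" for k
  proof (rule uniq[OF v[OF k] U[OF v[OF k]]])
    show "Rel (v k) (u k)" unfolding Rel_def using u[OF k] k by (auto intro!: exI[of _ "{k}"] exI[of _ "\<lambda>_. 1"])
  qed
  show ?thesis using UV Ulin Ubd Uv unfolding bounded_op_on_def by (intro exI[of _ U]) blast
qed

text \<open>\<open>Y\<close> is bounded below by \<open>\<bar>c\<bar> - \<delta>\<close>, so undoing
  it on its range costs at most the reciprocal. The range is dense because approximate solutions of
  \<open>Y g = f\<close> improve geometrically, and the inverse is then the extension of the map
  from \<open>Y f\<close> to \<open>f\<close>.\<close>

lemma perturbed_scalar_left_inverse:
  assumes Y: "bounded_op_on p V Y" and \<delta>: "0 \<le> \<delta>" "\<delta> < \<bar>c\<bar>"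
    and close: "\<And>f. f \<in> V \<Longrightarrow> Lp_norm p (\<lambda>x. Y f x - c * f x) \<le> \<delta> * Lp_norm p f"
  shows "\<exists>U. bounded_op_on p V U \<and> (\<forall>f\<in>V. Lp_norm p (U f) \<le> 1 / (\<bar>c\<bar> - \<delta>) * Lp_norm p f) \<and>
    (\<forall>f\<in>V. AE x in unitM. U (Y f) x = f x)"
proof (rule extend_operator[where K=V and v=Y and u="\<lambda>f. f"])
  have YV: "Y f \<in> V" if "f \<in> V" for f using op_in_V[OF Y that] .
  show "Y f \<in> V" "f \<in> V" if "f \<in> V" for f using that YV by auto
  show "0 \<le> 1 / (\<bar>c\<bar> - \<delta>)" using \<delta> by simp
  have lower: "Lp_norm p f \<le> 1 / (\<bar>c\<bar> - \<delta>) * Lp_norm p (Y f)" if f: "f \<in> V" for f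
  proof -
    have "Lp_norm p (\<lambda>x. Y f x - (Y f x - c * f x)) \<le> Lp_norm p (Y f) + Lp_norm p (\<lambda>x. Y f x - c * f x)"
      using f by (intro Lp_norm_triangle_diff p_ge1 V_Lp diff_in_V YV cmult_in_V)
    then have "\<bar>c\<bar> * Lp_norm p f \<le> Lp_norm p (Y f) + \<delta> * Lp_norm p f"
      using close[OF f] p_ge1 by (simp add: Lp_norm_cmult)
    then show ?thesis using \<delta> by (simp add: field_simps)
  qed
  show "Lp_norm p (\<lambda>x. \<Sum>f\<in>X. a f * f x) \<le> 1 / (\<bar>c\<bar> - \<delta>) * Lp_norm p (\<lambda>x. \<Sum>f\<in>X. a f * Y f x)"
    if X: "finite X" "X \<subseteq> V" for X a
  proof -
    have g: "(\<lambda>x. \<Sum>f\<in>X. a f * f x) \<in> V" using X by (intro sum_in_V) auto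
    have "Lp_norm p (Y (\<lambda>x. \<Sum>f\<in>X. a f * f x)) = Lp_norm p (\<lambda>x. \<Sum>f\<in>X. a f * Y f x)"
    proof (rule Lp_norm_cong_AE)
      show "AE x in unitM. Y (\<lambda>x. \<Sum>f\<in>X. a f * f x) x = (\<Sum>f\<in>X. a f * Y f x)"
        using X by (intro op_sum[OF Y]) auto
      have "(\<lambda>x. \<Sum>f\<in>X. a f * Y f x) \<in> V" using X YV by (intro sum_in_V) auto
      then show "(\<lambda>x. \<Sum>f\<in>X. a f * Y f x) \<in> borel_measurable unitM" using V_Lp in_Lp_measurable by blast
      show "Y (\<lambda>x. \<Sum>f\<in>X. a f * f x) \<in> borel_measurable unitM" using V_Lp[OF YV[OF g]] in_Lp_measurable by blast
    qed
    then show ?thesis using lower[OF g] by simp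
  qed
  show "\<exists>X a. finite X \<and> X \<subseteq> V \<and> Lp_norm p (\<lambda>x. f x - (\<Sum>k\<in>X. a k * Y k x)) < e" if f: "f \<in> V" and e: "0 < e" for f e
  proof -
    define \<theta> where "\<theta> = \<delta> / \<bar>c\<bar>"
    have \<theta>: "0 \<le> \<theta>" "\<theta> < 1" using \<delta> by (auto simp: \<theta>_def)
    have "\<exists>g\<in>V. Lp_norm p (\<lambda>x. f x - Y g x) \<le> \<theta> ^ J * (Lp_norm p (\<lambda>x. f x - Y (\<lambda>x. 0) x))" for J
    proof (induction J)
      case 0 show ?case using zero_in_V by force
    next
      case (Suc J)
      then obtain g where g: "g \<in> V" "Lp_norm p (\<lambda>x. f x - Y g x) \<le> \<theta> ^ J * (Lp_norm p (\<lambda>x. f x - Y (\<lambda>x. 0) x))" by blast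
      define r where "r x = f x - Y g x" for x
      have r: "r \<in> V" unfolding r_def using diff_in_V[OF f YV[OF g(1)]] .
      \<comment> \<open>A Neumann step: correcting by \<open>r / c\<close> leaves the residual
        \<open>(c * r - Y r) / c\<close>, whose norm is smaller by the factor
        \<open>\<delta> / \<bar>c\<bar>\<close>.\<close>
      define g' where "g' x = 1 * g x + (1 / c) * r x" for x
      have g': "g' \<in> V" unfolding g'_def by (rule V_lincomb[OF g(1) r])
      have "AE x in unitM. Y g' x = 1 * Y g x + (1 / c) * Y r x" unfolding g'_def by (rule op_lincomb[OF Y g(1) r])
      then have "AE x in unitM. f x - Y g' x = - (1 / c) * (Y r x - c * r x)"
        by eventually_elim (use \<delta> in \<open>auto simp: r_def field_simps\<close>)
      then have "Lp_norm p (\<lambda>x. f x - Y g' x) = Lp_norm p (\<lambda>x. - (1 / c) * (Y r x - c * r x))"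
        using V_Lp[OF diff_in_V[OF f YV[OF g']]] V_Lp[OF cmult_in_V[OF diff_in_V[OF YV[OF r] cmult_in_V[OF r]]], of "- (1/c)" c]
        by (intro Lp_norm_cong_AE) (auto dest: in_Lp_measurable)
      also have "\<dots> = 1 / \<bar>c\<bar> * Lp_norm p (\<lambda>x. Y r x - c * r x)"
        using p_ge1 by (subst Lp_norm_cmult) auto
      also have "\<dots> \<le> 1 / \<bar>c\<bar> * (\<delta> * Lp_norm p r)" using close[OF r] by (intro mult_left_mono) auto
      also have "\<dots> = \<theta> * Lp_norm p r" by (simp add: \<theta>_def)
      also have "\<dots> \<le> \<theta> * (\<theta> ^ J * (Lp_norm p (\<lambda>x. f x - Y (\<lambda>x. 0) x)))"
        using g(2) \<theta>(1) unfolding r_def by (intro mult_left_mono)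
      finally show ?case using g' by (intro bexI[of _ g']) (auto simp: mult_ac)
    qed
    moreover have "(\<lambda>J. \<theta> ^ J * (Lp_norm p (\<lambda>x. f x - Y (\<lambda>x. 0) x))) \<longlonglongrightarrow> 0 * (Lp_norm p (\<lambda>x. f x - Y (\<lambda>x. 0) x))"
      using \<theta> by (intro tendsto_mult_right LIMSEQ_realpow_zero)
    then obtain J where "\<theta> ^ J * (Lp_norm p (\<lambda>x. f x - Y (\<lambda>x. 0) x)) < e"
      using order_tendstoD(2)[of _ 0 sequentially e] e by (auto simp: eventually_sequentially)
    ultimately obtain g where "g \<in> V" "Lp_norm p (\<lambda>x. f x - Y g x) < e" by (meson le_less_trans)
    then show ?thesis by (intro exI[of _ "{g}"] exI[of _ "\<lambda>_. 1"]) auto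
  qed
qed

end

section \<open>Block systems and conditional expectations\<close>

definition walsh_index :: "(nat \<times> nat set) set" where
  "walsh_index = {(n, F). 1 \<le> n \<and> F \<subseteq> {..<n} \<and> F \<noteq> {}}"

definition block_walsh :: "(nat \<Rightarrow> real \<Rightarrow> nat set) \<Rightarrow> nat \<times> nat set \<Rightarrow> real \<Rightarrow> real" where
  "block_walsh \<xi> k x = walsh (snd k) (\<xi> (fst k) x)"

lemma abs_block_walsh [simp]: "\<bar>block_walsh \<xi> k x\<bar> = 1"
  by (simp add: block_walsh_def)

lemma block_subset: "block_system \<xi> \<Longrightarrow> 1 \<le> n \<Longrightarrow> \<xi> n x \<subseteq> {..<n}"
  by (simp add: block_system_def)

lemma block_measurable:
  assumes "block_system \<xi>" "1 \<le> n"
  shows "(\<lambda>x. u (\<xi> n x) :: real) \<in> borel_measurable unitM"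
proof -
  have "\<xi> n \<in> measurable unitM (count_space UNIV)" using assms by (simp add: block_system_def)
  from measurable_compose[OF this, of u borel] show ?thesis by simp
qed

lemma block_integral:
  fixes u :: "nat set \<Rightarrow> real"
  shows "block_system \<xi> \<Longrightarrow> 1 \<le> n \<Longrightarrow> (\<integral>x. u (\<xi> n x) \<partial>unitM) = (\<Sum>y\<in>Pow {..<n}. u y) / 2 ^ n"
  by (simp add: block_system_def)

lemma block_prod:
  fixes u :: "nat \<Rightarrow> nat set \<Rightarrow> real"
  shows "block_system \<xi> \<Longrightarrow> finite X \<Longrightarrow> X \<subseteq> {1..} \<Longrightarrow>
    (\<integral>x. (\<Prod>n\<in>X. u n (\<xi> n x)) \<partial>unitM) = (\<Prod>n\<in>X. \<integral>x. u n (\<xi> n x) \<partial>unitM)"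
  by (simp add: block_system_def)

lemma block_pair:
  fixes u u' :: "nat set \<Rightarrow> real"
  assumes "block_system \<xi>" "1 \<le> n" "1 \<le> n'" "n \<noteq> n'"
  shows "(\<integral>x. u (\<xi> n x) * u' (\<xi> n' x) \<partial>unitM) = (\<integral>x. u (\<xi> n x) \<partial>unitM) * (\<integral>x. u' (\<xi> n' x) \<partial>unitM)"
  using block_prod[OF assms(1), of "{n, n'}" "\<lambda>k. if k = n then u else u'"] assms(2-4) by simp

lemma block_walsh_measurable: "block_system \<xi> \<Longrightarrow> k \<in> walsh_index \<Longrightarrow> block_walsh \<xi> k \<in> borel_measurable unitM"
  unfolding block_walsh_def[abs_def] by (rule block_measurable) (auto simp: walsh_index_def)

lemma block_walsh_mean:
  assumes "block_system \<xi>" "k \<in> walsh_index"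
  shows "(\<integral>x. block_walsh \<xi> k x \<partial>unitM) = 0"
proof -
  obtain n F where k: "k = (n, F)" "1 \<le> n" "F \<subseteq> {..<n}" "F \<noteq> {}" using assms(2) by (auto simp: walsh_index_def)
  then show ?thesis
    unfolding block_walsh_def using block_integral[OF assms(1) k(2), of "walsh F"] sum_walsh[OF _ k(3,4)] by simp
qed

lemma block_walsh_orthonormal:
  assumes bs: "block_system \<xi>" and k: "k \<in> walsh_index" and j: "j \<in> walsh_index"
  shows "(\<integral>x. block_walsh \<xi> k x * block_walsh \<xi> j x \<partial>unitM) = (if k = j then 1 else 0)"
proof (cases "fst k = fst j")
  case True
  obtain n F G where kj: "k = (n, F)" "j = (n, G)" "1 \<le> n" "F \<subseteq> {..<n}" "G \<subseteq> {..<n}"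
    using True k j by (auto simp: walsh_index_def)
  have "(\<integral>x. block_walsh \<xi> k x * block_walsh \<xi> j x \<partial>unitM) = (\<Sum>y\<in>Pow {..<n}. walsh F y * walsh G y) / 2 ^ n"
    using block_integral[OF bs kj(3), of "\<lambda>y. walsh F y * walsh G y"] by (simp add: block_walsh_def kj(1,2))
  also have "(\<Sum>y\<in>Pow {..<n}. walsh F y * walsh G y) = (\<Sum>y\<in>Pow {..<n}. walsh y F * walsh y G)"
    using kj by (intro sum.cong refl arg_cong2[where f="(*)"] walsh_commute) (auto intro: finite_subset)
  finally show ?thesis using kj by (simp add: walsh_inversion)
next
  case False
  then have "(\<integral>x. block_walsh \<xi> k x * block_walsh \<xi> j x \<partial>unitM) = (\<integral>x. block_walsh \<xi> k x \<partial>unitM) * (\<integral>x. block_walsh \<xi> j x \<partial>unitM)"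
    unfolding block_walsh_def using k j by (intro block_pair[OF bs]) (auto simp: walsh_index_def)
  then show ?thesis using False block_walsh_mean[OF bs k] by auto
qed

text \<open>The blocks in \<open>X\<close> together amount to \<open>\<Sum>X\<close> independent
  fair bits, so an integral is a plain average over configurations.\<close>

lemma block_law:
  fixes \<Phi> :: "(nat \<Rightarrow> nat set) \<Rightarrow> real"
  assumes bs: "block_system \<xi>" and X: "finite X" "X \<subseteq> {1..}"
  shows "(\<integral>x. \<Phi> (\<lambda>n\<in>X. \<xi> n x) \<partial>unitM) = (\<Sum>y\<in>PiE X (\<lambda>n. Pow {..<n}). \<Phi> y) / 2 ^ (\<Sum>X)"
proof -
  let ?Y = "PiE X (\<lambda>n. Pow {..<n})"
  have finY: "finite ?Y" using X(1) by (intro finite_PiE) auto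
  define i where "i y x = (\<Prod>n\<in>X. if \<xi> n x = y n then 1 else 0 :: real)" for y x
  have meas: "i y \<in> borel_measurable unitM" for y
    unfolding i_def[abs_def] using X
    by (intro borel_measurable_prod block_measurable[OF bs, of _ "\<lambda>z. if z = y _ then 1 else 0"]) auto
  have int: "integrable unitM (i y)" for y
    by (rule unitM.integrable_const_bound[where B=1, OF _ meas])
      (auto simp: i_def abs_prod intro!: AE_I2 prod_le_1)
  have "\<Phi> (\<lambda>n\<in>X. \<xi> n x) = (\<Sum>y\<in>?Y. \<Phi> y * i y x)" for x
  proof -
    have mem: "(\<lambda>n\<in>X. \<xi> n x) \<in> ?Y" using X block_subset[OF bs] by auto
    have "i y x = (if y = (\<lambda>n\<in>X. \<xi> n x) then 1 else 0)" if "y \<in> ?Y" for y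
    proof (cases "\<forall>n\<in>X. \<xi> n x = y n")
      case True
      then have "y = (\<lambda>n\<in>X. \<xi> n x)" using that by (intro ext) (auto simp: PiE_def extensional_def restrict_def)
      then show ?thesis using True by (simp add: i_def)
    next
      case False
      then have "i y x = 0" using X(1) by (auto simp: i_def)
      moreover have "y \<noteq> (\<lambda>n\<in>X. \<xi> n x)" using False by auto
      ultimately show ?thesis by simp
    qed
    then have "(\<Sum>y\<in>?Y. \<Phi> y * i y x) = (\<Sum>y\<in>?Y. if y = (\<lambda>n\<in>X. \<xi> n x) then \<Phi> y else 0)"
      by (intro sum.cong refl) simp
    then show ?thesis using mem finY by simp
  qed
  then have "(\<integral>x. \<Phi> (\<lambda>n\<in>X. \<xi> n x) \<partial>unitM) = (\<Sum>y\<in>?Y. \<Phi> y * (\<integral>x. i y x \<partial>unitM))"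
    using int by simp
  also have "\<dots> = (\<Sum>y\<in>?Y. \<Phi> y / 2 ^ (\<Sum>X))"
  proof (rule sum.cong)
    fix y assume y: "y \<in> ?Y"
    have "(\<integral>x. i y x \<partial>unitM) = (\<Prod>n\<in>X. \<integral>x. (if \<xi> n x = y n then 1 else 0) \<partial>unitM)"
      unfolding i_def by (rule block_prod[OF bs X, of "\<lambda>n z. if z = y n then 1 else 0"])
    also have "\<dots> = (\<Prod>n\<in>X. 1 / 2 ^ n)"
    proof (rule prod.cong)
      fix n assume n: "n \<in> X"
      then have "1 \<le> n" using X by auto
      have "y n \<in> Pow {..<n}" using y n by auto
      then show "(\<integral>x. (if \<xi> n x = y n then 1 else 0) \<partial>unitM) = (1 / 2 ^ n :: real)"
        using block_integral[OF bs \<open>1 \<le> n\<close>, of "\<lambda>z. if z = y n then 1 else 0"] by simp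
    qed simp
    also have "\<dots> = 1 / 2 ^ (\<Sum>X)" by (simp add: power_sum prod_dividef)
    finally show "\<Phi> y * (\<integral>x. i y x \<partial>unitM) = \<Phi> y / 2 ^ (\<Sum>X)" by simp
  qed simp
  finally show ?thesis by (simp add: sum_divide_distrib)
qed

text \<open>Norms of Walsh combinations depend on the joint law alone, and all block systems share
  it. This is why the embedding is isometric.\<close>

lemma block_norm_eq:
  assumes bs: "block_system \<xi>" "block_system \<xi>'" and K: "finite K" "K \<subseteq> walsh_index"
  shows "Lp_norm p (\<lambda>x. \<Sum>k\<in>K. a k * block_walsh \<xi> k x) = Lp_norm p (\<lambda>x. \<Sum>k\<in>K. a k * block_walsh \<xi>' k x)"
proof -
  define \<Phi> where "\<Phi> y = \<bar>\<Sum>k\<in>K. a k * walsh (snd k) (y (fst k))\<bar> powr p" for y :: "nat \<Rightarrow> nat set"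
  have "(\<integral>x. \<bar>\<Sum>k\<in>K. a k * block_walsh \<xi> k x\<bar> powr p \<partial>unitM) = (\<Sum>y\<in>PiE (fst ` K) (\<lambda>n. Pow {..<n}). \<Phi> y) / 2 ^ (\<Sum>(fst ` K))"
    if bs: "block_system \<xi>" for \<xi>
  proof -
    have "\<Phi> (\<lambda>n\<in>fst ` K. \<xi> n x) = \<bar>\<Sum>k\<in>K. a k * block_walsh \<xi> k x\<bar> powr p" for x
      unfolding \<Phi>_def block_walsh_def by (intro arg_cong[where f="\<lambda>z. \<bar>z\<bar> powr p"] sum.cong) auto
    moreover have "fst ` K \<subseteq> {1..}" using K(2) by (auto simp: walsh_index_def)
    ultimately show ?thesis using block_law[OF bs _ _, of "fst ` K" \<Phi>] K(1) by simp
  qed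
  from this[OF bs(1)] this[OF bs(2)] show ?thesis by (simp add: Lp_norm_def)
qed

section \<open>Maps between blocks that preserve uniformity\<close>

text \<open>In Fourier terms, \<open>q\<close> carries the uniform law on subsets of
  \<open>{..<m}\<close> to the uniform law on subsets of \<open>{..<n}\<close>. In this form the
  condition can be read off from the Walsh expansion of the multiplexer.\<close>

definition uniform_map :: "nat \<Rightarrow> nat \<Rightarrow> (nat set \<Rightarrow> nat set) \<Rightarrow> bool" where
  "uniform_map m n q \<longleftrightarrow> (\<forall>x. q x \<subseteq> {..<n}) \<and>
     (\<forall>F\<subseteq>{..<n}. F \<noteq> {} \<longrightarrow> (\<Sum>x\<in>Pow {..<m}. walsh F (q x)) = 0)"

text \<open>Copy \<open>n\<close> is placed inside block \<open>m n\<close>; injectivity keeps the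
  copies independent.\<close>

definition block_map :: "(nat \<Rightarrow> nat) \<Rightarrow> (nat \<Rightarrow> nat set \<Rightarrow> nat set) \<Rightarrow> bool" where
  "block_map m q \<longleftrightarrow> inj_on m {1..} \<and> (\<forall>n\<ge>1. 1 \<le> m n \<and> uniform_map (m n) n (q n))"

lemma uniform_map_average:
  fixes u :: "nat set \<Rightarrow> real"
  assumes q: "uniform_map m n q"
  shows "(\<Sum>x\<in>Pow {..<m}. u (q x)) / 2 ^ m = (\<Sum>y\<in>Pow {..<n}. u y) / 2 ^ n"
proof -
  define c where "c F = (\<Sum>z\<in>Pow {..<n}. u z * walsh F z) / 2 ^ n" for F
  have u: "u (q x) = (\<Sum>F\<in>Pow {..<n}. c F * walsh F (q x))" for x
    using walsh_expansion[of "{..<n}" "q x" u] q by (simp add: c_def uniform_map_def)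
  have "(\<Sum>x\<in>Pow {..<m}. u (q x)) = (\<Sum>F\<in>Pow {..<n}. c F * (\<Sum>x\<in>Pow {..<m}. walsh F (q x)))"
    unfolding u by (subst sum.swap) (simp add: sum_distrib_left)
  also have "\<dots> = (\<Sum>F\<in>Pow {..<n}. if F = {} then c {} * 2 ^ m else 0)"
    by (intro sum.cong refl) (use q in \<open>auto simp: uniform_map_def card_Pow\<close>)
  also have "\<dots> = c {} * 2 ^ m" by (simp add: sum.delta)
  finally show ?thesis by (simp add: c_def)
qed

lemma uniform_map_walsh_span:
  assumes q: "uniform_map m n q" and F: "F \<subseteq> {..<n}" "F \<noteq> {}"
  shows "\<exists>a. \<forall>x\<subseteq>{..<m}. walsh F (q x) = (\<Sum>S\<in>Pow {..<m} - {{}}. a S * walsh S x)"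
proof -
  define a where "a S = (\<Sum>z\<in>Pow {..<m}. walsh F (q z) * walsh S z) / 2 ^ m" for S
  have "a {} = 0" using q F by (simp add: a_def uniform_map_def)
  have "walsh F (q x) = (\<Sum>S\<in>Pow {..<m} - {{}}. a S * walsh S x)" if "x \<subseteq> {..<m}" for x
  proof -
    have "walsh F (q x) = (\<Sum>S\<in>Pow {..<m}. a S * walsh S x)"
      using walsh_expansion[of "{..<m}" x "\<lambda>z. walsh F (q z)"] that by (simp add: a_def)
    also have "\<dots> = (\<Sum>S\<in>Pow {..<m} - {{}}. a S * walsh S x)"
      using \<open>a {} = 0\<close> by (subst sum.remove[of _ "{}"]) auto
    finally show ?thesis .
  qed
  then show ?thesis by blast
qed

lemma block_prod_reindex:
  fixes u :: "nat \<Rightarrow> nat set \<Rightarrow> real"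
  assumes bs: "block_system \<xi>" and m: "inj_on m X" "m ` X \<subseteq> {1..}" and X: "finite X"
  shows "(\<integral>x. (\<Prod>n\<in>X. u n (\<xi> (m n) x)) \<partial>unitM) = (\<Prod>n\<in>X. \<integral>x. u n (\<xi> (m n) x) \<partial>unitM)"
proof -
  define v where "v k = u (inv_into X m k)" for k
  have v: "v (m n) = u n" if "n \<in> X" for n using m that by (simp add: v_def)
  have "(\<integral>x. (\<Prod>k\<in>m ` X. v k (\<xi> k x)) \<partial>unitM) = (\<Prod>k\<in>m ` X. \<integral>x. v k (\<xi> k x) \<partial>unitM)"
    using X m by (intro block_prod[OF bs]) auto
  then show ?thesis using m(1) v by (simp add: prod.reindex)
qed

lemma block_system_derived:
  assumes bs: "block_system \<xi>" and mq: "block_map m q"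
  shows "block_system (\<lambda>n x. q n (\<xi> (m n) x))"
  unfolding block_system_def
proof (intro conjI allI impI)
  fix n :: nat assume n: "1 \<le> n"
  have mn: "1 \<le> m n" and q: "uniform_map (m n) n (q n)" using mq n by (auto simp: block_map_def)
  have "\<xi> (m n) \<in> measurable unitM (count_space UNIV)" using bs mn by (simp add: block_system_def)
  from measurable_compose[OF this, of "q n" "count_space UNIV"]
  show "(\<lambda>x. q n (\<xi> (m n) x)) \<in> measurable unitM (count_space UNIV)" by simp
  show "q n (\<xi> (m n) x) \<subseteq> {..<n}" for x using q by (simp add: uniform_map_def)
  fix u :: "nat set \<Rightarrow> real"
  show "(\<integral>x. u (q n (\<xi> (m n) x)) \<partial>unitM) = (\<Sum>y\<in>Pow {..<n}. u y) / 2 ^ n"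
    using block_integral[OF bs mn, of "\<lambda>z. u (q n z)"] uniform_map_average[OF q, of u] by simp
next
  fix X :: "nat set" and u :: "nat \<Rightarrow> nat set \<Rightarrow> real"
  assume X: "finite X" "X \<subseteq> {1..}"
  have "inj_on m X" using mq X(2) by (auto simp: block_map_def intro: inj_on_subset)
  moreover have "m ` X \<subseteq> {1..}" using mq X(2) by (auto simp: block_map_def)
  ultimately show "(\<integral>x. (\<Prod>n\<in>X. u n (q n (\<xi> (m n) x))) \<partial>unitM) = (\<Prod>n\<in>X. \<integral>x. u n (q n (\<xi> (m n) x)) \<partial>unitM)"
    by (rule block_prod_reindex[OF bs _ _ X(1), of m "\<lambda>n z. u n (q n z)"])
qed

abbreviation pairing :: "(real \<Rightarrow> real) \<Rightarrow> (real \<Rightarrow> real) \<Rightarrow> real" where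
  "pairing f g \<equiv> (\<integral>x. f x * g x \<partial>unitM)"

section \<open>Walsh functions in a closed subspace and conditional averages\<close>

locale walsh_span = closed_Lp_subspace +
  fixes \<xi> :: "nat \<Rightarrow> real \<Rightarrow> nat set"
  assumes p_gt1: "1 < p" and bs: "block_system \<xi>"
    and walsh_in_V: "k \<in> walsh_index \<Longrightarrow> block_walsh \<xi> k \<in> V"
    and walsh_dense: "f \<in> V \<Longrightarrow> 0 < e \<Longrightarrow> \<exists>K a. finite K \<and> K \<subseteq> walsh_index \<and>
        Lp_norm p (\<lambda>x. f x - (\<Sum>k\<in>K. a k * block_walsh \<xi> k x)) < e"
begin

abbreviation w :: "nat \<times> nat set \<Rightarrow> real \<Rightarrow> real" where "w \<equiv> block_walsh \<xi>"

lemma w_measurable: "k \<in> walsh_index \<Longrightarrow> w k \<in> borel_measurable unitM"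
  by (rule block_walsh_measurable[OF bs])

lemma w_norm: "k \<in> walsh_index \<Longrightarrow> Lp_norm r (w k) \<le> 1" if "0 < r" for r
  using that by (intro Lp_norm_bounded w_measurable) auto

lemma w_Lp: "k \<in> walsh_index \<Longrightarrow> in_Lp p (w k)"
  by (intro V_Lp walsh_in_V)

lemma V_measurable: "f \<in> V \<Longrightarrow> f \<in> borel_measurable unitM"
  using V_Lp in_Lp_measurable by blast

lemma pairing_sum_left:
  assumes "\<And>k. k \<in> K \<Longrightarrow> f k \<in> V" and \<beta>: "\<beta> \<in> borel_measurable unitM" "\<And>x. \<bar>\<beta> x\<bar> \<le> C"
  shows "pairing (\<lambda>x. \<Sum>k\<in>K. a k * f k x) \<beta> = (\<Sum>k\<in>K. a k * pairing (f k) \<beta>)"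
proof -
  have "integrable unitM (\<lambda>x. f k x * \<beta> x)" if "k \<in> K" for k
    using integrable_mult_bounded_Lp[OF p_ge1 V_Lp \<beta>] assms(1) that by blast
  then show ?thesis by (simp add: sum_distrib_right mult.assoc)
qed

lemma pairing_sum_right:
  assumes f: "f \<in> V" and \<beta>: "\<And>k. k \<in> K \<Longrightarrow> \<beta> k \<in> borel_measurable unitM" "\<And>k x. k \<in> K \<Longrightarrow> \<bar>\<beta> k x\<bar> \<le> C"
  shows "pairing f (\<lambda>x. \<Sum>k\<in>K. a k * \<beta> k x) = (\<Sum>k\<in>K. a k * pairing f (\<beta> k))"
proof -
  have "integrable unitM (\<lambda>x. f x * \<beta> k x)" if "k \<in> K" for k
    using integrable_mult_bounded_Lp[OF p_ge1 V_Lp[OF f]] \<beta> that by blast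
  then show ?thesis by (simp add: sum_distrib_left mult.left_commute)
qed

lemma pairing_diff_left:
  assumes "f \<in> V" "g \<in> V" and \<beta>: "\<beta> \<in> borel_measurable unitM" "\<And>x. \<bar>\<beta> x\<bar> \<le> C"
  shows "pairing (\<lambda>x. f x - g x) \<beta> = pairing f \<beta> - pairing g \<beta>"
  using integrable_mult_bounded_Lp[OF p_ge1 V_Lp \<beta>, of f] integrable_mult_bounded_Lp[OF p_ge1 V_Lp \<beta>, of g] assms
  by (simp add: left_diff_distrib)

lemma pairing_zero:
  assumes \<beta>: "\<beta> \<in> borel_measurable unitM" "\<And>x. \<bar>\<beta> x\<bar> \<le> C" and z: "\<And>k. k \<in> walsh_index \<Longrightarrow> pairing (w k) \<beta> = 0" and g: "g \<in> V"
  shows "pairing g \<beta> = 0"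
proof -
  have C: "0 \<le> C" using \<beta>(2)[of 0] by linarith
  have "\<bar>pairing g \<beta>\<bar> \<le> 0 + e" if e: "0 < e" for e
  proof -
    define d where "d = e / (C + 1)"
    have d: "0 < d" "(C + 1) * d = e" using e C by (auto simp: d_def)
    obtain K a where K: "finite K" "K \<subseteq> walsh_index" "Lp_norm p (\<lambda>x. g x - (\<Sum>k\<in>K. a k * w k x)) < d"
      using walsh_dense[OF g d(1)] by blast
    have hV: "(\<lambda>x. \<Sum>k\<in>K. a k * w k x) \<in> V" using K(2) walsh_in_V by (intro sum_in_V) auto
    have "pairing (\<lambda>x. \<Sum>k\<in>K. a k * w k x) \<beta> = (\<Sum>k\<in>K. a k * pairing (w k) \<beta>)"
      by (rule pairing_sum_left[OF _ \<beta>]) (use walsh_in_V K(2) in auto)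
    also have "\<dots> = 0" using z K(2) by (intro sum.neutral) auto
    finally have "pairing (\<lambda>x. \<Sum>k\<in>K. a k * w k x) \<beta> = 0" .
    then have "pairing g \<beta> = pairing (\<lambda>x. g x - (\<Sum>k\<in>K. a k * w k x)) \<beta>"
      using pairing_diff_left[OF g hV \<beta>] by simp
    also have "\<dots> = (C + 1) * pairing (\<lambda>x. g x - (\<Sum>k\<in>K. a k * w k x)) (\<lambda>x. \<beta> x / (C + 1))"
      using C by simp
    also have "\<bar>\<dots>\<bar> \<le> (C + 1) * Lp_norm p (\<lambda>x. g x - (\<Sum>k\<in>K. a k * w k x))"
    proof -
      have "\<bar>\<beta> x / (C + 1)\<bar> \<le> 1" for x using \<beta>(2)[of x] C by (simp add: abs_divide)
      then have "\<bar>pairing (\<lambda>x. g x - (\<Sum>k\<in>K. a k * w k x)) (\<lambda>x. \<beta> x / (C + 1))\<bar> \<le> Lp_norm p (\<lambda>x. g x - (\<Sum>k\<in>K. a k * w k x))"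
        using \<beta>(1) by (intro abs_integral_mult_bounded_le p_ge1 V_Lp diff_in_V g hV) auto
      then show ?thesis using C by (simp only: abs_mult) (intro mult_mono, auto)
    qed
    also have "\<dots> \<le> (C + 1) * d" using K(3) C by (intro mult_left_mono) auto
    finally show ?thesis using d(2) by simp
  qed
  then have "\<bar>pairing g \<beta>\<bar> \<le> 0" by (rule field_le_epsilon)
  then show ?thesis by simp
qed

lemma abs_pairing_w_le: "f \<in> V \<Longrightarrow> k \<in> walsh_index \<Longrightarrow> \<bar>pairing f (w k)\<bar> \<le> Lp_norm p f"
  by (intro abs_integral_mult_bounded_le p_ge1 V_Lp w_measurable) auto

abbreviation b :: "(nat \<Rightarrow> nat) \<Rightarrow> (nat \<Rightarrow> nat set \<Rightarrow> nat set) \<Rightarrow> nat \<times> nat set \<Rightarrow> real \<Rightarrow> real" where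
  "b m q \<equiv> block_walsh (\<lambda>n x. q n (\<xi> (m n) x))"

context
  fixes m :: "nat \<Rightarrow> nat" and q :: "nat \<Rightarrow> nat set \<Rightarrow> nat set"
  assumes mq: "block_map m q"
begin

lemma m_ge: "1 \<le> n \<Longrightarrow> 1 \<le> m n"
  using mq by (simp add: block_map_def)

lemma q_uniform: "1 \<le> n \<Longrightarrow> uniform_map (m n) n (q n)"
  using mq by (simp add: block_map_def)

lemma bsb: "block_system (\<lambda>n x. q n (\<xi> (m n) x))"
  by (rule block_system_derived[OF bs mq])

lemma b_measurable: "k \<in> walsh_index \<Longrightarrow> b m q k \<in> borel_measurable unitM"
  by (rule block_walsh_measurable[OF bsb])

lemma b_in_V:
  assumes k: "k \<in> walsh_index"
  shows "b m q k \<in> V"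
proof -
  obtain n F where nF: "k = (n, F)" "1 \<le> n" "F \<subseteq> {..<n}" "F \<noteq> {}" using k by (auto simp: walsh_index_def)
  obtain a where a: "\<And>x. x \<subseteq> {..<m n} \<Longrightarrow> walsh F (q n x) = (\<Sum>S\<in>Pow {..<m n} - {{}}. a S * walsh S x)"
    using uniform_map_walsh_span[OF q_uniform[OF nF(2)] nF(3,4)] by blast
  have "b m q k = (\<lambda>x. \<Sum>S\<in>Pow {..<m n} - {{}}. a S * w (m n, S) x)"
    using a block_subset[OF bs m_ge[OF nF(2)]] by (auto simp: block_walsh_def nF(1))
  moreover have "\<dots> \<in> V"
    using m_ge[OF nF(2)] by (intro sum_in_V walsh_in_V) (auto simp: walsh_index_def)
  ultimately show ?thesis by simp
qed

lemma pairing_w_b_zero: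
  assumes k: "k \<in> walsh_index" and j: "j \<in> walsh_index" and ne: "m (fst j) \<noteq> fst k"
  shows "pairing (w k) (b m q j) = 0"
proof -
  have "pairing (w k) (b m q j) = (\<integral>x. w k x \<partial>unitM) * (\<integral>x. b m q j x \<partial>unitM)"
    unfolding block_walsh_def using k j ne m_ge
    by (intro block_pair[OF bs, of _ _ "walsh (snd k)" "\<lambda>z. walsh (snd j) (q (fst j) z)"]) (auto simp: walsh_index_def)
  then show ?thesis using block_walsh_mean[OF bs k] by simp
qed

text \<open>The event has probability \<open>1 / 2 ^ (\<Sum>X)\<close>, so the left side is the
  conditional mean of \<open>g\<close>. Divided by its probability, the indicator is a product over
  the copies of 1 plus nonconstant Walsh terms. Elements of \<open>V\<close> are limits of sums of
  mean-zero functions of single blocks, so that only the terms with exactly one Walsh factor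
  contribute.\<close>

lemma conditional_average:
  assumes X: "finite X" "X \<subseteq> {1..}" and y: "y \<in> PiE X (\<lambda>n. Pow {..<n})" and g: "g \<in> V"
  shows "2 ^ (\<Sum>X) * pairing g (\<lambda>x. \<Prod>n\<in>X. if q n (\<xi> (m n) x) = y n then 1 else 0)
      = (\<Sum>n\<in>X. \<Sum>F\<in>Pow {..<n} - {{}}. pairing g (b m q (n, F)) * walsh F (y n))"
proof -
  define i where "i x = (\<Prod>n\<in>X. if q n (\<xi> (m n) x) = y n then 1 else 0 :: real)" for x
  define s where "s x = (\<Sum>n\<in>X. \<Sum>F\<in>Pow {..<n} - {{}}. walsh F (y n) * b m q (n, F) x)" for x
  have idx: "(n, F) \<in> walsh_index" if "n \<in> X" "F \<in> Pow {..<n} - {{}}" for n F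
    using that X by (auto simp: walsh_index_def)
  have im: "i \<in> borel_measurable unitM"
    unfolding i_def[abs_def] using X m_ge
    by (intro borel_measurable_prod block_measurable[OF bs, of _ "\<lambda>z. if q _ z = y _ then 1 else 0"]) auto
  have i1: "\<bar>i x\<bar> \<le> 1" for x by (auto simp: i_def abs_prod intro!: prod_le_1)
  have sm: "s \<in> borel_measurable unitM"
    unfolding s_def[abs_def] using idx by (intro borel_measurable_sum borel_measurable_times borel_measurable_const b_measurable)
  have s1: "\<bar>s x\<bar> \<le> (\<Sum>n\<in>X. \<Sum>F\<in>Pow {..<n} - {{}}. 1)" for x
    unfolding s_def by (intro order_trans[OF sum_abs] sum_mono order_trans[OF sum_abs]) (simp add: abs_mult)
  have pairing_s: "pairing f s = (\<Sum>n\<in>X. \<Sum>F\<in>Pow {..<n} - {{}}. pairing f (b m q (n, F)) * walsh F (y n))" if f: "f \<in> V" for f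
  proof -
    have int: "integrable unitM (\<lambda>x. f x * b m q (n, F) x)" if "n \<in> X" "F \<in> Pow {..<n} - {{}}" for n F
      by (rule integrable_mult_bounded_Lp[OF p_ge1 V_Lp[OF f] b_measurable[OF idx[OF that]], of 1]) simp
    have "pairing f s = (\<integral>x. (\<Sum>n\<in>X. \<Sum>F\<in>Pow {..<n} - {{}}. walsh F (y n) * (f x * b m q (n, F) x)) \<partial>unitM)"
      by (simp add: s_def sum_distrib_left mult_ac)
    also have "\<dots> = (\<Sum>n\<in>X. \<integral>x. (\<Sum>F\<in>Pow {..<n} - {{}}. walsh F (y n) * (f x * b m q (n, F) x)) \<partial>unitM)"
      using int by (intro Bochner_Integration.integral_sum Bochner_Integration.integrable_sum integrable_mult_right)
    also have "\<dots> = (\<Sum>n\<in>X. \<Sum>F\<in>Pow {..<n} - {{}}. \<integral>x. walsh F (y n) * (f x * b m q (n, F) x) \<partial>unitM)"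
      using int by (intro sum.cong refl Bochner_Integration.integral_sum integrable_mult_right)
    finally show ?thesis by (simp add: mult.commute)
  qed
  \<comment> \<open>\<open>s\<close> keeps the part of the expanded indicator with exactly one Walsh
    factor; the remainder annihilates all Walsh functions \<open>w k\<close> and therefore
    \<open>V\<close>.\<close>
  define \<beta> where "\<beta> x = 2 ^ (\<Sum>X) * i x - s x" for x
  have pairing_\<beta>: "pairing f \<beta> = 2 ^ (\<Sum>X) * pairing f i - pairing f s" if f: "f \<in> V" for f
  proof -
    have "integrable unitM (\<lambda>x. f x * i x)" "integrable unitM (\<lambda>x. f x * s x)"
      using integrable_mult_bounded_Lp[OF p_ge1 V_Lp[OF f] im i1] integrable_mult_bounded_Lp[OF p_ge1 V_Lp[OF f] sm s1] .
    then have "(\<integral>x. 2 ^ (\<Sum>X) * (f x * i x) - f x * s x \<partial>unitM) = 2 ^ (\<Sum>X) * pairing f i - pairing f s" by simp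
    then show ?thesis by (simp add: \<beta>_def algebra_simps)
  qed
  have injm: "inj_on m X" using mq X(2) by (auto simp: block_map_def intro: inj_on_subset)
  have zero: "pairing (w k) \<beta> = 0" if k: "k \<in> walsh_index" for k
  proof -
    obtain N S where NS: "k = (N, S)" "1 \<le> N" "S \<subseteq> {..<N}" "S \<noteq> {}" using k by (auto simp: walsh_index_def)
    show ?thesis
    proof (cases "N \<in> m ` X")
      case True
      then obtain n0 where n0: "n0 \<in> X" "N = m n0" by blast
      have n0_1: "1 \<le> n0" using n0 X by auto
      \<comment> \<open>The Walsh factor joins the indicator of the only copy that lives in its
        block; the other copies are independent of it and contribute their probabilities.\<close>
      define u where "u n z = (if n = n0 then walsh S z else 1) * (if q n z = y n then 1 else 0)" for n z
      have "pairing (w k) i = (\<integral>x. (\<Prod>n\<in>X. u n (\<xi> (m n) x)) \<partial>unitM)"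
      proof (intro Bochner_Integration.integral_cong refl)
        fix x
        have "(\<Prod>n\<in>X. u n (\<xi> (m n) x)) = (\<Prod>n\<in>X. if n = n0 then walsh S (\<xi> (m n) x) else 1) * i x"
          unfolding u_def i_def by (simp add: prod.distrib)
        then show "w k x * i x = (\<Prod>n\<in>X. u n (\<xi> (m n) x))"
          using n0 X(1) by (simp add: block_walsh_def NS(1))
      qed
      also have "\<dots> = (\<Prod>n\<in>X. \<integral>x. u n (\<xi> (m n) x) \<partial>unitM)"
        using X m_ge by (intro block_prod_reindex[OF bs injm]) auto
      also have "\<dots> = (\<integral>x. u n0 (\<xi> N x) \<partial>unitM) * (\<Prod>n\<in>X - {n0}. \<integral>x. u n (\<xi> (m n) x) \<partial>unitM)"
        using n0 X(1) by (simp add: prod.remove)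
      also have "(\<Prod>n\<in>X - {n0}. \<integral>x. u n (\<xi> (m n) x) \<partial>unitM) = (\<Prod>n\<in>X - {n0}. 1 / 2 ^ n)"
      proof (rule prod.cong)
        fix n assume n: "n \<in> X - {n0}"
        then have n1: "1 \<le> n" using X by auto
        have "y n \<in> Pow {..<n}" using y n by auto
        then show "(\<integral>x. u n (\<xi> (m n) x) \<partial>unitM) = 1 / 2 ^ n"
          using block_integral[OF bsb n1, of "\<lambda>z. if z = y n then 1 else 0"] n by (simp add: u_def)
      qed simp
      also have "\<dots> = 1 / 2 ^ (\<Sum>(X - {n0}))" by (simp add: power_sum prod_dividef)
      finally have *: "pairing (w k) i = (\<integral>x. u n0 (\<xi> N x) \<partial>unitM) / 2 ^ (\<Sum>(X - {n0}))" by simp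
      have sX: "\<Sum>X = n0 + \<Sum>(X - {n0})" using n0(1) X(1) by (simp add: sum.remove)
      have "2 ^ (\<Sum>X) * pairing (w k) i = 2 ^ n0 * (\<integral>x. u n0 (\<xi> N x) \<partial>unitM)"
        unfolding * sX by (simp add: power_add)
      also have "\<dots> = (\<integral>x. 2 ^ n0 * u n0 (\<xi> N x) \<partial>unitM)" by simp
      also have "\<dots> = (\<integral>x. (\<Sum>F\<in>Pow {..<n0}. walsh F (y n0) * (w k x * walsh F (q n0 (\<xi> N x)))) \<partial>unitM)"
      proof (intro Bochner_Integration.integral_cong refl)
        fix x
        have sub: "q n0 (\<xi> N x) \<subseteq> {..<n0}" using q_uniform[OF n0_1] by (simp add: uniform_map_def)
        have "y n0 \<subseteq> {..<n0}" using y n0 by auto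
        then have "(\<Sum>F\<in>Pow {..<n0}. walsh F (q n0 (\<xi> N x)) * walsh F (y n0)) = (if q n0 (\<xi> N x) = y n0 then 2 ^ n0 else 0)"
          using walsh_inversion[OF _ sub, of "y n0"] by simp
        moreover have "(\<Sum>F\<in>Pow {..<n0}. walsh F (y n0) * (w k x * walsh F (q n0 (\<xi> N x)))) = w k x * (\<Sum>F\<in>Pow {..<n0}. walsh F (q n0 (\<xi> N x)) * walsh F (y n0))"
          by (simp add: sum_distrib_left mult_ac)
        ultimately show "2 ^ n0 * u n0 (\<xi> N x) = (\<Sum>F\<in>Pow {..<n0}. walsh F (y n0) * (w k x * walsh F (q n0 (\<xi> N x))))"
          by (simp add: u_def block_walsh_def NS(1))
      qed
      also have "\<dots> = (\<Sum>F\<in>Pow {..<n0}. walsh F (y n0) * (\<integral>x. w k x * walsh F (q n0 (\<xi> N x)) \<partial>unitM))"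
      proof -
        have "integrable unitM (\<lambda>x. w k x * walsh F (q n0 (\<xi> N x)))" for F
          by (rule integrable_mult_bounded_Lp[OF p_ge1 w_Lp[OF k], of _ 1])
            (use block_measurable[OF bs NS(2), of "\<lambda>z. walsh F (q n0 z)"] in auto)
        then show ?thesis by simp
      qed
      also have "\<dots> = (\<Sum>F\<in>Pow {..<n0} - {{}}. walsh F (y n0) * (\<integral>x. w k x * walsh F (q n0 (\<xi> N x)) \<partial>unitM))"
        using block_walsh_mean[OF bs k] by (subst sum.remove[of _ "{}"]) auto
      also have "\<dots> = (\<Sum>F\<in>Pow {..<n0} - {{}}. pairing (w k) (b m q (n0, F)) * walsh F (y n0))"
        by (simp add: block_walsh_def[of "\<lambda>n x. q n (\<xi> (m n) x)"] n0(2) mult.commute)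
      also have "\<dots> = pairing (w k) s"
      proof -
        have "(\<Sum>n\<in>X. \<Sum>F\<in>Pow {..<n} - {{}}. pairing (w k) (b m q (n, F)) * walsh F (y n))
          = (\<Sum>n\<in>{n0}. \<Sum>F\<in>Pow {..<n} - {{}}. pairing (w k) (b m q (n, F)) * walsh F (y n))"
        proof (rule sum.mono_neutral_right)
          show "\<forall>n\<in>X - {n0}. (\<Sum>F\<in>Pow {..<n} - {{}}. pairing (w k) (b m q (n, F)) * walsh F (y n)) = 0"
          proof
            fix n assume n: "n \<in> X - {n0}"
            then have "m n \<noteq> N" using n0 inj_onD[OF injm, of n n0] by auto
            then have "pairing (w k) (b m q (n, F)) = 0" if "F \<in> Pow {..<n} - {{}}" for F
              using n that NS(1) by (intro pairing_w_b_zero k idx) auto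
            then show "(\<Sum>F\<in>Pow {..<n} - {{}}. pairing (w k) (b m q (n, F)) * walsh F (y n)) = 0" by simp
          qed
        qed (use X n0 in auto)
        then show ?thesis using pairing_s[OF walsh_in_V[OF k]] by simp
      qed
      finally show ?thesis using pairing_\<beta>[OF walsh_in_V[OF k]] by simp
    next
      case False
      \<comment> \<open>Index 0 is free because \<open>X\<close> lies in \<open>{1..}\<close>. It
        carries the block \<open>N\<close>, which hosts none of the copies, so that independence
        splits off a factor of mean zero.\<close>
      define m' where "m' n = (if n = 0 then N else m n)" for n
      define u where "u n z = (if n = 0 then walsh S z else if q n z = y n then 1 else 0)" for n z
      have X0: "0 \<notin> X" using X by auto
      have "pairing (w k) i = (\<integral>x. (\<Prod>n\<in>insert 0 X. u n (\<xi> (m' n) x)) \<partial>unitM)"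
      proof (intro Bochner_Integration.integral_cong refl)
        fix x
        have "(\<Prod>n\<in>X. u n (\<xi> (m' n) x)) = i x"
          unfolding i_def by (intro prod.cong refl) (use X0 in \<open>auto simp: u_def m'_def\<close>)
        then show "w k x * i x = (\<Prod>n\<in>insert 0 X. u n (\<xi> (m' n) x))"
          using X(1) X0 by (simp add: u_def m'_def block_walsh_def NS(1))
      qed
      also have "\<dots> = (\<Prod>n\<in>insert 0 X. \<integral>x. u n (\<xi> (m' n) x) \<partial>unitM)"
      proof (rule block_prod_reindex[OF bs])
        have "inj_on m' X" using injm X0 by (auto simp: inj_on_def m'_def split: if_splits)
        moreover have "m' 0 \<notin> m' ` X" using False X0 by (auto simp: m'_def split: if_splits)
        ultimately show "inj_on m' (insert 0 X)" using X0 by (subst inj_on_insert) auto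
        show "m' ` insert 0 X \<subseteq> {1..}" using NS(2) X m_ge by (auto simp: m'_def)
      qed (use X in auto)
      also have "\<dots> = 0"
      proof -
        have "(\<integral>x. u 0 (\<xi> (m' 0) x) \<partial>unitM) = 0" using block_walsh_mean[OF bs k] by (simp add: u_def m'_def block_walsh_def NS(1))
        then show ?thesis using X(1) X0 by simp
      qed
      finally have "pairing (w k) i = 0" .
      moreover have "pairing (w k) s = 0"
      proof -
        have "pairing (w k) (b m q (n, F)) = 0" if "n \<in> X" "F \<in> Pow {..<n} - {{}}" for n F
          using False that NS(1) by (intro pairing_w_b_zero k idx) auto
        then show ?thesis using pairing_s[OF walsh_in_V[OF k]] by simp
      qed
      ultimately show ?thesis using pairing_\<beta>[OF walsh_in_V[OF k]] by simp
    qed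
  qed
  have "pairing g \<beta> = 0"
  proof (rule pairing_zero[OF _ _ zero g])
    show "\<beta> \<in> borel_measurable unitM" unfolding \<beta>_def[abs_def] using im sm by measurable
    show "\<bar>\<beta> x\<bar> \<le> 2 ^ (\<Sum>X) + (\<Sum>n\<in>X. \<Sum>F\<in>Pow {..<n} - {{}}. 1)" for x
    proof -
      have "\<bar>2 ^ (\<Sum>X) * i x\<bar> \<le> 2 ^ (\<Sum>X)" using i1[of x] by (simp add: abs_mult)
      then show ?thesis using s1[of x] unfolding \<beta>_def by linarith
    qed
  qed
  then show ?thesis using pairing_\<beta>[OF g] pairing_s[OF g] by (simp add: i_def)
qed

end

end

lemma in_Lp_mult_bounded:
  assumes "0 \<le> p" and f: "in_Lp p f" and [measurable]: "g \<in> borel_measurable unitM" and g: "\<And>x. \<bar>g x\<bar> \<le> 1"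
  shows "in_Lp p (\<lambda>x. f x * g x)"
proof -
  have [measurable]: "f \<in> borel_measurable unitM" using f by (simp add: in_Lp_def)
  have "integrable unitM (\<lambda>x. \<bar>f x\<bar> powr p)" using f by (simp add: in_Lp_def)
  then have "integrable unitM (\<lambda>x. \<bar>f x * g x\<bar> powr p)"
  proof (rule Bochner_Integration.integrable_bound)
    have "\<bar>f x * g x\<bar> powr p \<le> \<bar>f x\<bar> powr p" for x
      using g[of x] assms(1) by (intro powr_mono2) (auto simp: abs_mult mult_left_le)
    then show "AE x in unitM. norm (\<bar>f x * g x\<bar> powr p) \<le> norm (\<bar>f x\<bar> powr p)" by simp
  qed simp
  then show ?thesis by (simp add: in_Lp_def)
qed

text \<open>Block \<open>n\<close> has fewer than \<open>2 ^ n\<close> frequencies, and the sum of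
  \<open>2 ^ n / (2 * 4 ^ n)\<close> over all \<open>n\<close> from 1 on is 1/2. Entry errors
  bounded by products of two weights thus add up to at most 1/4.\<close>

definition weight :: "nat \<Rightarrow> real" where
  "weight n = 1 / (2 * 4 ^ n)"

lemma sum_weight_le:
  assumes K: "finite K" "K \<subseteq> walsh_index"
  shows "(\<Sum>k\<in>K. weight (fst k)) \<le> 1 / 2"
proof -
  obtain N where N: "\<And>n. n \<in> fst ` K \<Longrightarrow> n < N" using finite_nat_set_iff_bounded[of "fst ` K"] K(1) by auto
  have "(\<Sum>k\<in>K. weight (fst k)) \<le> (\<Sum>k\<in>Sigma {1..<Suc N} (\<lambda>n. Pow {..<n}). weight (fst k))"
    using K N by (intro sum_mono2) (fastforce simp: walsh_index_def weight_def)+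
  also have "\<dots> = (\<Sum>n\<in>{1..<Suc N}. \<Sum>F\<in>Pow {..<n}. weight n)"
    by (subst sum.Sigma) (auto intro: sum.cong)
  also have "\<dots> = (\<Sum>n\<in>{1..<Suc N}. (1 / 2) ^ n / 2)"
    by (intro sum.cong refl) (simp add: weight_def card_Pow power_divide power_mult_distrib[symmetric] field_simps)
  also have "\<dots> \<le> 1 / 2"
  proof -
    have "(\<Sum>n\<in>{1..<Suc M}. (1 / 2) ^ n / 2) = 1 / 2 - (1 / 2 :: real) ^ M / 2" for M
      by (induction M) (auto simp: field_simps)
    then show ?thesis by simp
  qed
  finally show ?thesis .
qed

section \<open>The embedding and the conditional expectation onto it\<close>

context walsh_span
begin

definition pair_index :: "nat set \<Rightarrow> (nat \<times> nat set) set" where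
  "pair_index X = Sigma X (\<lambda>n. Pow {..<n} - {{}})"

lemma pair_index_subset: "X \<subseteq> {1..} \<Longrightarrow> pair_index X \<subseteq> walsh_index"
  by (auto simp: pair_index_def walsh_index_def)

lemma finite_pair_index: "finite X \<Longrightarrow> finite (pair_index X)"
  by (auto simp: pair_index_def)

text \<open>At the configuration \<open>y\<close> of the original blocks the sum equals
  \<open>c y\<close>, the mean of \<open>g\<close> over the atom on which the copies in
  \<open>X\<close> show \<open>y\<close>. Configurations and atoms have equal probabilities, so this
  is the contractivity of a conditional expectation, obtained from Hoelder's inequality on each
  atom.\<close>

lemma block_projection_contractive:
  assumes mq: "block_map m q" and X: "finite X" "X \<subseteq> {1..}" and g: "g \<in> V"
  shows "Lp_norm p (\<lambda>x. \<Sum>j\<in>pair_index X. pairing g (b m q j) * w j x) \<le> Lp_norm p g"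
proof -
  define Y where "Y = PiE X (\<lambda>n. Pow {..<n})"
  define N where "N = \<Sum>X"
  define r where "r = p / (p - 1)"
  have r: "1 < r" "1 / p + 1 / r = 1" "p / r = p - 1" using p_gt1 by (auto simp: r_def field_simps)
  define Z where "Z x = (\<lambda>n\<in>X. q n (\<xi> (m n) x))" for x
  define i where "i y x = (if Z x = y then 1 else 0 :: real)" for y x
  note bsb = bsb[OF mq]
  have gL: "in_Lp p g" using V_Lp[OF g] .
  have [measurable]: "g \<in> borel_measurable unitM" using V_measurable[OF g] .
  have finY: "finite Y" unfolding Y_def using X(1) by (intro finite_PiE) auto
  have ZY: "Z x \<in> Y" for x unfolding Z_def Y_def using X block_subset[OF bsb] by auto
  have i_prod: "(\<Prod>n\<in>X. if q n (\<xi> (m n) x) = y n then 1 else 0) = i y x" if "y \<in> Y" for x y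
  proof (cases "\<forall>n\<in>X. q n (\<xi> (m n) x) = y n")
    case True
    then have "Z x = y" using that by (intro ext) (auto simp: Y_def Z_def PiE_def extensional_def restrict_def)
    then show ?thesis using True by (simp add: i_def)
  next
    case False
    then have "(\<Prod>n\<in>X. if q n (\<xi> (m n) x) = y n then 1 else 0) = (0::real)" using X(1) by auto
    moreover have "Z x \<noteq> y" using False by (auto simp: Z_def)
    ultimately show ?thesis by (simp add: i_def)
  qed
  have im [measurable]: "i y \<in> borel_measurable unitM" if "y \<in> Y" for y
  proof -
    have "(\<lambda>x. \<Prod>n\<in>X. if q n (\<xi> (m n) x) = y n then 1 else 0 :: real) \<in> borel_measurable unitM"
      using X by (intro borel_measurable_prod block_measurable[OF bsb, of _ "\<lambda>z. if z = y _ then 1 else 0"]) auto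
    then show ?thesis using i_prod[OF that] by simp
  qed
  have ipow: "\<bar>i y x\<bar> powr s = i y x" "\<bar>i y x\<bar> \<le> 1" for y x s by (auto simp: i_def)
  have imean: "(\<integral>x. i y x \<partial>unitM) = 1 / 2 ^ N" if "y \<in> Y" for y
    using block_law[OF bsb X, of "\<lambda>z. if z = y then 1 else 0"] that finY
    by (simp add: i_def Z_def Y_def N_def)
  define G where "G y = (\<integral>x. \<bar>g x\<bar> powr p * i y x \<partial>unitM)" for y
  have gi: "\<bar>g x * i y x\<bar> powr p = \<bar>g x\<bar> powr p * i y x" for x y by (simp add: i_def)
  define c where "c y = 2 ^ N * pairing g (i y)" for y
  have giL: "in_Lp p (\<lambda>x. g x * i y x)" if "y \<in> Y" for y
    using p_gt1 gL im[OF that] ipow(2) by (intro in_Lp_mult_bounded) auto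
  have Gint: "integrable unitM (\<lambda>x. \<bar>g x\<bar> powr p * i y x)" if "y \<in> Y" for y
    using in_Lp_integrable_powr[OF giL[OF that]] by (simp add: gi)
  \<comment> \<open>The powers of \<open>2 ^ N\<close> cancel: \<open>p\<close> from the
    normalization of \<open>c y\<close> against \<open>p - 1\<close> from the norm of the indicator
    and 1 from the probability of the atom.\<close>
  have cG: "\<bar>c y\<bar> powr p / 2 ^ N \<le> G y" if y: "y \<in> Y" for y
  proof -
    have "pairing g (i y) = pairing (\<lambda>x. g x * i y x) (i y)"
      by (intro Bochner_Integration.integral_cong) (auto simp: i_def)
    then have "\<bar>pairing g (i y)\<bar> \<le> Lp_norm p (\<lambda>x. g x * i y x) * Lp_norm r (i y)"
      using Holder_bounded[OF p_gt1 r(1,2) giL[OF y] im[OF y] ipow(2)] by simp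
    then have "\<bar>pairing g (i y)\<bar> powr p \<le> (Lp_norm p (\<lambda>x. g x * i y x) * Lp_norm r (i y)) powr p"
      using p_gt1 by (intro powr_mono2) auto
    also have "\<dots> = G y * Lp_norm r (i y) powr p"
      using p_gt1 by (simp add: powr_mult Lp_norm_powr gi G_def Lp_norm_nonneg)
    also have "Lp_norm r (i y) powr p = (1 / 2 ^ N) powr (p - 1)"
      unfolding Lp_norm_def ipow imean[OF y] using r(3) by (simp add: powr_powr)
    finally have "\<bar>pairing g (i y)\<bar> powr p \<le> G y * (1 / 2 ^ N) powr (p - 1)" .
    then have "(2 ^ N) powr p * \<bar>pairing g (i y)\<bar> powr p / 2 ^ N \<le> (2 ^ N) powr p * (G y * (1 / 2 ^ N) powr (p - 1)) / 2 ^ N"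
      by (intro divide_right_mono mult_left_mono) auto
    also have "\<dots> = G y"
    proof -
      have "(2 ^ N) powr p * (1 / 2 ^ N) powr (p - 1) = (2 ^ N :: real)"
        by (simp add: powr_divide powr_diff)
      then show ?thesis by (simp add: field_simps)
    qed
    finally show ?thesis by (simp add: c_def abs_mult powr_mult)
  qed
  have cavg: "c y = (\<Sum>j\<in>pair_index X. pairing g (b m q j) * walsh (snd j) (y (fst j)))" if y: "y \<in> Y" for y
  proof -
    have "c y = (\<Sum>n\<in>X. \<Sum>F\<in>Pow {..<n} - {{}}. pairing g (b m q (n, F)) * walsh F (y n))"
      using conditional_average[OF mq X _ g, of y] y i_prod[OF y] by (simp add: c_def Y_def N_def)
    also have "\<dots> = (\<Sum>j\<in>pair_index X. pairing g (b m q j) * walsh (snd j) (y (fst j)))"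
      unfolding pair_index_def using X(1) by (subst sum.Sigma) (auto intro!: sum.cong)
    finally show ?thesis .
  qed
  have "(\<integral>x. \<bar>\<Sum>j\<in>pair_index X. pairing g (b m q j) * w j x\<bar> powr p \<partial>unitM) = (\<Sum>y\<in>Y. \<bar>c y\<bar> powr p) / 2 ^ N"
  proof -
    define \<Phi> where "\<Phi> y = \<bar>\<Sum>j\<in>pair_index X. pairing g (b m q j) * walsh (snd j) (y (fst j))\<bar> powr p" for y :: "nat \<Rightarrow> nat set"
    have "\<Phi> (\<lambda>n\<in>X. \<xi> n x) = \<bar>\<Sum>j\<in>pair_index X. pairing g (b m q j) * w j x\<bar> powr p" for x
      unfolding \<Phi>_def block_walsh_def[of \<xi>]
      by (intro arg_cong[where f="\<lambda>z. \<bar>z\<bar> powr p"] sum.cong) (auto simp: pair_index_def)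
    then have "(\<integral>x. \<bar>\<Sum>j\<in>pair_index X. pairing g (b m q j) * w j x\<bar> powr p \<partial>unitM) = (\<Sum>y\<in>Y. \<Phi> y) / 2 ^ N"
      using block_law[OF bs X, of \<Phi>] by (simp add: Y_def N_def)
    also have "(\<Sum>y\<in>Y. \<Phi> y) = (\<Sum>y\<in>Y. \<bar>c y\<bar> powr p)"
      by (intro sum.cong refl) (simp add: \<Phi>_def cavg)
    finally show ?thesis .
  qed
  also have "\<dots> \<le> (\<Sum>y\<in>Y. G y)"
    unfolding sum_divide_distrib by (intro sum_mono cG)
  also have "\<dots> = (\<integral>x. (\<Sum>y\<in>Y. \<bar>g x\<bar> powr p * i y x) \<partial>unitM)"
    unfolding G_def using Gint by (intro Bochner_Integration.integral_sum[symmetric])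
  also have "\<dots> = (\<integral>x. \<bar>g x\<bar> powr p \<partial>unitM)"
  proof -
    have "(\<Sum>y\<in>Y. i y x) = 1" for x unfolding i_def using finY ZY[of x] by (simp add: sum.delta')
    then show ?thesis by (simp add: sum_distrib_left[symmetric])
  qed
  also have "\<dots> = Lp_norm p g powr p" using p_gt1 by (simp add: Lp_norm_powr)
  finally show ?thesis using p_gt1 Lp_norm_nonneg by (subst Lp_norm_le_iff) auto
qed

lemma pairing_walsh_sum:
  assumes K: "finite K" "K \<subseteq> walsh_index" and j: "j \<in> walsh_index"
  shows "pairing (\<lambda>x. \<Sum>k\<in>K. a k * w k x) (w j) = (if j \<in> K then a j else 0)"
proof -
  have "pairing (\<lambda>x. \<Sum>k\<in>K. a k * w k x) (w j) = (\<Sum>k\<in>K. a k * pairing (w k) (w j))"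
    by (rule pairing_sum_left[OF _ w_measurable[OF j], of _ _ 1]) (use K walsh_in_V in auto)
  also have "\<dots> = (\<Sum>k\<in>K. if k = j then a k else 0)"
    by (intro sum.cong refl) (use block_walsh_orthonormal[OF bs _ j] K in auto)
  finally show ?thesis using K(1) by simp
qed

lemma walsh_sum_in_V: "K \<subseteq> walsh_index \<Longrightarrow> (\<lambda>x. \<Sum>k\<in>K. a k * w k x) \<in> V"
  using walsh_in_V by (intro sum_in_V) auto

text \<open>An element of \<open>V\<close> is only a limit of Walsh sums, so the triangle inequality
  does not apply to it directly. Projecting onto the finitely many blocks of an approximating sum is
  contractive, fixes that sum, and turns \<open>g\<close> into a finite Walsh sum with coefficients
  taken from \<open>g\<close>.\<close>

lemma norm_le_sum_coefficients:
  assumes g: "g \<in> V" and D: "\<And>K. finite K \<Longrightarrow> K \<subseteq> walsh_index \<Longrightarrow> (\<Sum>k\<in>K. \<bar>pairing g (w k)\<bar>) \<le> D"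
  shows "Lp_norm p g \<le> D"
proof (rule field_le_epsilon)
  fix e :: real assume e: "0 < e"
  obtain K a where K: "finite K" "K \<subseteq> walsh_index" "Lp_norm p (\<lambda>x. g x - (\<Sum>k\<in>K. a k * w k x)) < e / 2"
    using walsh_dense[OF g, of "e / 2"] e by auto
  define h where "h x = (\<Sum>k\<in>K. a k * w k x)" for x
  have hV: "h \<in> V" unfolding h_def using walsh_sum_in_V[OF K(2)] .
  define X where "X = fst ` K"
  have X: "finite X" "X \<subseteq> {1..}" using K by (auto simp: X_def walsh_index_def)
  define L where "L = pair_index X"
  have L: "finite L" "L \<subseteq> walsh_index" unfolding L_def using X finite_pair_index pair_index_subset by auto
  have KL: "K \<subseteq> L" using K(2) by (force simp: L_def pair_index_def X_def walsh_index_def)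
  define P where "P f x = (\<Sum>j\<in>L. pairing f (w j) * w j x)" for f x
  have PV: "P f \<in> V" for f unfolding P_def using walsh_sum_in_V[OF L(2)] .
  \<comment> \<open>The projection onto finitely many blocks is the conditional expectation for the
    identity embedding; the intersection with \<open>{..<n}\<close> confines the values for
    arbitrary arguments, as a uniform map demands.\<close>
  have idmap: "block_map (\<lambda>n. n) (\<lambda>n x. x \<inter> {..<n})"
    unfolding block_map_def uniform_map_def
  proof (intro conjI allI impI)
    fix n :: nat and F assume "F \<subseteq> {..<n}" "F \<noteq> {}"
    moreover have "(\<Sum>x\<in>Pow {..<n}. walsh F (x \<inter> {..<n})) = (\<Sum>x\<in>Pow {..<n}. walsh F x)"
      by (intro sum.cong refl) (auto simp: Int_absorb2)
    ultimately show "(\<Sum>x\<in>Pow {..<n}. walsh F (x \<inter> {..<n})) = 0" by (simp add: sum_walsh)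
  qed auto
  have bw: "b (\<lambda>n. n) (\<lambda>n x. x \<inter> {..<n}) j = w j" if "j \<in> walsh_index" for j
    using that block_subset[OF bs] by (auto simp: block_walsh_def walsh_index_def Int_absorb2)
  have contr: "Lp_norm p (P f) \<le> Lp_norm p f" if "f \<in> V" for f
  proof -
    have "P f = (\<lambda>x. \<Sum>j\<in>pair_index X. pairing f (b (\<lambda>n. n) (\<lambda>n x. x \<inter> {..<n}) j) * w j x)"
      unfolding P_def L_def by (intro ext sum.cong refl) (use bw pair_index_subset[OF X(2)] in auto)
    then show ?thesis using block_projection_contractive[OF idmap X that] by simp
  qed
  have Ph: "P h x = h x" for x
  proof -
    have "P h x = (\<Sum>j\<in>L. if j \<in> K then a j * w j x else 0)"
      unfolding P_def by (intro sum.cong refl) (use pairing_walsh_sum[OF K(1,2)] L in \<open>auto simp: h_def[abs_def]\<close>)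
    also have "\<dots> = h x" using L(1) KL by (simp add: h_def sum.If_cases Int_absorb1)
    finally show ?thesis .
  qed
  have "P (\<lambda>x. h x - g x) x = h x - P g x" for x
  proof -
    have "P (\<lambda>x. h x - g x) x = P h x - P g x"
      unfolding P_def sum_subtractf[symmetric]
    proof (intro sum.cong refl)
      fix j assume "j \<in> L"
      then have "j \<in> walsh_index" using L by auto
      then have "pairing (\<lambda>x. h x - g x) (w j) = pairing h (w j) - pairing g (w j)"
        by (intro pairing_diff_left[OF hV g w_measurable, of _ 1]) auto
      then show "pairing (\<lambda>x. h x - g x) (w j) * w j x = pairing h (w j) * w j x - pairing g (w j) * w j x"
        by (simp add: left_diff_distrib)
    qed
    then show ?thesis by (simp add: Ph)
  qed
  then have "P (\<lambda>x. h x - g x) = (\<lambda>x. h x - P g x)" by (rule ext)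
  then have 1: "Lp_norm p (\<lambda>x. h x - P g x) \<le> Lp_norm p (\<lambda>x. h x - g x)"
    using contr[OF diff_in_V[OF hV g]] by simp
  have "Lp_norm p (P g) \<le> (\<Sum>j\<in>L. \<bar>pairing g (w j)\<bar> * Lp_norm p (w j))"
    unfolding P_def using L w_Lp by (intro Lp_norm_sum_le p_ge1) auto
  also have "\<dots> \<le> (\<Sum>j\<in>L. \<bar>pairing g (w j)\<bar> * 1)"
    using L w_norm[of p] p_gt1 by (intro sum_mono mult_left_mono) auto
  also have "\<dots> \<le> D" using D[OF L] by simp
  finally have 2: "Lp_norm p (P g) \<le> D" .
  have "Lp_norm p (\<lambda>x. (g x - P g x) + P g x) \<le> Lp_norm p (\<lambda>x. g x - P g x) + Lp_norm p (P g)"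
    using g PV by (intro Lp_norm_triangle p_ge1 V_Lp diff_in_V)
  moreover have "Lp_norm p (\<lambda>x. g x - P g x) \<le> Lp_norm p (\<lambda>x. g x - h x) + Lp_norm p (\<lambda>x. h x - P g x)"
    using g PV hV by (intro Lp_norm_triangle_via p_ge1 V_Lp)
  ultimately show "Lp_norm p g \<le> D + e"
    using 1 2 K(3) by (simp add: h_def[abs_def] Lp_norm_minus_commute[of p "\<lambda>x. \<Sum>k\<in>K. a k * w k x"])
qed

lemma walsh_embedding:
  assumes mq: "block_map m q"
  shows "\<exists>B. bounded_op_on p V B \<and> (\<forall>f\<in>V. Lp_norm p (B f) \<le> 1 * Lp_norm p f) \<and>
    (\<forall>k\<in>walsh_index. AE x in unitM. B (w k) x = b m q k x)"
proof (rule extend_operator)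
  show "Lp_norm p (\<lambda>x. \<Sum>k\<in>K. a k * b m q k x) \<le> 1 * Lp_norm p (\<lambda>x. \<Sum>k\<in>K. a k * w k x)"
    if "finite K" "K \<subseteq> walsh_index" for K a
    using block_norm_eq[OF bsb[OF mq] bs that, of p a] by simp
qed (use walsh_in_V b_in_V[OF mq] walsh_dense in auto)

text \<open>\<open>A\<close> is the adjoint of the embedding for the pairing with Walsh functions:
  conditional expectation onto the copies, followed by the inverse embedding. On \<open>w k\<close>
  only the copy placed in block \<open>fst k\<close> contributes, if there is one, so its image is a
  finite Walsh sum.\<close>

lemma walsh_coembedding:
  assumes mq: "block_map m q"
  shows "\<exists>A. bounded_op_on p V A \<and> (\<forall>f\<in>V. Lp_norm p (A f) \<le> 1 * Lp_norm p f) \<and>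
    (\<forall>g\<in>V. \<forall>j\<in>walsh_index. pairing (A g) (w j) = pairing g (b m q j))"
proof -
  define J where "J k = {j \<in> walsh_index. m (fst j) = fst k}" for k :: "nat \<times> nat set"
  define u where "u k x = (\<Sum>j\<in>J k. pairing (w k) (b m q j) * w j x)" for k x
  have finX: "finite {n. 1 \<le> n \<and> m n \<in> Y}" if "finite Y" for Y
  proof (rule inj_on_finite[where f=m and B=Y])
    show "inj_on m {n. 1 \<le> n \<and> m n \<in> Y}" using mq by (auto simp: block_map_def intro: inj_on_subset)
  qed (use that in auto)
  have JX: "J k \<subseteq> pair_index {n. 1 \<le> n \<and> m n \<in> Y}" if "fst k \<in> Y" for k Y
    using that by (auto simp: J_def pair_index_def walsh_index_def)
  have finJ: "finite (J k)" for k
    using finite_subset[OF JX[of k "{fst k}"] finite_pair_index[OF finX]] by simp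
  have JI: "J k \<subseteq> walsh_index" for k by (auto simp: J_def)
  have uV: "u k \<in> V" for k unfolding u_def using walsh_sum_in_V[OF JI] .
  have bound: "Lp_norm p (\<lambda>x. \<Sum>k\<in>K. a k * u k x) \<le> 1 * Lp_norm p (\<lambda>x. \<Sum>k\<in>K. a k * w k x)"
    if K: "finite K" "K \<subseteq> walsh_index" for K a
  proof -
    define X where "X = {n. 1 \<le> n \<and> m n \<in> fst ` K}"
    have X: "finite X" "X \<subseteq> {1..}" using finX[of "fst ` K"] K by (auto simp: X_def)
    have L: "finite (pair_index X)" "pair_index X \<subseteq> walsh_index" using X finite_pair_index pair_index_subset by auto
    have uL: "u k x = (\<Sum>j\<in>pair_index X. pairing (w k) (b m q j) * w j x)" if "k \<in> K" for k x
      unfolding u_def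
    proof (rule sum.mono_neutral_left[OF L(1)])
      show "J k \<subseteq> pair_index X" unfolding X_def using that by (intro JX) auto
      show "\<forall>j\<in>pair_index X - J k. pairing (w k) (b m q j) * w j x = 0"
      proof
        fix j assume j: "j \<in> pair_index X - J k"
        then have "j \<in> walsh_index" "m (fst j) \<noteq> fst k" using L(2) by (auto simp: J_def)
        moreover have "k \<in> walsh_index" using \<open>k \<in> K\<close> K(2) by auto
        ultimately show "pairing (w k) (b m q j) * w j x = 0" using pairing_w_b_zero[OF mq] by simp
      qed
    qed
    have "(\<Sum>k\<in>K. a k * u k x) = (\<Sum>j\<in>pair_index X. pairing (\<lambda>x. \<Sum>k\<in>K. a k * w k x) (b m q j) * w j x)" for x
    proof -
      have "(\<Sum>k\<in>K. a k * u k x) = (\<Sum>k\<in>K. \<Sum>j\<in>pair_index X. a k * pairing (w k) (b m q j) * w j x)"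
        by (intro sum.cong refl) (simp add: uL sum_distrib_left mult.assoc)
      also have "\<dots> = (\<Sum>j\<in>pair_index X. (\<Sum>k\<in>K. a k * pairing (w k) (b m q j)) * w j x)"
        by (subst sum.swap) (simp add: sum_distrib_right)
      also have "\<dots> = (\<Sum>j\<in>pair_index X. pairing (\<lambda>x. \<Sum>k\<in>K. a k * w k x) (b m q j) * w j x)"
      proof (intro sum.cong refl)
        fix j assume "j \<in> pair_index X"
        then have "b m q j \<in> borel_measurable unitM" using L(2) by (intro b_measurable[OF mq]) auto
        then have "pairing (\<lambda>x. \<Sum>k\<in>K. a k * w k x) (b m q j) = (\<Sum>k\<in>K. a k * pairing (w k) (b m q j))"
          by (intro pairing_sum_left[of _ _ _ 1]) (use K(2) walsh_in_V in auto)
        then show "(\<Sum>k\<in>K. a k * pairing (w k) (b m q j)) * w j x = pairing (\<lambda>x. \<Sum>k\<in>K. a k * w k x) (b m q j) * w j x" by simp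
      qed
      finally show ?thesis .
    qed
    then show ?thesis using block_projection_contractive[OF mq X walsh_sum_in_V[OF K(2)], of a] by simp
  qed
  obtain A where A: "bounded_op_on p V A" "\<And>f. f \<in> V \<Longrightarrow> Lp_norm p (A f) \<le> 1 * Lp_norm p f"
    and Aw: "\<And>k. k \<in> walsh_index \<Longrightarrow> AE x in unitM. A (w k) x = u k x"
    using extend_operator[of walsh_index w u 1, OF walsh_in_V uV _ bound walsh_dense] by auto
  have "pairing (A g) (w j) = pairing g (b m q j)" if g: "g \<in> V" and j: "j \<in> walsh_index" for g j
  proof -
    have base: "pairing (A (w k)) (w j) = pairing (w k) (b m q j)" if k: "k \<in> walsh_index" for k
    proof -
      have "pairing (A (w k)) (w j) = pairing (u k) (w j)"
        using Aw[OF k] V_measurable[OF op_in_V[OF A(1) walsh_in_V[OF k]]] V_measurable[OF uV] w_measurable[OF j]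
        by (intro integral_cong_AE) auto
      also have "\<dots> = (if j \<in> J k then pairing (w k) (b m q j) else 0)"
        unfolding u_def by (rule pairing_walsh_sum[OF finJ JI j])
      also have "\<dots> = pairing (w k) (b m q j)" using pairing_w_b_zero[OF mq k j] j by (auto simp: J_def)
      finally show ?thesis .
    qed
    note wj = w_measurable[OF j] and bj = b_measurable[OF mq j]
    have "\<bar>pairing (A g) (w j) - pairing g (b m q j)\<bar> \<le> 0 + e" if e: "0 < e" for e
    proof -
      obtain K a where K: "finite K" "K \<subseteq> walsh_index" "Lp_norm p (\<lambda>x. g x - (\<Sum>k\<in>K. a k * w k x)) < e / 2"
        using walsh_dense[OF g, of "e / 2"] e by auto
      define h where "h x = (\<Sum>k\<in>K. a k * w k x)" for x
      have hV: "h \<in> V" unfolding h_def using walsh_sum_in_V[OF K(2)] .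
      have AV: "A f \<in> V" if "f \<in> V" for f using op_in_V[OF A(1) that] .
      have "AE x in unitM. A h x = (\<Sum>k\<in>K. a k * A (w k) x)"
        unfolding h_def by (rule op_sum[OF A(1) K(1)]) (use K walsh_in_V in auto)
      moreover have "(\<lambda>x. \<Sum>k\<in>K. a k * A (w k) x) \<in> borel_measurable unitM"
        using K(2) by (intro V_measurable sum_in_V AV walsh_in_V) auto
      ultimately have "pairing (A h) (w j) = pairing (\<lambda>x. \<Sum>k\<in>K. a k * A (w k) x) (w j)"
        using V_measurable[OF AV[OF hV]] wj by (intro integral_cong_AE) auto
      also have "\<dots> = (\<Sum>k\<in>K. a k * pairing (A (w k)) (w j))"
        by (rule pairing_sum_left[OF _ wj, of _ _ 1]) (use AV walsh_in_V K(2) in auto)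
      also have "\<dots> = (\<Sum>k\<in>K. a k * pairing (w k) (b m q j))"
        using base K(2) by (intro sum.cong) auto
      also have "\<dots> = pairing h (b m q j)"
        unfolding h_def by (rule pairing_sum_left[OF _ bj, of _ _ 1, symmetric]) (use walsh_in_V K(2) in auto)
      finally have h: "pairing (A h) (w j) = pairing h (b m q j)" .
      have d: "(\<lambda>x. g x - h x) \<in> V" using diff_in_V[OF g hV] .
      have "pairing (A (\<lambda>x. g x - h x)) (w j) = pairing (\<lambda>x. A g x - A h x) (w j)"
        using op_diff[OF A(1) g hV] V_measurable[OF AV[OF d]] V_measurable[OF diff_in_V[OF AV[OF g] AV[OF hV]]] wj
        by (intro integral_cong_AE) auto
      also have "\<dots> = pairing (A g) (w j) - pairing (A h) (w j)"
        by (rule pairing_diff_left[OF AV[OF g] AV[OF hV] wj, of 1]) simp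
      finally have 1: "pairing (A g) (w j) - pairing (A h) (w j) = pairing (A (\<lambda>x. g x - h x)) (w j)" ..
      have 2: "pairing g (b m q j) - pairing h (b m q j) = pairing (\<lambda>x. g x - h x) (b m q j)"
        by (rule pairing_diff_left[OF g hV bj, of 1, symmetric]) simp
      have "\<bar>pairing (A (\<lambda>x. g x - h x)) (w j)\<bar> \<le> Lp_norm p (A (\<lambda>x. g x - h x))"
        by (rule abs_pairing_w_le[OF AV[OF d] j])
      also have "\<dots> \<le> e / 2" using A(2)[OF d] K(3) by (simp add: h_def)
      finally have 3: "\<bar>pairing (A (\<lambda>x. g x - h x)) (w j)\<bar> \<le> e / 2" .
      have "\<bar>pairing (\<lambda>x. g x - h x) (b m q j)\<bar> \<le> Lp_norm p (\<lambda>x. g x - h x)"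
        by (rule abs_integral_mult_bounded_le[OF p_ge1 V_Lp[OF d] bj]) simp
      also have "\<dots> \<le> e / 2" using K(3) by (simp add: h_def)
      finally show ?thesis using 1 2 3 h by linarith
    qed
    then have "\<bar>pairing (A g) (w j) - pairing g (b m q j)\<bar> \<le> 0" by (rule field_le_epsilon)
    then show ?thesis by simp
  qed
  then show ?thesis using A by blast
qed

end

section \<open>Factorization\<close>

text \<open>Every frequency in the Walsh expansion of a multiplexed nonconstant Walsh function is
  nonempty and lies inside the block, so each term has mean zero.\<close>

lemma uniform_map_multiplexer:
  assumes inj: "inj_on \<phi> (mux_coords l n)" and sub: "\<phi> ` mux_coords l n \<subseteq> {..<m}"
  shows "uniform_map m n (multiplexer l n \<phi>)"
  unfolding uniform_map_def
proof (intro conjI allI impI)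
  show "multiplexer l n \<phi> x \<subseteq> {..<n}" for x by (auto simp: multiplexer_def)
  fix F assume F: "F \<subseteq> {..<n}" "F \<noteq> {}"
  let ?\<Theta> = "Pow {..<l} \<times> Pow {..<l}"
  have "(\<Sum>x\<in>Pow {..<m}. walsh F (multiplexer l n \<phi> x))
      = (\<Sum>\<theta>\<in>?\<Theta>. \<Sum>x\<in>Pow {..<m}. walsh (snd \<theta>) (fst \<theta>) / 2 ^ l * walsh (\<phi> ` mux_freq F \<theta>) x)"
    unfolding walsh_multiplexer[OF inj F(1)] case_prod_beta by (subst sum.swap) simp
  also have "\<dots> = (\<Sum>\<theta>\<in>?\<Theta>. walsh (snd \<theta>) (fst \<theta>) / 2 ^ l * (\<Sum>x\<in>Pow {..<m}. walsh (\<phi> ` mux_freq F \<theta>) x))"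
    by (simp only: sum_distrib_left)
  also have "\<dots> = 0"
  proof (rule sum.neutral, rule ballI)
    fix \<theta> assume "\<theta> \<in> ?\<Theta>"
    then have "\<phi> ` mux_freq F \<theta> \<subseteq> {..<m}" using mux_freq_subset[OF F(1), of \<theta> l] sub by auto
    then have "(\<Sum>x\<in>Pow {..<m}. walsh (\<phi> ` mux_freq F \<theta>) x) = 0"
      using mux_freq_nonempty[OF F(2)] by (intro sum_walsh) auto
    then show "walsh (snd \<theta>) (fst \<theta>) / 2 ^ l * (\<Sum>x\<in>Pow {..<m}. walsh (\<phi> ` mux_freq F \<theta>) x) = 0" by simp
  qed
  finally show "(\<Sum>x\<in>Pow {..<m}. walsh F (multiplexer l n \<phi> x)) = 0" .
qed

context walsh_span
begin

lemma pairing_op_sum: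
  assumes T: "bounded_op_on p V T" and K: "finite K" and f: "\<And>k. k \<in> K \<Longrightarrow> f k \<in> V"
    and \<beta>: "\<beta> \<in> borel_measurable unitM" "\<And>x. \<bar>\<beta> x\<bar> \<le> 1"
  shows "pairing (T (\<lambda>x. \<Sum>k\<in>K. a k * f k x)) \<beta> = (\<Sum>k\<in>K. a k * pairing (T (f k)) \<beta>)"
proof -
  have TV: "T (f k) \<in> V" if "k \<in> K" for k using op_in_V[OF T f[OF that]] .
  have "AE x in unitM. T (\<lambda>x. \<Sum>k\<in>K. a k * f k x) x = (\<Sum>k\<in>K. a k * T (f k) x)"
    by (rule op_sum[OF T K f])
  moreover have "T (\<lambda>x. \<Sum>k\<in>K. a k * f k x) \<in> borel_measurable unitM"
    using f by (intro V_measurable op_in_V[OF T] sum_in_V)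
  moreover have "(\<lambda>x. \<Sum>k\<in>K. a k * T (f k) x) \<in> borel_measurable unitM"
    using TV by (intro V_measurable sum_in_V)
  ultimately have "pairing (T (\<lambda>x. \<Sum>k\<in>K. a k * f k x)) \<beta> = pairing (\<lambda>x. \<Sum>k\<in>K. a k * T (f k) x) \<beta>"
    using \<beta>(1) by (intro integral_cong_AE) auto
  also have "\<dots> = (\<Sum>k\<in>K. a k * pairing (T (f k)) \<beta>)" by (rule pairing_sum_left[OF TV \<beta>])
  finally show ?thesis .
qed

text \<open>The coefficients of a finite Walsh sum \<open>h\<close> are at most its norm, so those
  of \<open>Y h - c * h\<close> add up to at most this norm times the total entry error, which the
  weights limit to 1/4. The sum of the coefficients controls the norm of the difference, and density
  extends the estimate to \<open>V\<close>.\<close>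

lemma near_scalar:
  assumes T: "bounded_op_on p V T" and mq: "block_map m q"
    and A: "bounded_op_on p V A" "\<And>g j. g \<in> V \<Longrightarrow> j \<in> walsh_index \<Longrightarrow> pairing (A g) (w j) = pairing g (b m q j)"
    and B: "bounded_op_on p V B" "\<And>k. k \<in> walsh_index \<Longrightarrow> AE x in unitM. B (w k) x = b m q k x"
    and e: "\<And>i j. i \<in> walsh_index \<Longrightarrow> j \<in> walsh_index \<Longrightarrow>
        \<bar>pairing (T (b m q i)) (b m q j) - (if i = j then c else 0)\<bar> \<le> weight (fst i) * weight (fst j)"
    and f: "f \<in> V"
  shows "Lp_norm p (\<lambda>x. A (T (B f)) x - c * f x) \<le> 1 / 4 * Lp_norm p f"
proof -
  define Y where "Y f = A (T (B f))" for f
  have Y: "bounded_op_on p V Y" unfolding Y_def using op_compose[OF A(1) op_compose[OF T B(1)]] .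
  have YV: "Y f \<in> V" if "f \<in> V" for f using op_in_V[OF Y that] .
  have comb: "Lp_norm p (\<lambda>x. Y h x - c * h x) \<le> 1 / 4 * Lp_norm p h"
    if K: "finite K" "K \<subseteq> walsh_index" and h: "h = (\<lambda>x. \<Sum>k\<in>K. a k * w k x)" for K a h
  proof (rule norm_le_sum_coefficients)
    have hV: "h \<in> V" unfolding h using walsh_sum_in_V[OF K(2)] .
    show "(\<lambda>x. Y h x - c * h x) \<in> V" by (intro diff_in_V YV cmult_in_V hV)
    have ak: "\<bar>a k\<bar> \<le> Lp_norm p h" if "k \<in> K" for k
      using abs_pairing_w_le[OF hV, of k] pairing_walsh_sum[OF K, of k a] that K(2) by (auto simp: h)
    have coef: "pairing (\<lambda>x. Y h x - c * h x) (w j)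
        = (\<Sum>k\<in>K. a k * (pairing (T (b m q k)) (b m q j) - (if k = j then c else 0)))" if j: "j \<in> walsh_index" for j
    proof -
      note wj = w_measurable[OF j] and bj = b_measurable[OF mq j]
      have "pairing (\<lambda>x. Y h x - c * h x) (w j) = pairing (Y h) (w j) - pairing (\<lambda>x. c * h x) (w j)"
        by (rule pairing_diff_left[OF YV[OF hV] cmult_in_V[OF hV] wj, of 1]) simp
      also have "pairing (\<lambda>x. c * h x) (w j) = c * pairing h (w j)" by (simp add: mult.assoc)
      also have "pairing h (w j) = (if j \<in> K then a j else 0)" unfolding h by (rule pairing_walsh_sum[OF K j])
      also have "pairing (Y h) (w j) = pairing (T (B h)) (b m q j)"
        unfolding Y_def by (rule A(2)[OF op_in_V[OF T op_in_V[OF B(1) hV]] j])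
      also have "\<dots> = (\<Sum>k\<in>K. a k * pairing (T (B (w k))) (b m q j))"
        unfolding h by (rule pairing_op_sum[OF op_compose[OF T B(1)] K(1) _ bj]) (use K walsh_in_V in auto)
      also have "\<dots> = (\<Sum>k\<in>K. a k * pairing (T (b m q k)) (b m q j))"
      proof (intro sum.cong refl arg_cong2[where f="(*)"])
        fix k assume "k \<in> K"
        then have k: "k \<in> walsh_index" using K by auto
        have Bk: "B (w k) \<in> V" "b m q k \<in> V" using op_in_V[OF B(1) walsh_in_V[OF k]] b_in_V[OF mq k] by auto
        have "AE x in unitM. T (B (w k)) x = T (b m q k) x" by (rule op_cong[OF T Bk B(2)[OF k]])
        then show "pairing (T (B (w k))) (b m q j) = pairing (T (b m q k)) (b m q j)"
          using V_measurable[OF op_in_V[OF T Bk(1)]] V_measurable[OF op_in_V[OF T Bk(2)]] bj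
          by (intro integral_cong_AE) auto
      qed
      finally have "pairing (\<lambda>x. Y h x - c * h x) (w j) = (\<Sum>k\<in>K. a k * pairing (T (b m q k)) (b m q j)) - c * (if j \<in> K then a j else 0)" .
      moreover have "c * (if j \<in> K then a j else 0) = (\<Sum>k\<in>K. a k * (if k = j then c else 0))"
        using K(1) by (simp add: if_distrib[of "(*) _"] cong: if_cong)
      ultimately show ?thesis by (simp add: sum_subtractf right_diff_distrib)
    qed
    show "(\<Sum>j\<in>L. \<bar>pairing (\<lambda>x. Y h x - c * h x) (w j)\<bar>) \<le> 1 / 4 * Lp_norm p h" if L: "finite L" "L \<subseteq> walsh_index" for L
    proof -
      have "(\<Sum>j\<in>L. \<bar>pairing (\<lambda>x. Y h x - c * h x) (w j)\<bar>) \<le> (\<Sum>j\<in>L. \<Sum>k\<in>K. Lp_norm p h * (weight (fst k) * weight (fst j)))"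
      proof (intro sum_mono)
        fix j assume "j \<in> L"
        then have j: "j \<in> walsh_index" using L by auto
        have "\<bar>pairing (\<lambda>x. Y h x - c * h x) (w j)\<bar> \<le> (\<Sum>k\<in>K. \<bar>a k\<bar> * \<bar>pairing (T (b m q k)) (b m q j) - (if k = j then c else 0)\<bar>)"
          unfolding coef[OF j] by (rule order_trans[OF sum_abs]) (simp add: abs_mult)
        also have "\<dots> \<le> (\<Sum>k\<in>K. Lp_norm p h * (weight (fst k) * weight (fst j)))"
        proof (rule sum_mono)
          fix k assume k: "k \<in> K"
          then have "k \<in> walsh_index" using K(2) by auto
          from mult_mono[OF ak[OF k] e[OF this j] Lp_norm_nonneg abs_ge_zero]
          show "\<bar>a k\<bar> * \<bar>pairing (T (b m q k)) (b m q j) - (if k = j then c else 0)\<bar> \<le> Lp_norm p h * (weight (fst k) * weight (fst j))" .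
        qed
        finally show "\<bar>pairing (\<lambda>x. Y h x - c * h x) (w j)\<bar> \<le> (\<Sum>k\<in>K. Lp_norm p h * (weight (fst k) * weight (fst j)))" .
      qed
      also have "\<dots> = (\<Sum>k\<in>K. weight (fst k)) * (\<Sum>j\<in>L. weight (fst j)) * Lp_norm p h"
        unfolding sum_product sum_distrib_right by (subst sum.swap) (intro sum.cong refl, simp add: sum_distrib_left sum_distrib_right mult_ac)
      also have "\<dots> \<le> (1 / 2) * (1 / 2) * Lp_norm p h"
        using sum_weight_le[OF K] sum_weight_le[OF L] by (intro mult_right_mono mult_mono Lp_norm_nonneg sum_nonneg) (auto simp: weight_def)
      finally show ?thesis by simp
    qed
  qed
  obtain C where C: "0 \<le> C" "\<And>f. f \<in> V \<Longrightarrow> Lp_norm p (Y f) \<le> C * Lp_norm p f" using op_bound[OF Y] by blast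
  have "Lp_norm p (\<lambda>x. Y f x - c * f x) \<le> 1 / 4 * Lp_norm p f"
  proof (rule field_le_epsilon)
    fix e :: real assume e: "0 < e"
    \<comment> \<open>Replacing \<open>f\<close> by \<open>h\<close> costs \<open>d / 4\<close> in
      the bound for \<open>h\<close> and \<open>(C + \<bar>c\<bar>) * d\<close> for the remainder,
      together at most \<open>e\<close>.\<close>
    define d where "d = e / (1 + C + \<bar>c\<bar>)"
    have "d * (1 + C + \<bar>c\<bar>) = e" using C by (simp add: d_def)
    then have d: "0 < d" "(1 + C + \<bar>c\<bar>) * d = e" using e C by (auto simp: d_def algebra_simps add_pos_nonneg)
    obtain K a where K: "finite K" "K \<subseteq> walsh_index" "Lp_norm p (\<lambda>x. f x - (\<Sum>k\<in>K. a k * w k x)) < d"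
      using walsh_dense[OF f d(1)] by blast
    define h where "h = (\<lambda>x. \<Sum>k\<in>K. a k * w k x)"
    have hV: "h \<in> V" unfolding h_def using walsh_sum_in_V[OF K(2)] .
    define s where "s = (\<lambda>x. f x - h x)"
    have sV: "s \<in> V" unfolding s_def using diff_in_V[OF f hV] .
    have sd: "Lp_norm p s \<le> d" using K(3) by (simp add: s_def h_def)
    have "AE x in unitM. Y s x = Y f x - Y h x" unfolding s_def by (rule op_diff[OF Y f hV])
    then have "AE x in unitM. Y f x - c * f x = (Y h x - c * h x) + (Y s x - c * s x)"
      by eventually_elim (simp add: s_def algebra_simps)
    then have "Lp_norm p (\<lambda>x. Y f x - c * f x) = Lp_norm p (\<lambda>x. (Y h x - c * h x) + (Y s x - c * s x))"
      using f hV sV by (intro Lp_norm_cong_AE V_measurable diff_in_V add_in_V YV cmult_in_V)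
    also have "\<dots> \<le> Lp_norm p (\<lambda>x. Y h x - c * h x) + Lp_norm p (\<lambda>x. Y s x - c * s x)"
      using hV sV by (intro Lp_norm_triangle p_ge1 V_Lp diff_in_V YV cmult_in_V)
    also have "Lp_norm p (\<lambda>x. Y s x - c * s x) \<le> Lp_norm p (Y s) + Lp_norm p (\<lambda>x. c * s x)"
      using sV by (intro Lp_norm_triangle_diff p_ge1 V_Lp YV cmult_in_V)
    also have "\<dots> \<le> C * Lp_norm p s + \<bar>c\<bar> * Lp_norm p s"
      using C(2)[OF sV] p_gt1 by (simp add: Lp_norm_cmult)
    also have "\<dots> \<le> (C + \<bar>c\<bar>) * d"
      using sd C(1) by (simp add: distrib_right[symmetric] mult_left_mono)
    also have "Lp_norm p (\<lambda>x. Y h x - c * h x) \<le> 1 / 4 * Lp_norm p h" by (rule comb[OF K(1,2) h_def])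
    also have "Lp_norm p h \<le> Lp_norm p f + d"
    proof -
      have "Lp_norm p (\<lambda>x. f x - s x) \<le> Lp_norm p f + Lp_norm p s"
        using f sV by (intro Lp_norm_triangle_diff p_ge1 V_Lp)
      then show ?thesis using sd by (simp add: s_def)
    qed
    finally have "Lp_norm p (\<lambda>x. Y f x - c * f x) \<le> 1 / 4 * (Lp_norm p f + d) + (C + \<bar>c\<bar>) * d" by simp
    moreover have "d + (C + \<bar>c\<bar>) * d = e" using d(2) by (simp add: algebra_simps)
    moreover have "u \<le> 1 / 4 * v + e" if "u \<le> 1 / 4 * (v + d) + z" "d + z = e" for u v z :: real
    proof -
      have "1 / 4 * (v + d) + z = 1 / 4 * v + (1 / 4 * d + z)" by simp
      also have "\<dots> \<le> 1 / 4 * v + (d + z)" using d(1) by simp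
      finally show ?thesis using that by simp
    qed
    ultimately show "Lp_norm p (\<lambda>x. Y f x - c * f x) \<le> 1 / 4 * Lp_norm p f + e" by blast
  qed
  then show ?thesis by (simp add: Y_def)
qed

section \<open>Counting large matrix entries\<close>

text \<open>For fixed \<open>\<beta>\<close>, pairing \<open>T f\<close> with \<open>\<beta>\<close>
  is a functional of \<open>f\<close> bounded by \<open>C\<close> in L_p, so it exceeds
  \<open>\<delta>\<close> on boundedly many members of an orthogonal family.\<close>

lemma card_large_left:
  fixes f :: "'i \<Rightarrow> real \<Rightarrow> real"
  assumes T: "bounded_op_on p V T" and C: "0 \<le> C" "\<And>f. f \<in> V \<Longrightarrow> Lp_norm p (T f) \<le> C * Lp_norm p f"
    and X: "finite X" and f: "\<And>i. i \<in> X \<Longrightarrow> f i \<in> V" "\<And>i x. i \<in> X \<Longrightarrow> \<bar>f i x\<bar> \<le> 1"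
    and orth: "\<And>i j. i \<in> X \<Longrightarrow> j \<in> X \<Longrightarrow> i \<noteq> j \<Longrightarrow> pairing (f i) (f j) = 0"
    and \<beta>: "\<beta> \<in> borel_measurable unitM" "\<And>x. \<bar>\<beta> x\<bar> \<le> 1"
    and \<delta>: "0 < \<delta>" "\<And>i. i \<in> X \<Longrightarrow> \<delta> < \<bar>pairing (T (f i)) \<beta>\<bar>"
  shows "real (card X) \<le> (C / \<delta>) powr (2 * p)"
proof (rule orthogonal_card_bound[where \<phi>="\<lambda>i. pairing (T (f i)) \<beta>" and g=f])
  fix s :: "'i \<Rightarrow> real"
  have sV: "(\<lambda>x. \<Sum>i\<in>X. s i * f i x) \<in> V" using f(1) by (rule sum_in_V)
  have "\<bar>\<Sum>i\<in>X. s i * pairing (T (f i)) \<beta>\<bar> = \<bar>pairing (T (\<lambda>x. \<Sum>i\<in>X. s i * f i x)) \<beta>\<bar>"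
    by (subst pairing_op_sum[OF T X f(1) \<beta>]) auto
  also have "\<dots> \<le> Lp_norm p (T (\<lambda>x. \<Sum>i\<in>X. s i * f i x))"
    by (rule abs_integral_mult_bounded_le[OF p_ge1 V_Lp[OF op_in_V[OF T sV]] \<beta>])
  also have "\<dots> \<le> C * Lp_norm p (\<lambda>x. \<Sum>i\<in>X. s i * f i x)" by (rule C(2)[OF sV])
  finally show "\<bar>\<Sum>i\<in>X. s i * pairing (T (f i)) \<beta>\<bar> \<le> C * Lp_norm p (\<lambda>x. \<Sum>i\<in>X. s i * f i x)" .
qed (use assms p_ge1 V_measurable in auto)

text \<open>The dual count: by Hoelder's inequality a fixed \<open>g\<close> acts on bounded
  functions as a functional that is bounded in the conjugate norm.\<close>

lemma card_large_right:
  fixes f :: "'i \<Rightarrow> real \<Rightarrow> real"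
  assumes g: "g \<in> V" and C: "Lp_norm p g \<le> C"
    and X: "finite X" and f: "\<And>i. i \<in> X \<Longrightarrow> f i \<in> borel_measurable unitM" "\<And>i x. i \<in> X \<Longrightarrow> \<bar>f i x\<bar> \<le> 1"
    and orth: "\<And>i j. i \<in> X \<Longrightarrow> j \<in> X \<Longrightarrow> i \<noteq> j \<Longrightarrow> pairing (f i) (f j) = 0"
    and \<delta>: "0 < \<delta>" "\<And>i. i \<in> X \<Longrightarrow> \<delta> < \<bar>pairing g (f i)\<bar>"
  shows "real (card X) \<le> (C / \<delta>) powr (2 * (p / (p - 1)))"
proof (rule orthogonal_card_bound[where \<phi>="\<lambda>i. pairing g (f i)" and g=f])
  have r: "1 < p / (p - 1)" "1 / p + 1 / (p / (p - 1)) = 1" using p_gt1 by (auto simp: field_simps)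
  show "1 \<le> p / (p - 1)" using r by simp
  show "0 \<le> C" using C Lp_norm_nonneg[of p g] by linarith
  fix s :: "'i \<Rightarrow> real" assume s: "\<And>i. \<bar>s i\<bar> = 1"
  have bd: "\<bar>\<Sum>i\<in>X. s i * f i x\<bar> \<le> real (card X)" for x
  proof -
    have "\<bar>\<Sum>i\<in>X. s i * f i x\<bar> \<le> (\<Sum>i\<in>X. 1)"
      by (rule order_trans[OF sum_abs]) (intro sum_mono, use f(2) s in \<open>auto simp: abs_mult\<close>)
    then show ?thesis by simp
  qed
  have "(\<Sum>i\<in>X. s i * pairing g (f i)) = pairing g (\<lambda>x. \<Sum>i\<in>X. s i * f i x)"
    by (rule pairing_sum_right[OF g f, symmetric])
  also have "\<bar>\<dots>\<bar> \<le> Lp_norm p g * Lp_norm (p / (p - 1)) (\<lambda>x. \<Sum>i\<in>X. s i * f i x)"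
    by (rule Holder_bounded[OF p_gt1 r V_Lp[OF g] _ bd]) (use f(1) in measurable)
  also have "\<dots> \<le> C * Lp_norm (p / (p - 1)) (\<lambda>x. \<Sum>i\<in>X. s i * f i x)"
    using C by (intro mult_right_mono Lp_norm_nonneg)
  finally show "\<bar>\<Sum>i\<in>X. s i * pairing g (f i)\<bar> \<le> C * Lp_norm (p / (p - 1)) (\<lambda>x. \<Sum>i\<in>X. s i * f i x)" .
qed (use assms in auto)

section \<open>Blocks on which the operator is nearly scalar\<close>

text \<open>The embedded Walsh function for one block and one map, available before blocks are
  assembled into the sequences that \<open>b\<close> expects.\<close>

definition bw :: "nat \<Rightarrow> (nat set \<Rightarrow> nat set) \<Rightarrow> nat set \<Rightarrow> real \<Rightarrow> real" where
  "bw m q F x = walsh F (q (\<xi> m x))"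

lemma abs_bw [simp]: "\<bar>bw m q F x\<bar> = 1"
  by (simp add: bw_def)

lemma bw_measurable: "1 \<le> m \<Longrightarrow> bw m q F \<in> borel_measurable unitM"
  unfolding bw_def[abs_def] by (rule block_measurable[OF bs])

lemma bw_in_V:
  assumes m: "1 \<le> m" and q: "uniform_map m n q" and F: "F \<subseteq> {..<n}" "F \<noteq> {}"
  shows "bw m q F \<in> V"
proof -
  obtain a where a: "\<And>x. x \<subseteq> {..<m} \<Longrightarrow> walsh F (q x) = (\<Sum>S\<in>Pow {..<m} - {{}}. a S * walsh S x)"
    using uniform_map_walsh_span[OF q F] by blast
  have "bw m q F = (\<lambda>x. \<Sum>S\<in>Pow {..<m} - {{}}. a S * w (m, S) x)"
    using a block_subset[OF bs m] by (auto simp: block_walsh_def bw_def)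
  moreover have "\<dots> \<in> V" using m by (intro sum_in_V walsh_in_V) (auto simp: walsh_index_def)
  ultimately show ?thesis by simp
qed

lemma bw_orthogonal:
  assumes "1 \<le> m" "1 \<le> m'" "m \<noteq> m'" and q: "uniform_map m n q" and F: "F \<subseteq> {..<n}" "F \<noteq> {}"
  shows "pairing (bw m q F) (bw m' q' F') = 0"
proof -
  have "(\<integral>x. bw m q F x \<partial>unitM) = (\<Sum>x\<in>Pow {..<m}. walsh F (q x)) / 2 ^ m"
    unfolding bw_def using block_integral[OF bs assms(1), of "\<lambda>z. walsh F (q z)"] by simp
  also have "\<dots> = 0" using q F by (simp add: uniform_map_def)
  finally show ?thesis
    unfolding bw_def using block_pair[OF bs assms(1-3), of "\<lambda>z. walsh F (q z)" "\<lambda>z. walsh F' (q' z)"] by simp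
qed

definition good_block :: "((real \<Rightarrow> real) \<Rightarrow> real \<Rightarrow> real) \<Rightarrow> real \<Rightarrow> nat \<Rightarrow> nat \<Rightarrow> (nat set \<Rightarrow> nat set) \<Rightarrow> real \<Rightarrow> bool" where
  "good_block T c m n q \<eta> \<longleftrightarrow> 1 \<le> m \<and> uniform_map m n q \<and>
     (\<forall>F\<subseteq>{..<n}. \<forall>G\<subseteq>{..<n}. F \<noteq> {} \<longrightarrow> G \<noteq> {} \<longrightarrow>
        \<bar>pairing (T (bw m q F)) (bw m q G) - (if F = G then c else 0)\<bar> \<le> \<eta>)"

text \<open>The matrix of \<open>T\<close> on block \<open>m\<close> has entries bounded by
  \<open>C\<close> and, in each row and column, a number of large entries bounded independently of
  \<open>m\<close>. The combinatorial diagonalization therefore applies to every large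
  \<open>m\<close>, with \<open>q\<close> and \<open>c\<close> depending on it.\<close>

lemma exists_good_block:
  assumes T: "bounded_op_on p V T" and C: "0 \<le> C" "\<And>f. f \<in> V \<Longrightarrow> Lp_norm p (T f) \<le> C * Lp_norm p f" and \<eta>: "0 < \<eta>"
  shows "\<exists>m0. \<forall>m\<ge>m0. \<exists>q c. \<bar>c\<bar> \<le> C \<and> good_block T c m n q \<eta>"
proof -
  define r where "r = p / (p - 1)"
  \<comment> \<open>The sum covers both directions: exponent \<open>p\<close> when the test function
    is fixed, the conjugate exponent when the image is fixed.\<close>
  define Lf where "Lf \<delta> = nat \<lceil>(C / \<delta>) powr (2 * p)\<rceil> + nat \<lceil>(C / \<delta>) powr (2 * r)\<rceil>" for \<delta>
  obtain l m0 where lm: "\<forall>t :: nat set \<Rightarrow> nat set \<Rightarrow> real. \<forall>m\<ge>m0.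
     (\<forall>S S'. \<bar>t S S'\<bar> \<le> C) \<longrightarrow>
     (\<forall>\<delta>>0. \<forall>S'\<subseteq>{..<m}. S' \<noteq> {} \<longrightarrow> card {S. S \<subseteq> {..<m} \<and> S \<noteq> {} \<and> \<delta> < \<bar>t S S'\<bar>} \<le> Lf \<delta>) \<longrightarrow>
     (\<forall>\<delta>>0. \<forall>S\<subseteq>{..<m}. S \<noteq> {} \<longrightarrow> card {S'. S' \<subseteq> {..<m} \<and> S' \<noteq> {} \<and> \<delta> < \<bar>t S S'\<bar>} \<le> Lf \<delta>) \<longrightarrow>
     (\<exists>\<phi> c. inj_on \<phi> (mux_coords l n) \<and> \<phi> ` mux_coords l n \<subseteq> {..<m} \<and> \<bar>c\<bar> \<le> C \<and>
       (\<forall>F\<subseteq>{..<n}. \<forall>G\<subseteq>{..<n}. F \<noteq> {} \<longrightarrow> G \<noteq> {} \<longrightarrow>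
         \<bar>(\<Sum>(A, P)\<in>Pow {..<l} \<times> Pow {..<l}. \<Sum>(A', P')\<in>Pow {..<l} \<times> Pow {..<l}.
            walsh P A / 2 ^ l * (walsh P' A' / 2 ^ l) * t (\<phi> ` mux_freq F (A, P)) (\<phi> ` mux_freq G (A', P')))
          - (if F = G then c else 0)\<bar> \<le> \<eta>))"
    using finite_diagonalization[OF C(1) \<eta>, where n=n and Lf=Lf] by (elim exE)
  have "\<exists>q c. \<bar>c\<bar> \<le> C \<and> good_block T c m n q \<eta>" if m: "max m0 1 \<le> m" for m
  proof -
    have m1: "1 \<le> m" and m0: "m0 \<le> m" using m by auto
    define D where "D = Pow {..<m} - {{}}"
    have idx: "(m, S) \<in> walsh_index" if "S \<in> D" for S using that m1 by (auto simp: walsh_index_def D_def)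
    \<comment> \<open>Entries outside the nonempty subsets of \<open>{..<m}\<close> are set to 0
      because the bound by \<open>C\<close> is demanded for all index sets.\<close>
    define t where "t S S' = (if S \<in> D \<and> S' \<in> D then pairing (T (w (m, S))) (w (m, S')) else 0)" for S S'
    have Tw: "Lp_norm p (T (w (m, S))) \<le> C" "T (w (m, S)) \<in> V" if "S \<in> D" for S
    proof -
      have "C * Lp_norm p (w (m, S)) \<le> C * 1" using C(1) w_norm[OF _ idx[OF that], of p] p_gt1 by (intro mult_left_mono) auto
      then show "Lp_norm p (T (w (m, S))) \<le> C" using C(2)[OF walsh_in_V[OF idx[OF that]]] by simp
      show "T (w (m, S)) \<in> V" using op_in_V[OF T walsh_in_V[OF idx[OF that]]] .
    qed
    have tC: "\<forall>S S'. \<bar>t S S'\<bar> \<le> C"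
    proof (intro allI)
      fix S S'
      show "\<bar>t S S'\<bar> \<le> C"
      proof (cases "S \<in> D \<and> S' \<in> D")
        case True
        then show ?thesis using order_trans[OF abs_pairing_w_le[OF Tw(2)[of S] idx[of S']] Tw(1)[of S]] by (simp add: t_def)
      next
        case False then show ?thesis using C(1) by (auto simp: t_def)
      qed
    qed
    have orth: "pairing (w (m, S)) (w (m, S')) = 0" if "S \<in> D" "S' \<in> D" "S \<noteq> S'" for S S'
      using block_walsh_orthonormal[OF bs idx[OF that(1)] idx[OF that(2)]] that(3) by simp
    have rowD: "{S. S \<subseteq> {..<m} \<and> S \<noteq> {} \<and> \<delta> < \<bar>u S\<bar>} = {S \<in> D. \<delta> < \<bar>u S\<bar>}" for u :: "nat set \<Rightarrow> real" and \<delta>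
      by (auto simp: D_def)
    have finD: "finite {S \<in> D. Q S}" for Q by (rule finite_subset[of _ "Pow {..<m}"]) (auto simp: D_def)
    have row: "\<forall>\<delta>>0. \<forall>S'\<subseteq>{..<m}. S' \<noteq> {} \<longrightarrow> card {S. S \<subseteq> {..<m} \<and> S \<noteq> {} \<and> \<delta> < \<bar>t S S'\<bar>} \<le> Lf \<delta>"
    proof (intro allI impI)
      fix \<delta> :: real and S' assume \<delta>: "0 < \<delta>" and S': "S' \<subseteq> {..<m}" "S' \<noteq> {}"
      have S'D: "S' \<in> D" using S' by (auto simp: D_def)
      have "real (card {S \<in> D. \<delta> < \<bar>t S S'\<bar>}) \<le> (C / \<delta>) powr (2 * p)"
        by (rule card_large_left[OF T C finD, of _ "\<lambda>S. w (m, S)" "w (m, S')"])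
          (use walsh_in_V idx orth w_measurable[OF idx[OF S'D]] \<delta> S'D in \<open>auto simp: t_def\<close>)
      then show "card {S. S \<subseteq> {..<m} \<and> S \<noteq> {} \<and> \<delta> < \<bar>t S S'\<bar>} \<le> Lf \<delta>" unfolding rowD Lf_def by linarith
    qed
    have col: "\<forall>\<delta>>0. \<forall>S\<subseteq>{..<m}. S \<noteq> {} \<longrightarrow> card {S'. S' \<subseteq> {..<m} \<and> S' \<noteq> {} \<and> \<delta> < \<bar>t S S'\<bar>} \<le> Lf \<delta>"
    proof (intro allI impI)
      fix \<delta> :: real and S assume \<delta>: "0 < \<delta>" and S: "S \<subseteq> {..<m}" "S \<noteq> {}"
      have SD: "S \<in> D" using S by (auto simp: D_def)
      have "real (card {S' \<in> D. \<delta> < \<bar>t S S'\<bar>}) \<le> (C / \<delta>) powr (2 * (p / (p - 1)))"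
        by (rule card_large_right[OF Tw(2)[OF SD] Tw(1)[OF SD] finD, of _ "\<lambda>S'. w (m, S')"])
          (use w_measurable[OF idx] orth \<delta> SD in \<open>auto simp: t_def\<close>)
      then show "card {S'. S' \<subseteq> {..<m} \<and> S' \<noteq> {} \<and> \<delta> < \<bar>t S S'\<bar>} \<le> Lf \<delta>" unfolding rowD Lf_def r_def by linarith
    qed
    obtain \<phi> c where *: "inj_on \<phi> (mux_coords l n) \<and> \<phi> ` mux_coords l n \<subseteq> {..<m} \<and> \<bar>c\<bar> \<le> C \<and>
       (\<forall>F\<subseteq>{..<n}. \<forall>G\<subseteq>{..<n}. F \<noteq> {} \<longrightarrow> G \<noteq> {} \<longrightarrow>
         \<bar>(\<Sum>(A, P)\<in>Pow {..<l} \<times> Pow {..<l}. \<Sum>(A', P')\<in>Pow {..<l} \<times> Pow {..<l}.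
            walsh P A / 2 ^ l * (walsh P' A' / 2 ^ l) * t (\<phi> ` mux_freq F (A, P)) (\<phi> ` mux_freq G (A', P')))
          - (if F = G then c else 0)\<bar> \<le> \<eta>)"
      using lm[THEN spec, THEN spec, THEN mp, OF m0, THEN mp, OF tC, THEN mp, OF row, THEN mp, OF col] by (elim exE)
    have \<phi>: "inj_on \<phi> (mux_coords l n)" "\<phi> ` mux_coords l n \<subseteq> {..<m}" "\<bar>c\<bar> \<le> C" using * by simp_all
    define q where "q = multiplexer l n \<phi>"
    define \<Theta> where "\<Theta> = Pow {..<l} \<times> Pow {..<l}"
    define \<kappa> where "\<kappa> \<theta> = walsh (snd \<theta>) (fst \<theta>) / 2 ^ l" for \<theta> :: "nat set \<times> nat set"
    have near: "\<bar>(\<Sum>\<theta>\<in>\<Theta>. \<Sum>\<theta>'\<in>\<Theta>. \<kappa> \<theta> * \<kappa> \<theta>' * t (\<phi> ` mux_freq F \<theta>) (\<phi> ` mux_freq G \<theta>')) - (if F = G then c else 0)\<bar> \<le> \<eta>"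
      if "F \<subseteq> {..<n}" "F \<noteq> {}" "G \<subseteq> {..<n}" "G \<noteq> {}" for F G
      using * that by (simp add: case_prod_beta \<Theta>_def \<kappa>_def)
    have freqD: "\<phi> ` mux_freq F \<theta> \<in> D" if "F \<subseteq> {..<n}" "F \<noteq> {}" "\<theta> \<in> \<Theta>" for F \<theta>
      using order_trans[OF image_mono[OF mux_freq_subset[OF that(1)]] \<phi>(2), of \<theta>] mux_freq_nonempty[OF that(2), of \<theta>] that(3)
      by (simp add: D_def \<Theta>_def)
    have bw_sum: "bw m q F = (\<lambda>x. \<Sum>\<theta>\<in>\<Theta>. \<kappa> \<theta> * w (m, \<phi> ` mux_freq F \<theta>) x)" if "F \<subseteq> {..<n}" for F
      unfolding bw_def q_def block_walsh_def walsh_multiplexer[OF \<phi>(1) that]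
      by (simp add: case_prod_beta \<Theta>_def \<kappa>_def)
    have fin\<Theta>: "finite \<Theta>" by (simp add: \<Theta>_def)
    have "pairing (T (bw m q F)) (bw m q G) = (\<Sum>\<theta>\<in>\<Theta>. \<Sum>\<theta>'\<in>\<Theta>. \<kappa> \<theta> * \<kappa> \<theta>' * t (\<phi> ` mux_freq F \<theta>) (\<phi> ` mux_freq G \<theta>'))"
      if F: "F \<subseteq> {..<n}" "F \<noteq> {}" and G: "G \<subseteq> {..<n}" "G \<noteq> {}" for F G
    proof -
      have "pairing (T (bw m q F)) (bw m q G) = (\<Sum>\<theta>\<in>\<Theta>. \<kappa> \<theta> * pairing (T (w (m, \<phi> ` mux_freq F \<theta>))) (bw m q G))"
        unfolding bw_sum[OF F(1)] using freqD[OF F] idx walsh_in_V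
        by (intro pairing_op_sum[OF T fin\<Theta> _ bw_measurable[OF m1]]) auto
      also have "\<dots> = (\<Sum>\<theta>\<in>\<Theta>. \<Sum>\<theta>'\<in>\<Theta>. \<kappa> \<theta> * \<kappa> \<theta>' * t (\<phi> ` mux_freq F \<theta>) (\<phi> ` mux_freq G \<theta>'))"
      proof (intro sum.cong refl)
        fix \<theta> assume \<theta>: "\<theta> \<in> \<Theta>"
        have "pairing (T (w (m, \<phi> ` mux_freq F \<theta>))) (bw m q G)
            = (\<Sum>\<theta>'\<in>\<Theta>. \<kappa> \<theta>' * pairing (T (w (m, \<phi> ` mux_freq F \<theta>))) (w (m, \<phi> ` mux_freq G \<theta>')))"
          unfolding bw_sum[OF G(1)] using freqD[OF G] idx w_measurable
          by (intro pairing_sum_right[OF Tw(2)[OF freqD[OF F \<theta>]], of _ _ 1]) auto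
        then show "\<kappa> \<theta> * pairing (T (w (m, \<phi> ` mux_freq F \<theta>))) (bw m q G)
            = (\<Sum>\<theta>'\<in>\<Theta>. \<kappa> \<theta> * \<kappa> \<theta>' * t (\<phi> ` mux_freq F \<theta>) (\<phi> ` mux_freq G \<theta>'))"
          using freqD[OF F \<theta>] freqD[OF G] by (simp add: t_def sum_distrib_left mult.assoc)
      qed
      finally show ?thesis .
    qed
    then have "good_block T c m n q \<eta>"
      unfolding good_block_def using near m1 uniform_map_multiplexer[OF \<phi>(1,2)] by (auto simp: q_def)
    then show ?thesis using \<phi>(3) by blast
  qed
  then show ?thesis by blast
qed

text \<open>Forgetting the outputs from \<open>n'\<close> on preserves uniformity and does not
  change the Walsh functions with frequencies inside \<open>{..<n'}\<close>. A block found for large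
  \<open>n\<close> thus serves all smaller ones, and a change of the scalar only costs
  accuracy.\<close>

lemma good_block_mono:
  assumes g: "good_block T c m n q \<eta>" and n: "n' \<le> n" and \<eta>: "\<eta> + \<bar>c - c'\<bar> \<le> \<eta>'"
  shows "good_block T c' m n' (\<lambda>x. q x \<inter> {..<n'}) \<eta>'"
proof -
  have w: "walsh F (z \<inter> {..<n'}) = walsh F z" if "F \<subseteq> {..<n'}" for F z
    unfolding walsh_def using that by (intro prod.cong) auto
  have bweq: "bw m (\<lambda>x. q x \<inter> {..<n'}) F = bw m q F" if "F \<subseteq> {..<n'}" for F
    using w[OF that] by (auto simp: bw_def)
  have um: "uniform_map m n' (\<lambda>x. q x \<inter> {..<n'})"
    unfolding uniform_map_def
  proof (intro conjI allI impI)
    fix F assume F: "F \<subseteq> {..<n'}" "F \<noteq> {}"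
    then have "F \<subseteq> {..<n}" using n by auto
    then show "(\<Sum>x\<in>Pow {..<m}. walsh F (q x \<inter> {..<n'})) = 0"
      using g F unfolding w[OF F(1)] by (simp add: good_block_def uniform_map_def)
  qed auto
  have near: "\<bar>pairing (T (bw m (\<lambda>x. q x \<inter> {..<n'}) F)) (bw m (\<lambda>x. q x \<inter> {..<n'}) G) - (if F = G then c' else 0)\<bar> \<le> \<eta>'"
    if F: "F \<subseteq> {..<n'}" "F \<noteq> {}" and G: "G \<subseteq> {..<n'}" "G \<noteq> {}" for F G
  proof -
    have "F \<subseteq> {..<n}" "G \<subseteq> {..<n}" using F(1) G(1) n by auto
    then have "\<bar>pairing (T (bw m q F)) (bw m q G) - (if F = G then c else 0)\<bar> \<le> \<eta>" using g F(2) G(2) by (simp add: good_block_def)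
    then show ?thesis unfolding bweq[OF F(1)] bweq[OF G(1)] using \<eta> by (cases "F = G") auto
  qed
  show ?thesis unfolding good_block_def
  proof (intro conjI allI impI um)
    show "1 \<le> m" using g by (simp add: good_block_def)
  qed (rule near)
qed

text \<open>The scalars found for the various sizes lie in a compact interval, and a subsequence of
  them converges to \<open>c\<close>. Late members of the subsequence, restricted to
  \<open>n\<close> outputs, serve every \<open>n\<close> and \<open>\<eta>\<close>. Infinitely many
  blocks are recorded because each stage of the later selection discards finitely many.\<close>

lemma stable_scalar:
  assumes T: "bounded_op_on p V T"
  shows "\<exists>c. \<forall>n. \<forall>\<eta>>0. infinite {m. \<exists>q. good_block T c m n q \<eta>}"
proof -
  obtain C where C: "0 \<le> C" "\<And>f. f \<in> V \<Longrightarrow> Lp_norm p (T f) \<le> C * Lp_norm p f" using op_bound[OF T] by blast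
  have "\<exists>m q c. N \<le> m \<and> \<bar>c\<bar> \<le> C \<and> good_block T c m N q (1 / Suc N)" for N
  proof -
    obtain m0 where "\<forall>m\<ge>m0. \<exists>q c. \<bar>c\<bar> \<le> C \<and> good_block T c m N q (1 / Suc N)"
      using exists_good_block[OF T C, of "1 / Suc N" N] by auto
    then show ?thesis by (metis max.cobounded1 max.cobounded2)
  qed
  then obtain M Q \<gamma> where M: "\<And>N. N \<le> M N" "\<And>N. \<bar>\<gamma> N\<bar> \<le> C" "\<And>N. good_block T (\<gamma> N) (M N) N (Q N) (1 / Suc N)"
    by metis
  have "seq_compact {-C..C}" by (simp add: compact_imp_seq_compact)
  moreover have "\<forall>N. \<gamma> N \<in> {-C..C}" using M(2) by (auto simp: abs_le_iff minus_le_iff)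
  ultimately obtain c r where r: "strict_mono r" "(\<gamma> \<circ> r) \<longlonglongrightarrow> c" by (meson seq_compactE)
  have "infinite {m. \<exists>q. good_block T c m n q \<eta>}" if \<eta>: "0 < \<eta>" for n \<eta>
  proof -
    have "\<forall>\<^sub>F k in sequentially. \<bar>\<gamma> (r k) - c\<bar> < \<eta> / 2"
      using tendstoD[OF r(2), of "\<eta> / 2"] \<eta> by (simp add: dist_real_def)
    moreover have "\<forall>\<^sub>F k in sequentially. 1 / real (Suc k) < \<eta> / 2"
      using order_tendstoD(2)[OF LIMSEQ_inverse_real_of_nat, of "\<eta> / 2"] \<eta> by (simp add: inverse_eq_divide)
    moreover have "\<forall>\<^sub>F k in sequentially. n \<le> k" by (rule eventually_ge_at_top)
    ultimately have "\<forall>\<^sub>F k in sequentially. \<exists>q. good_block T c (M (r k)) n q \<eta>"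
    proof eventually_elim
      case (elim k)
      have rk: "k \<le> r k" using seq_suble[OF r(1)] .
      have "1 / real (Suc (r k)) \<le> 1 / real (Suc k)" using rk by (intro divide_left_mono) auto
      then have "1 / real (Suc (r k)) + \<bar>\<gamma> (r k) - c\<bar> \<le> \<eta>" using elim by linarith
      then show ?case using good_block_mono[OF M(3)[of "r k"], of n c \<eta>] elim rk by auto
    qed
    then obtain k0 where k0: "\<And>k. k0 \<le> k \<Longrightarrow> \<exists>q. good_block T c (M (r k)) n q \<eta>" by (auto simp: eventually_sequentially)
    show ?thesis unfolding infinite_nat_iff_unbounded_le
    proof
      fix B
      have "B \<le> M (r (max k0 B))" using M(1)[of "r (max k0 B)"] seq_suble[OF r(1), of "max k0 B"] by linarith
      then show "\<exists>m\<ge>B. m \<in> {m. \<exists>q. good_block T c m n q \<eta>}" using k0[of "max k0 B"] by auto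
    qed
  qed
  then show ?thesis by blast
qed

text \<open>Functions built in different blocks are orthogonal, whatever maps and frequencies are
  used. One offending function from each bad block gives a family to which the counting bound
  applies, uniformly in \<open>q\<close> and \<open>F\<close>.\<close>

lemma finite_bad_right:
  assumes g: "g \<in> V" and \<delta>: "0 < \<delta>"
  shows "finite {m. 1 \<le> m \<and> (\<exists>q F. uniform_map m n q \<and> F \<subseteq> {..<n} \<and> F \<noteq> {} \<and> \<delta> < \<bar>pairing g (bw m q F)\<bar>)}" (is "finite ?S")
proof (rule ccontr)
  assume inf: "infinite ?S"
  obtain X where "finite X \<and> card X = Suc (nat \<lceil>(Lp_norm p g / \<delta>) powr (2 * (p / (p - 1)))\<rceil>) \<and> X \<subseteq> ?S"
    using infinite_arbitrarily_large[OF inf, of "Suc (nat \<lceil>(Lp_norm p g / \<delta>) powr (2 * (p / (p - 1)))\<rceil>)"] by (elim exE)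
  then have X: "X \<subseteq> ?S" "finite X" "card X = Suc (nat \<lceil>(Lp_norm p g / \<delta>) powr (2 * (p / (p - 1)))\<rceil>)" by simp_all
  from X(1) have "\<forall>m\<in>X. \<exists>q F. 1 \<le> m \<and> uniform_map m n q \<and> F \<subseteq> {..<n} \<and> F \<noteq> {} \<and> \<delta> < \<bar>pairing g (bw m q F)\<bar>" by auto
  then obtain Q F where QF: "\<And>m. m \<in> X \<Longrightarrow> 1 \<le> m \<and> uniform_map m n (Q m) \<and> F m \<subseteq> {..<n} \<and> F m \<noteq> {} \<and> \<delta> < \<bar>pairing g (bw m (Q m) (F m))\<bar>"
    by metis
  have "real (card X) \<le> (Lp_norm p g / \<delta>) powr (2 * (p / (p - 1)))"
    by (rule card_large_right[OF g order_refl X(2), of "\<lambda>m. bw m (Q m) (F m)"])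
      (use QF bw_measurable \<delta> in \<open>auto intro!: bw_orthogonal\<close>)
  then show False using X(3) by linarith
qed

lemma finite_bad_left:
  assumes T: "bounded_op_on p V T" and \<beta>: "\<beta> \<in> borel_measurable unitM" "\<And>x. \<bar>\<beta> x\<bar> \<le> 1" and \<delta>: "0 < \<delta>"
  shows "finite {m. 1 \<le> m \<and> (\<exists>q F. uniform_map m n q \<and> F \<subseteq> {..<n} \<and> F \<noteq> {} \<and> \<delta> < \<bar>pairing (T (bw m q F)) \<beta>\<bar>)}" (is "finite ?S")
proof (rule ccontr)
  obtain C where C: "0 \<le> C" "\<And>f. f \<in> V \<Longrightarrow> Lp_norm p (T f) \<le> C * Lp_norm p f" using op_bound[OF T] by blast
  assume inf: "infinite ?S"
  obtain X where "finite X \<and> card X = Suc (nat \<lceil>(C / \<delta>) powr (2 * p)\<rceil>) \<and> X \<subseteq> ?S"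
    using infinite_arbitrarily_large[OF inf, of "Suc (nat \<lceil>(C / \<delta>) powr (2 * p)\<rceil>)"] by (elim exE)
  then have X: "X \<subseteq> ?S" "finite X" "card X = Suc (nat \<lceil>(C / \<delta>) powr (2 * p)\<rceil>)" by simp_all
  from X(1) have "\<forall>m\<in>X. \<exists>q F. 1 \<le> m \<and> uniform_map m n q \<and> F \<subseteq> {..<n} \<and> F \<noteq> {} \<and> \<delta> < \<bar>pairing (T (bw m q F)) \<beta>\<bar>" by auto
  then obtain Q F where QF: "\<And>m. m \<in> X \<Longrightarrow> 1 \<le> m \<and> uniform_map m n (Q m) \<and> F m \<subseteq> {..<n} \<and> F m \<noteq> {} \<and> \<delta> < \<bar>pairing (T (bw m (Q m) (F m))) \<beta>\<bar>"
    by metis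
  have "real (card X) \<le> (C / \<delta>) powr (2 * p)"
    by (rule card_large_left[OF T C X(2), of "\<lambda>m. bw m (Q m) (F m)" \<beta>])
      (use QF \<beta> \<delta> in \<open>auto intro!: bw_orthogonal bw_in_V\<close>)
  then show False using X(3) by linarith
qed

text \<open>Blocks are chosen recursively, each avoiding the finitely many that interact with
  earlier choices in either order of the pairing. The accuracy \<open>(weight n)\<^sup>2\<close> at
  stage \<open>n\<close> suffices because weights decrease: the square of the later weight is at
  most the product of the two.\<close>

lemma select_blocks:
  assumes T: "bounded_op_on p V T" and c: "\<And>n \<eta>. 0 < \<eta> \<Longrightarrow> infinite {m. \<exists>q. good_block T c m n q \<eta>}"
  shows "\<exists>m q. block_map m q \<and> (\<forall>i\<in>walsh_index. \<forall>j\<in>walsh_index.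
    \<bar>pairing (T (b m q i)) (b m q j) - (if i = j then c else 0)\<bar> \<le> weight (fst i) * weight (fst j))"
proof -
  define cross where "cross n n' r r' \<longleftrightarrow> (\<forall>F F'. F \<subseteq> {..<n} \<longrightarrow> F \<noteq> {} \<longrightarrow> F' \<subseteq> {..<n'} \<longrightarrow> F' \<noteq> {} \<longrightarrow>
      \<bar>pairing (T (bw (fst r') (snd r') F')) (bw (fst r) (snd r) F)\<bar> \<le> (weight n)\<^sup>2 \<and>
      \<bar>pairing (T (bw (fst r) (snd r) F)) (bw (fst r') (snd r') F')\<bar> \<le> (weight n)\<^sup>2)" for n n' and r r' :: "nat \<times> (nat set \<Rightarrow> nat set)"
  define Q where "Q f n r \<longleftrightarrow> good_block T c (fst r) n (snd r) ((weight n)\<^sup>2) \<and>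
      (\<forall>n'<n. fst (f n') < fst r \<and> cross n n' r (f n'))" for f n and r :: "nat \<times> (nat set \<Rightarrow> nat set)"
  have "\<exists>f. \<forall>n. Q f n (f n)"
  proof (rule dependent_wellorder_choice)
    show "Q f n r = Q g n r" if "\<And>n'. n' < n \<Longrightarrow> f n' = g n'" for r f g n
      unfolding Q_def by (intro arg_cong2[where f="(\<and>)"] refl all_cong) (simp_all add: that)
  next
    fix n and f :: "nat \<Rightarrow> nat \<times> (nat set \<Rightarrow> nat set)"
    assume IH: "\<And>n'. n' < n \<Longrightarrow> Q f n' (f n')"
    have \<delta>: "0 < (weight n)\<^sup>2" by (simp add: weight_def)
    have f1: "1 \<le> fst (f n')" "uniform_map (fst (f n')) n' (snd (f n'))" if "n' < n" for n'
      using IH[OF that] by (auto simp: Q_def good_block_def)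
    define I where "I = Sigma {..<n} (\<lambda>n'. Pow {..<n'} - {{}})"
    define B where "B k = bw (fst (f (fst k))) (snd (f (fst k))) (snd k)" for k
    have finI: "finite I" by (auto simp: I_def)
    have BV: "B k \<in> V" and Bm: "B k \<in> borel_measurable unitM" if "k \<in> I" for k
      using f1[of "fst k"] that unfolding B_def I_def by (auto intro!: bw_in_V bw_measurable)
    \<comment> \<open>To be avoided: blocks not beyond the earlier ones, blocks correlated with
      images of earlier functions, and blocks whose images correlate with earlier functions.\<close>
    define Bad where "Bad = {..Max (insert 0 ((\<lambda>n'. fst (f n')) ` {..<n}))} \<union>
      (\<Union>k\<in>I. {m. 1 \<le> m \<and> (\<exists>q F. uniform_map m n q \<and> F \<subseteq> {..<n} \<and> F \<noteq> {} \<and> (weight n)\<^sup>2 < \<bar>pairing (T (B k)) (bw m q F)\<bar>)}) \<union>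
      (\<Union>k\<in>I. {m. 1 \<le> m \<and> (\<exists>q F. uniform_map m n q \<and> F \<subseteq> {..<n} \<and> F \<noteq> {} \<and> (weight n)\<^sup>2 < \<bar>pairing (T (bw m q F)) (B k)\<bar>)})"
    have "finite Bad"
      unfolding Bad_def using finI
      by (intro finite_UnI finite_UN_I finite_bad_right[OF op_in_V[OF T BV] \<delta>] finite_bad_left[OF T Bm _ \<delta>]) (auto simp: B_def)
    then have "infinite ({m. \<exists>q. good_block T c m n q ((weight n)\<^sup>2)} - Bad)" using c[OF \<delta>, of n] by (rule Diff_infinite_finite)
    then obtain m q where mq: "good_block T c m n q ((weight n)\<^sup>2)" "m \<notin> Bad"
      using infinite_imp_nonempty by blast
    have m1: "1 \<le> m" "uniform_map m n q" using mq by (auto simp: good_block_def)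
    have "Q f n (m, q)" unfolding Q_def
    proof (intro conjI allI impI)
      show "good_block T c (fst (m, q)) n (snd (m, q)) ((weight n)\<^sup>2)" using mq by simp
      fix n' assume n': "n' < n"
      then have "fst (f n') \<le> Max (insert 0 ((\<lambda>n'. fst (f n')) ` {..<n}))" by (intro Max_ge) auto
      moreover have "\<not> m \<le> Max (insert 0 ((\<lambda>n'. fst (f n')) ` {..<n}))" using mq(2) by (auto simp: Bad_def)
      ultimately show "fst (f n') < fst (m, q)" by simp
      show "cross n n' (m, q) (f n')" unfolding cross_def
      proof (intro allI impI)
        fix F F' assume F: "F \<subseteq> {..<n}" "F \<noteq> {}" and F': "F' \<subseteq> {..<n'}" "F' \<noteq> {}"
        then have k: "(n', F') \<in> I" using n' by (auto simp: I_def)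
        have "\<not> (weight n)\<^sup>2 < \<bar>pairing (T (B (n', F'))) (bw m q F)\<bar>" "\<not> (weight n)\<^sup>2 < \<bar>pairing (T (bw m q F)) (B (n', F'))\<bar>"
          using mq(2) k m1 F unfolding Bad_def by blast+
        then show "\<bar>pairing (T (bw (fst (f n')) (snd (f n')) F')) (bw (fst (m, q)) (snd (m, q)) F)\<bar> \<le> (weight n)\<^sup>2 \<and>
            \<bar>pairing (T (bw (fst (m, q)) (snd (m, q)) F)) (bw (fst (f n')) (snd (f n')) F')\<bar> \<le> (weight n)\<^sup>2"
          by (simp add: B_def)
      qed
    qed
    then show "\<exists>r. Q f n r" by blast
  qed
  then obtain f where f: "\<And>n. Q f n (f n)" by blast
  define m where "m n = fst (f n)" for n
  define q where "q n = snd (f n)" for n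
  have good: "good_block T c (m n) n (q n) ((weight n)\<^sup>2)" for n using f[of n] by (simp add: Q_def m_def q_def)
  have "strict_mono m" using f by (auto simp: strict_mono_def Q_def m_def)
  then have mq: "block_map m q"
    using good by (auto simp: block_map_def good_block_def intro: inj_on_subset strict_mono_imp_inj_on)
  have b_bw: "b m q (n, F) = bw (m n) (q n) F" for n F by (auto simp: block_walsh_def bw_def)
  have wt: "(weight n)\<^sup>2 \<le> weight n' * weight n" if "n' \<le> n" for n n'
  proof -
    have "weight n \<le> weight n'" unfolding weight_def using that by (intro divide_left_mono mult_left_mono power_increasing) auto
    moreover have "0 \<le> weight n" by (simp add: weight_def)
    ultimately show ?thesis unfolding power2_eq_square by (rule mult_right_mono)
  qed
  have "\<bar>pairing (T (b m q i)) (b m q j) - (if i = j then c else 0)\<bar> \<le> weight (fst i) * weight (fst j)"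
    if i: "i \<in> walsh_index" and j: "j \<in> walsh_index" for i j
  proof -
    obtain n F where nF: "i = (n, F)" "F \<subseteq> {..<n}" "F \<noteq> {}" using i by (auto simp: walsh_index_def)
    obtain n' F' where nF': "j = (n', F')" "F' \<subseteq> {..<n'}" "F' \<noteq> {}" using j by (auto simp: walsh_index_def)
    consider "n = n'" | "n < n'" | "n' < n" by linarith
    then show ?thesis
    proof cases
      case 1
      then have "\<bar>pairing (T (b m q i)) (b m q j) - (if i = j then c else 0)\<bar> \<le> (weight n)\<^sup>2"
        using good[of n] nF nF' unfolding good_block_def by (simp add: b_bw)
      then show ?thesis using 1 nF nF' by (simp add: power2_eq_square)
    next
      case 2
      then have "cross n' n (f n') (f n)" using f[of n'] by (simp add: Q_def)
      from this[unfolded cross_def, rule_format, OF nF'(2,3) nF(2,3), THEN conjunct1]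
      have "\<bar>pairing (T (b m q i)) (b m q j)\<bar> \<le> (weight n')\<^sup>2"
        unfolding nF(1) nF'(1) b_bw unfolding m_def q_def .
      moreover have "i \<noteq> j" "weight (fst i) * weight (fst j) = weight n * weight n'" using 2 by (auto simp: nF(1) nF'(1))
      ultimately show ?thesis using wt[OF less_imp_le[OF 2]] by simp
    next
      case 3
      then have "cross n n' (f n) (f n')" using f[of n] by (simp add: Q_def)
      from this[unfolded cross_def, rule_format, OF nF(2,3) nF'(2,3), THEN conjunct2]
      have "\<bar>pairing (T (b m q i)) (b m q j)\<bar> \<le> (weight n)\<^sup>2"
        unfolding nF(1) nF'(1) b_bw unfolding m_def q_def .
      moreover have "i \<noteq> j" "weight (fst i) * weight (fst j) = weight n' * weight n" using 3 by (auto simp: nF(1) nF'(1))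
      ultimately show ?thesis using wt[OF less_imp_le[OF 3]] by simp
    qed
  qed
  then show ?thesis using mq by blast
qed

theorem factorization:
  assumes T: "bounded_op_on p V T"
  shows "\<exists>S \<in> {T, (\<lambda>f x. f x - T f x)}. \<exists>A B. bounded_op_on p V A \<and> bounded_op_on p V B \<and>
     (\<forall>f \<in> V. AE x in unitM. A (S (B f)) x = f x) \<and> op_norm_on p V A * op_norm_on p V B \<le> 4"
proof -
  obtain c where c: "\<And>n \<eta>. 0 < \<eta> \<Longrightarrow> infinite {m. \<exists>q. good_block T c m n q \<eta>}" using stable_scalar[OF T] by blast
  obtain m q where mq: "block_map m q" and e: "\<And>i j. i \<in> walsh_index \<Longrightarrow> j \<in> walsh_index \<Longrightarrow>
      \<bar>pairing (T (b m q i)) (b m q j) - (if i = j then c else 0)\<bar> \<le> weight (fst i) * weight (fst j)"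
    using select_blocks[OF T c] by blast
  obtain B where B: "bounded_op_on p V B" "\<And>f. f \<in> V \<Longrightarrow> Lp_norm p (B f) \<le> 1 * Lp_norm p f"
    "\<And>k. k \<in> walsh_index \<Longrightarrow> AE x in unitM. B (w k) x = b m q k x" using walsh_embedding[OF mq] by blast
  obtain A where A: "bounded_op_on p V A" "\<And>f. f \<in> V \<Longrightarrow> Lp_norm p (A f) \<le> 1 * Lp_norm p f"
    "\<And>g j. g \<in> V \<Longrightarrow> j \<in> walsh_index \<Longrightarrow> pairing (A g) (w j) = pairing g (b m q j)" using walsh_coembedding[OF mq] by blast
  have factor: "\<exists>A B. bounded_op_on p V A \<and> bounded_op_on p V B \<and>
     (\<forall>f \<in> V. AE x in unitM. A (S (B f)) x = f x) \<and> op_norm_on p V A * op_norm_on p V B \<le> 4"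
    if S: "bounded_op_on p V S" and d: "1 / 2 \<le> d"
      and eS: "\<And>i j. i \<in> walsh_index \<Longrightarrow> j \<in> walsh_index \<Longrightarrow>
      \<bar>pairing (S (b m q i)) (b m q j) - (if i = j then d else 0)\<bar> \<le> weight (fst i) * weight (fst j)" for S d
  proof -
    have Y: "bounded_op_on p V (\<lambda>f. A (S (B f)))" by (rule op_compose[OF A(1) op_compose[OF S B(1)]])
    have d14: "0 \<le> (1 / 4 :: real)" "1 / 4 < \<bar>d\<bar>" using d by auto
    have "Lp_norm p (\<lambda>x. A (S (B f)) x - d * f x) \<le> 1 / 4 * Lp_norm p f" if "f \<in> V" for f
      by (rule near_scalar[OF S mq A(1,3) B(1,3) eS that])
    then obtain U where U0: "bounded_op_on p V U \<and> (\<forall>f\<in>V. Lp_norm p (U f) \<le> 1 / (\<bar>d\<bar> - 1 / 4) * Lp_norm p f) \<and>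
        (\<forall>f\<in>V. AE x in unitM. U (A (S (B f))) x = f x)"
      using perturbed_scalar_left_inverse[OF Y d14] by blast
    have U: "bounded_op_on p V U" "\<And>f. f \<in> V \<Longrightarrow> Lp_norm p (U f) \<le> 1 / (\<bar>d\<bar> - 1 / 4) * Lp_norm p f"
      "\<And>f. f \<in> V \<Longrightarrow> AE x in unitM. U (A (S (B f))) x = f x"
      using U0 by blast+
    \<comment> \<open>As \<open>d\<close> is at least 1/2 and the perturbation at most 1/4,
      inverting costs at most 1 / (1/2 - 1/4) = 4; the inverse is absorbed into the left
      factor.\<close>
    have UA: "Lp_norm p (U (A f)) \<le> 4 * Lp_norm p f" if f: "f \<in> V" for f
    proof -
      have "Lp_norm p (U (A f)) \<le> 1 / (\<bar>d\<bar> - 1 / 4) * Lp_norm p (A f)" by (rule U(2)[OF op_in_V[OF A(1) f]])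
      also have "\<dots> \<le> 4 * Lp_norm p f"
        using A(2)[OF f] d by (intro mult_mono Lp_norm_nonneg) (auto simp: divide_le_eq)
      finally show ?thesis .
    qed
    have "op_norm_on p V (\<lambda>f. U (A f)) * op_norm_on p V B \<le> 4 * 1"
      using op_norm_le[of 4 "\<lambda>f. U (A f)"] op_norm_le[of 1 B] UA B(2) by (intro mult_mono) auto
    then show ?thesis
      using op_compose[OF U(1) A(1)] B(1) U(3) by (intro exI[of _ "\<lambda>f. U (A f)"] exI[of _ B]) auto
  qed
  show ?thesis
  proof (cases "1 / 2 \<le> c")
    case True
    from factor[OF T this e] show ?thesis by blast
  next
    case False
    \<comment> \<open>The embedded Walsh functions are orthonormal, so the complement of
      \<open>T\<close> has the scalar \<open>1 - c\<close>, now above 1/2, with the same errors and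
      the same \<open>A\<close> and \<open>B\<close>.\<close>
    have "\<bar>pairing (\<lambda>x. b m q i x - T (b m q i) x) (b m q j) - (if i = j then 1 - c else 0)\<bar> \<le> weight (fst i) * weight (fst j)"
      if i: "i \<in> walsh_index" and j: "j \<in> walsh_index" for i j
    proof -
      have "pairing (\<lambda>x. b m q i x - T (b m q i) x) (b m q j) = pairing (b m q i) (b m q j) - pairing (T (b m q i)) (b m q j)"
        by (rule pairing_diff_left[OF b_in_V[OF mq i] op_in_V[OF T b_in_V[OF mq i]] b_measurable[OF mq j], of 1]) simp
      then show ?thesis using e[OF i j] block_walsh_orthonormal[OF bsb[OF mq] i j] by (auto simp: abs_minus_commute)
    qed
    from factor[OF op_complement[OF T] _ this] False show ?thesis by auto
  qed
qed

end

section \<open>The space as a closed span of Walsh functions\<close>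

lemma closed_span_subspace:
  fixes v :: "'k \<Rightarrow> real \<Rightarrow> real"
  assumes p: "1 \<le> p" and v: "\<And>k. k \<in> K \<Longrightarrow> in_Lp p (v k)"
    and V: "V = {f. in_Lp p f \<and> (\<forall>e>0. \<exists>X c. finite X \<and> X \<subseteq> K \<and> Lp_norm p (\<lambda>x. f x - (\<Sum>k\<in>X. c k * v k x)) < e)}"
  shows "closed_Lp_subspace p V" and "\<And>k. k \<in> K \<Longrightarrow> v k \<in> V"
proof -
  have sumL: "in_Lp p (\<lambda>x. \<Sum>k\<in>X. c k * v k x)" if "X \<subseteq> K" for X c
    using that v by (intro in_Lp_sum p) auto
  have lin: "(\<lambda>x. \<alpha> * f x + \<beta> * g x) \<in> V" if f: "f \<in> V" and g: "g \<in> V" for f g \<alpha> \<beta>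
  proof -
    have L: "in_Lp p f" "in_Lp p g" using f g by (auto simp: V)
    have "\<exists>X c. finite X \<and> X \<subseteq> K \<and> Lp_norm p (\<lambda>x. (\<alpha> * f x + \<beta> * g x) - (\<Sum>k\<in>X. c k * v k x)) < e" if e: "0 < e" for e
    proof -
      define d where "d = e / (\<bar>\<alpha>\<bar> + \<bar>\<beta>\<bar> + 1)"
      have d: "0 < d" "(\<bar>\<alpha>\<bar> + \<bar>\<beta>\<bar>) * d < e"
        using e by (auto simp: d_def field_simps add_pos_nonneg intro!: divide_pos_pos)
      obtain X a where X: "finite X" "X \<subseteq> K" "Lp_norm p (\<lambda>x. f x - (\<Sum>k\<in>X. a k * v k x)) < d"
        using f d(1) unfolding V by blast
      obtain Y b where Y: "finite Y" "Y \<subseteq> K" "Lp_norm p (\<lambda>x. g x - (\<Sum>k\<in>Y. b k * v k x)) < d"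
        using g d(1) unfolding V by blast
      define c where "c k = \<alpha> * (if k \<in> X then a k else 0) + \<beta> * (if k \<in> Y then b k else 0)" for k
      have c: "(\<Sum>k\<in>X \<union> Y. c k * z k) = \<alpha> * (\<Sum>k\<in>X. a k * z k) + \<beta> * (\<Sum>k\<in>Y. b k * z k)" for z :: "'k \<Rightarrow> real"
      proof -
        have "(\<Sum>k\<in>X \<union> Y. c k * z k) = \<alpha> * (\<Sum>k\<in>X \<union> Y. if k \<in> X then a k * z k else 0) + \<beta> * (\<Sum>k\<in>X \<union> Y. if k \<in> Y then b k * z k else 0)"
          unfolding c_def sum_distrib_left sum.distrib[symmetric] by (intro sum.cong refl) (auto simp: algebra_simps)
        then show ?thesis using X(1) Y(1) by (simp add: sum.If_cases Int_absorb1)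
      qed
      have Ld: "in_Lp p (\<lambda>x. f x - (\<Sum>k\<in>X. a k * v k x))" "in_Lp p (\<lambda>x. g x - (\<Sum>k\<in>Y. b k * v k x))"
        using L sumL X(2) Y(2) by (auto intro!: in_Lp_diff p)
      have "Lp_norm p (\<lambda>x. (\<alpha> * f x + \<beta> * g x) - (\<Sum>k\<in>X \<union> Y. c k * v k x))
          = Lp_norm p (\<lambda>x. \<alpha> * (f x - (\<Sum>k\<in>X. a k * v k x)) + \<beta> * (g x - (\<Sum>k\<in>Y. b k * v k x)))"
        by (simp add: c algebra_simps)
      also have "\<dots> \<le> \<bar>\<alpha>\<bar> * Lp_norm p (\<lambda>x. f x - (\<Sum>k\<in>X. a k * v k x)) + \<bar>\<beta>\<bar> * Lp_norm p (\<lambda>x. g x - (\<Sum>k\<in>Y. b k * v k x))"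
        using Lp_norm_triangle[OF p in_Lp_cmult[OF Ld(1), of \<alpha>] in_Lp_cmult[OF Ld(2), of \<beta>]] p by (simp add: Lp_norm_cmult)
      also have "\<dots> \<le> \<bar>\<alpha>\<bar> * d + \<bar>\<beta>\<bar> * d" using X(3) Y(3) by (intro add_mono mult_left_mono) auto
      finally show ?thesis using d(2) X(1,2) Y(1,2) by (intro exI[of _ "X \<union> Y"] exI[of _ c]) (simp add: algebra_simps)
    qed
    then show ?thesis using in_Lp_lincomb[OF p L] by (simp add: V)
  qed
  have closed: "f \<in> V" if f: "in_Lp p f" and cl: "\<And>e. 0 < e \<Longrightarrow> \<exists>g\<in>V. Lp_norm p (\<lambda>x. f x - g x) < e" for f
  proof -
    have "\<exists>X c. finite X \<and> X \<subseteq> K \<and> Lp_norm p (\<lambda>x. f x - (\<Sum>k\<in>X. c k * v k x)) < e" if e: "0 < e" for e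
    proof -
      obtain g where g: "g \<in> V" "Lp_norm p (\<lambda>x. f x - g x) < e / 2" using cl[of "e / 2"] e by auto
      have "\<exists>X c. finite X \<and> X \<subseteq> K \<and> Lp_norm p (\<lambda>x. g x - (\<Sum>k\<in>X. c k * v k x)) < e / 2"
        using g(1) half_gt_zero[OF e] unfolding V by blast
      then obtain X c where X: "finite X" "X \<subseteq> K" "Lp_norm p (\<lambda>x. g x - (\<Sum>k\<in>X. c k * v k x)) < e / 2" by blast
      have "in_Lp p g" using g(1) by (simp add: V)
      from Lp_norm_triangle_via[OF p f this sumL[OF X(2), of c]] show ?thesis using g(2) X by (intro exI[of _ X] exI[of _ c]) auto
    qed
    then show ?thesis using f by (simp add: V)
  qed
  have zero: "(\<lambda>x. 0) \<in> V" unfolding V by (auto simp: in_Lp_zero intro!: exI[of _ "{}"])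
  show "closed_Lp_subspace p V"
  proof
    show "1 \<le> p" by (rule p)
    show "V \<noteq> {}" using zero by blast
    show "in_Lp p f" if "f \<in> V" for f using that by (simp add: V)
  qed (fact lin closed)+
  show "v k \<in> V" if "k \<in> K" for k
    using v[OF that] that by (auto simp: V intro!: exI[of _ "{k}"] exI[of _ "\<lambda>_. 1"])
qed

text \<open>Within each copy, Haar functions and nonconstant Walsh functions are finite combinations
  of each other almost everywhere, so the two systems have the same closed span.\<close>

lemma walsh_span_R_p0_omega:
  assumes p: "1 < p" and h: "BRS_family h"
  shows "walsh_span p (R_p0_omega p h) (pattern h)"
proof -
  define v where "v = (\<lambda>(n, I). h n I)"
  note bs = block_system_pattern[OF h]
  let ?w = "block_walsh (pattern h)"
  have "\<exists>a. \<forall>k\<in>D_omega. AE x in unitM. v k x = (\<Sum>F\<in>Pow {..<fst k} - {{}}. a k F * ?w (fst k, F) x)"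
  proof -
    have "\<exists>a. AE x in unitM. v k x = (\<Sum>F\<in>Pow {..<fst k} - {{}}. a F * ?w (fst k, F) x)" if "k \<in> D_omega" for k
      using h_eq_walsh[OF h, of "fst k" "snd k"] that by (auto simp: D_omega_def v_def block_walsh_def)
    then show ?thesis by (intro bchoice ballI)
  qed
  then obtain a where a: "\<And>k. k \<in> D_omega \<Longrightarrow> AE x in unitM. v k x = (\<Sum>F\<in>Pow {..<fst k} - {{}}. a k F * ?w (fst k, F) x)"
    by blast
  have idx: "(fst k, F) \<in> walsh_index" if "k \<in> D_omega" "F \<in> Pow {..<fst k} - {{}}" for k F
    using that by (auto simp: walsh_index_def D_omega_def)
  have wL: "in_Lp p (?w k)" if "k \<in> walsh_index" for k
    using block_walsh_measurable[OF bs that] p by (intro in_Lp_bounded[where C=1]) auto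
  have vm: "v k \<in> borel_measurable unitM" if "k \<in> D_omega" for k
    using h_measurable[OF h, of "fst k" "snd k"] that by (auto simp: D_omega_def v_def)
  have vL: "in_Lp p (v k)" if k: "k \<in> D_omega" for k
    using wL idx[OF k] p by (intro in_Lp_cong_AE[OF a[OF k] vm[OF k]] in_Lp_sum) auto
  have V: "R_p0_omega p h = {f. in_Lp p f \<and> (\<forall>e>0. \<exists>X c. finite X \<and> X \<subseteq> D_omega \<and>
      Lp_norm p (\<lambda>x. f x - (\<Sum>k\<in>X. c k * v k x)) < e)}"
    by (simp add: R_p0_omega_def v_def case_prod_beta)
  have p1: "1 \<le> p" using p by simp
  have sub: "v k \<in> R_p0_omega p h" if "k \<in> D_omega" for k
    by (rule closed_span_subspace(2)[OF p1 _ V that]) (rule vL)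
  interpret closed_Lp_subspace p "R_p0_omega p h"
    by (rule closed_span_subspace(1)[OF p1 _ V]) (rule vL)
  show ?thesis
  proof
    show "1 < p" by (rule p)
    show "block_system (pattern h)" by (rule bs)
  next
    fix k assume k: "k \<in> walsh_index"
    then have n: "1 \<le> fst k" "snd k \<subseteq> {..<fst k}" "snd k \<noteq> {}" by (auto simp: walsh_index_def)
    obtain c where c: "AE x in unitM. ?w k x = (\<Sum>I\<in>dyadic_upto (fst k - 1). c I * h (fst k) I x)"
      using walsh_eq_h[OF h n] unfolding block_walsh_def by blast
    have "(\<lambda>x. \<Sum>I\<in>dyadic_upto (fst k - 1). c I * h (fst k) I x) \<in> R_p0_omega p h"
    proof (rule sum_in_V)
      fix I assume "I \<in> dyadic_upto (fst k - 1)"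
      then have "(fst k, I) \<in> D_omega" using n by (simp add: D_omega_def)
      from sub[OF this] show "h (fst k) I \<in> R_p0_omega p h" by (simp add: v_def)
    qed
    from V_AE_cong[OF this block_walsh_measurable[OF bs k] c] show "?w k \<in> R_p0_omega p h" .
  next
    fix f and e :: real assume f: "f \<in> R_p0_omega p h" and e: "0 < e"
    obtain X c where X: "finite X" "X \<subseteq> D_omega" "Lp_norm p (\<lambda>x. f x - (\<Sum>k\<in>X. c k * v k x)) < e"
      using f e unfolding V by blast
    define K where "K = Sigma (fst ` X) (\<lambda>n. Pow {..<n} - {{}})"
    have K: "finite K" "K \<subseteq> walsh_index" using X by (auto simp: K_def walsh_index_def D_omega_def)
    \<comment> \<open>The coefficient of a Walsh function collects the contributions of all Haar
      terms from the same copy.\<close>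
    define d where "d j = (\<Sum>k\<in>X. if fst k = fst j then c k * a k (snd j) else 0)" for j :: "nat \<times> nat set"
    have swap: "(\<Sum>j\<in>K. d j * ?w j x) = (\<Sum>k\<in>X. c k * (\<Sum>F\<in>Pow {..<fst k} - {{}}. a k F * ?w (fst k, F) x))" for x
    proof -
      have "(\<Sum>j\<in>K. d j * ?w j x) = (\<Sum>j\<in>K. \<Sum>k\<in>X. (if fst k = fst j then c k * a k (snd j) * ?w j x else 0))"
        unfolding d_def sum_distrib_right by (intro sum.cong refl) auto
      also have "\<dots> = (\<Sum>k\<in>X. \<Sum>j\<in>K. (if fst k = fst j then c k * a k (snd j) * ?w j x else 0))"
        by (rule sum.swap)
      also have "\<dots> = (\<Sum>k\<in>X. c k * (\<Sum>F\<in>Pow {..<fst k} - {{}}. a k F * ?w (fst k, F) x))"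
      proof (rule sum.cong)
        fix k assume k: "k \<in> X"
        have "(\<Sum>j\<in>K. (if fst k = fst j then c k * a k (snd j) * ?w j x else 0))
            = (\<Sum>j\<in>Pair (fst k) ` (Pow {..<fst k} - {{}}). (if fst k = fst j then c k * a k (snd j) * ?w j x else 0))"
          by (rule sum.mono_neutral_right[OF K(1)]) (use k in \<open>auto simp: K_def\<close>)
        also have "\<dots> = (\<Sum>F\<in>Pow {..<fst k} - {{}}. c k * (a k F * ?w (fst k, F) x))"
          by (subst sum.reindex) (auto simp: inj_on_def mult.assoc)
        finally show "(\<Sum>j\<in>K. (if fst k = fst j then c k * a k (snd j) * ?w j x else 0))
            = c k * (\<Sum>F\<in>Pow {..<fst k} - {{}}. a k F * ?w (fst k, F) x)" by (simp only: sum_distrib_left)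
      qed simp
      finally show ?thesis .
    qed
    have "AE x in unitM. \<forall>k\<in>X. v k x = (\<Sum>F\<in>Pow {..<fst k} - {{}}. a k F * ?w (fst k, F) x)"
      using a X(1,2) by (intro AE_finite_allI) auto
    then have eq: "AE x in unitM. f x - (\<Sum>j\<in>K. d j * ?w j x) = f x - (\<Sum>k\<in>X. c k * v k x)"
      unfolding swap by eventually_elim simp
    have "Lp_norm p (\<lambda>x. f x - (\<Sum>j\<in>K. d j * ?w j x)) = Lp_norm p (\<lambda>x. f x - (\<Sum>k\<in>X. c k * v k x))"
    proof (rule Lp_norm_cong_AE[OF eq])
      have "in_Lp p f" using V_Lp[OF f] .
      moreover have "in_Lp p (\<lambda>x. \<Sum>j\<in>K. d j * ?w j x)" "in_Lp p (\<lambda>x. \<Sum>k\<in>X. c k * v k x)"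
        using K(2) X(2) wL vL p by (auto intro!: in_Lp_sum)
      ultimately show "(\<lambda>x. f x - (\<Sum>j\<in>K. d j * ?w j x)) \<in> borel_measurable unitM"
        "(\<lambda>x. f x - (\<Sum>k\<in>X. c k * v k x)) \<in> borel_measurable unitM"
        by (auto dest!: in_Lp_measurable)
    qed
    then show "\<exists>K a. finite K \<and> K \<subseteq> walsh_index \<and> Lp_norm p (\<lambda>x. f x - (\<Sum>k\<in>K. a k * ?w k x)) < e"
      using K X(3) by (intro exI[of _ K] exI[of _ d]) simp
  qed
qed

lemma p_star_ge_2:
  assumes "1 < p"
  shows "2 \<le> p_star p"
proof (cases "2 \<le> p")
  case False
  then have "2 \<le> p / (p - 1)" using assms by (simp add: le_divide_eq)
  then show ?thesis by (simp add: p_star_def conj_exp_def)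
qed (simp add: p_star_def)

theorem mainTheorem14:
  fixes p \<epsilon> :: real
    and h :: "nat \<Rightarrow> nat \<times> nat \<Rightarrow> real \<Rightarrow> real"
    and T :: "(real \<Rightarrow> real) \<Rightarrow> (real \<Rightarrow> real)"
  assumes "1 < p" and "BRS_family h"
    and "bounded_op_on p (R_p0_omega p h) T"
    and "0 < \<epsilon>" and "\<epsilon> < 1"
  shows "\<exists>S \<in> {T, (\<lambda>f x. f x - T f x)}. \<exists>A B.
           bounded_op_on p (R_p0_omega p h) A \<and> bounded_op_on p (R_p0_omega p h) B \<and>
           (\<forall>f \<in> R_p0_omega p h. AE x in unitM. A (S (B f)) x = f x) \<and>
           op_norm_on p (R_p0_omega p h) A * op_norm_on p (R_p0_omega p h) B
             \<le> 4 / (1 - \<epsilon>) * (p_star p - 1) ^ 2 * (p_star p / 2) powr (3 / 2)"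
proof -
  have "1 \<le> 1 / (1 - \<epsilon>)" using assms(4,5) by simp
  moreover have "1 \<le> (p_star p - 1) ^ 2" using p_star_ge_2[OF assms(1)] by (simp add: one_le_power)
  moreover have "1 \<le> (p_star p / 2) powr (3 / 2)" using p_star_ge_2[OF assms(1)] by (intro ge_one_powr_ge_zero) auto
  ultimately have "1 * 1 * 1 \<le> 1 / (1 - \<epsilon>) * (p_star p - 1) ^ 2 * (p_star p / 2) powr (3 / 2)"
    using assms(5) by (intro mult_mono) auto
  then have "4 \<le> 4 / (1 - \<epsilon>) * (p_star p - 1) ^ 2 * (p_star p / 2) powr (3 / 2)" by simp
  with walsh_span.factorization[OF walsh_span_R_p0_omega[OF assms(1,2)] assms(3)] show ?thesis
    by (meson order_trans)
qed

end
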